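(* Let $\mu\in\mathscr{P}(\mathfrak{L}\times\mathbb{P})$. Then the equation (called the generalized Karcher equation) $$\int_{\mathfrak{L}\times\mathbb{P}}f\left(X^{-1/2}AX^{-1/2}\right)d\mu(f,A)=0$$ has a unique solution $X=X(\mu)$ in $\mathbb{P}$. Moreover this solution is operator monotone in $\mu$: if $\mu_1,\mu_2\in\mathscr{P}(\mathfrak{L}\times\mathbb{P})$ and $\mu_1\leq\mu_2$, then $X(\mu_1)\leq X(\mu_2)$.
   Context: $E$ is a (possibly infinite-dimensional) complex Hilbert space, $S(E)$ is the Banach space of bounded self-adjoint operators on $E$, and $\mathbb{P}\subseteq S(E)$ is the cone of positive definite operators, i.e. $\mathbb{P}=\bigcup_{k\ge 1}\{X\in S(E):\frac1k I\le X\le kI\}$. For $A,B\in S(E)$, $A\le B$ means that $B-A$ is positive semidefinite. $\mathbb{P}$ carries the norm topology. A subset of $\mathbb{P}$ is bounded if it is contained in $\{X: e^{-r}I\le X\le e^{r}I\}$ for some $r<\infty$. A function $f:(0,\infty)\to\mathbb{R}$ is operator monotone if $A\le B$ implies $f(A)\le f(B)$ for all positive definite operators $A,B$ (on any Hilbert space; equivalently, for positive definite matrices of all sizes). $\mathfrak{L}$ is the set of all operator monotone functions $f:(0,\infty)\to\mathbb{R}$ with $f(1)=0$ and $f'(1)=1$; it is equipped with the topology of pointwise convergence. $\mathscr{P}(\mathfrak{L}\times\mathbb{P})$ is the set of Borel probability measures $\mu$ on $\mathfrak{L}\times\mathbb{P}$ with bounded support, meaning $\mu(\operatorname{supp}\mu)=1$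 and $\operatorname{supp}\mu\subseteq\mathfrak{L}\times\{A:e^{-r}I\le A\le e^{r}I\}$ for some $r<\infty$. Integrals of operator-valued functions are weak operator Pettis integrals: $\int g\,d\mu$ is the operator $T\in S(E)$ with $\langle Tx,y\rangle=\int\langle g x,y\rangle d\mu$ for all $x,y\in E$. Order of measures: $\mu_1\le\mu_2$ means that there are a set $\Omega$, a probability space structure $(\mathfrak{L}\times\Omega,\mathcal{A},\pi)$ and measurable maps $F_1,F_2:\mathfrak{L}\times\Omega\to\mathfrak{L}\times\mathbb{P}$ such that $\mu_i$ is the pushforward of $\pi$ under $F_i$ ($i=1,2$), and for all $f\in\mathfrak{L}$, $\omega\in\Omega$ the first components of $F_1(f,\omega)$ and $F_2(f,\omega)$ coincide while the second component of $F_1(f,\omega)$ is $\le$ the second component of $F_2(f,\omega)$. *)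

theory Defs
  imports "HOL-Probability.Probability_Measure" "Jordan_Normal_Form.Schur_Decomposition"
begin

section \<open>Complex Hilbert spaces\<close>

text \<open>The scalar product is linear in the first argument. The zero space is allowed.\<close>

class complex_hilbert_space = banach +
  fixes scaleC :: "complex \<Rightarrow> 'a \<Rightarrow> 'a" (infixr "*\<^sub>C" 75)
    and cinner :: "'a \<Rightarrow> 'a \<Rightarrow> complex"
  assumes scaleC_add_right: "c *\<^sub>C (x + y) = c *\<^sub>C x + c *\<^sub>C y"
    and scaleC_add_left: "(c + d) *\<^sub>C x = c *\<^sub>C x + d *\<^sub>C x"
    and scaleC_scaleC: "c *\<^sub>C d *\<^sub>C x = (c * d) *\<^sub>C x"
    and scaleC_one: "1 *\<^sub>C x = x"
    and scaleR_scaleC: "r *\<^sub>R x = complex_of_real r *\<^sub>C x"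
    and cinner_commute: "cinner x y = cnj (cinner y x)"
    and cinner_add_left: "cinner (x + y) z = cinner x z + cinner y z"
    and cinner_scaleC_left: "cinner (c *\<^sub>C x) y = c * cinner x y"
    and cinner_self_nonneg: "0 \<le> Re (cinner x x)"
    and cinner_self_eq_zero_iff: "cinner x x = 0 \<longleftrightarrow> x = 0"
    and norm_eq_sqrt_cinner: "norm x = sqrt (Re (cinner x x))"


section \<open>Self-adjoint operators and their order\<close>

text \<open>The library type of bounded linear maps is real-linear, so complex linearity is
  required explicitly. The operator norm is the same over both fields.\<close>

definition self_adjoint_ops :: "('e::complex_hilbert_space \<Rightarrow>\<^sub>L 'e) set" where
  "self_adjoint_ops = {T :: 'e \<Rightarrow>\<^sub>L 'e. (\<forall>c x. T (c *\<^sub>C x) = c *\<^sub>C T x) \<and>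
                          (\<forall>x y. cinner (T x) y = cinner x (T y))}"

text \<open>For a self-adjoint \<open>T\<close> the numbers \<open>\<langle>T x, x\<rangle>\<close> are real, so taking the real part
  loses nothing.\<close>

definition pos_semidef :: "('e::complex_hilbert_space \<Rightarrow>\<^sub>L 'e) \<Rightarrow> bool" where
  "pos_semidef T \<longleftrightarrow> T \<in> self_adjoint_ops \<and> (\<forall>x. 0 \<le> Re (cinner (T x) x))"

definition op_le :: "('e::complex_hilbert_space \<Rightarrow>\<^sub>L 'e) \<Rightarrow> ('e \<Rightarrow>\<^sub>L 'e) \<Rightarrow> bool"
    (infix "\<preceq>" 50) where
  "A \<preceq> B \<longleftrightarrow> A \<in> self_adjoint_ops \<and> B \<in> self_adjoint_ops \<and> pos_semidef (B - A)"

definition pos_def_ops :: "('e::complex_hilbert_space \<Rightarrow>\<^sub>L 'e) set" where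
  "pos_def_ops = (\<Union>k\<in>{1::nat..}. {X \<in> self_adjoint_ops.
      (1 / real k) *\<^sub>R id_blinfun \<preceq> X \<and> X \<preceq> real k *\<^sub>R id_blinfun})"

definition op_interval :: "real \<Rightarrow> ('e::complex_hilbert_space \<Rightarrow>\<^sub>L 'e) set" where
  "op_interval r = {A. exp (- r) *\<^sub>R id_blinfun \<preceq> A \<and> A \<preceq> exp r *\<^sub>R id_blinfun}"


section \<open>Continuous functional calculus\<close>

text \<open>Only the real points of the spectrum are collected: the functional calculus is
  used for self-adjoint operators, whose spectrum is real.\<close>

definition real_spectrum :: "('e::complex_hilbert_space \<Rightarrow>\<^sub>L 'e) \<Rightarrow> real set" where
  "real_spectrum T = {t. \<not> (\<exists>S. S o\<^sub>L (T - t *\<^sub>R id_blinfun) = id_blinfun \<and>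
                                (T - t *\<^sub>R id_blinfun) o\<^sub>L S = id_blinfun)}"

definition op_poly :: "real poly \<Rightarrow> ('e::complex_hilbert_space \<Rightarrow>\<^sub>L 'e) \<Rightarrow> ('e \<Rightarrow>\<^sub>L 'e)" where
  "op_poly p T = (\<Sum>i\<le>degree p. poly.coeff p i *\<^sub>R (((\<lambda>S. T o\<^sub>L S) ^^ i) id_blinfun))"

text \<open>For self-adjoint \<open>T\<close> and \<open>f\<close> continuous on the spectrum of \<open>T\<close>, \<open>f(T)\<close> is the
  norm limit of \<open>p\<^sub>n(T)\<close> for any polynomials \<open>p\<^sub>n\<close> converging to \<open>f\<close> uniformly on the spectrum.\<close>

definition op_fun :: "(real \<Rightarrow> real) \<Rightarrow> ('e::complex_hilbert_space \<Rightarrow>\<^sub>L 'e) \<Rightarrow> ('e \<Rightarrow>\<^sub>L 'e)" where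
  "op_fun f T = (THE S. \<exists>p :: nat \<Rightarrow> real poly.
      uniform_limit (real_spectrum T) (\<lambda>n. poly (p n)) f sequentially \<and>
      (\<lambda>n. op_poly (p n) T) \<longlonglongrightarrow> S)"

definition op_inv_sqrt :: "('e::complex_hilbert_space \<Rightarrow>\<^sub>L 'e) \<Rightarrow> ('e \<Rightarrow>\<^sub>L 'e)" where
  "op_inv_sqrt X = op_fun (\<lambda>t. t powr (- 1 / 2)) X"


section \<open>Operator monotone functions\<close>

definition mat_pos_semidef :: "nat \<Rightarrow> complex mat \<Rightarrow> bool" where
  "mat_pos_semidef n A \<longleftrightarrow> A \<in> carrier_mat n n \<and> mat_adjoint A = A \<and>
     (\<forall>v\<in>carrier_vec n. 0 \<le> Re ((A *\<^sub>v v) \<bullet>c v))"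

definition mat_pos_def :: "nat \<Rightarrow> complex mat \<Rightarrow> bool" where
  "mat_pos_def n A \<longleftrightarrow> A \<in> carrier_mat n n \<and> mat_adjoint A = A \<and>
     (\<forall>v\<in>carrier_vec n. v \<noteq> 0\<^sub>v n \<longrightarrow> 0 < Re ((A *\<^sub>v v) \<bullet>c v))"

text \<open>\<open>f(A)\<close> for a Hermitian \<open>n \<times> n\<close> matrix \<open>A\<close>, through a unitary diagonalization.\<close>

definition mat_fun :: "nat \<Rightarrow> (real \<Rightarrow> real) \<Rightarrow> complex mat \<Rightarrow> complex mat" where
  "mat_fun n f A = (THE B. \<exists>U (d :: nat \<Rightarrow> real).
      U \<in> carrier_mat n n \<and> U * mat_adjoint U = 1\<^sub>m n \<and> mat_adjoint U * U = 1\<^sub>m n \<and>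
      A = U * mat_diag n (\<lambda>i. complex_of_real (d i)) * mat_adjoint U \<and>
      B = U * mat_diag n (\<lambda>i. complex_of_real (f (d i))) * mat_adjoint U)"

text \<open>Operator monotonicity on all Hilbert spaces is expressed by monotonicity on positive
  definite matrices of all sizes. It only depends on the values of \<open>f\<close> on \<open>(0,\<infinity>)\<close>.\<close>

definition operator_monotone :: "(real \<Rightarrow> real) \<Rightarrow> bool" where
  "operator_monotone f \<longleftrightarrow> (\<forall>n A B. mat_pos_def n A \<and> mat_pos_def n B \<and>
     mat_pos_semidef n (B - A) \<longrightarrow> mat_pos_semidef n (mat_fun n f B - mat_fun n f A))"

text \<open>Functions on \<open>(0,\<infinity>)\<close> are represented by functions that are \<open>undefined\<close> elsewhere,
  which is also the convention of \<^const>\<open>product_topology\<close>, the topology of pointwise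
  convergence.\<close>

definition op_mono_funs :: "(real \<Rightarrow> real) set" where
  "op_mono_funs = {f \<in> extensional {0<..}.
      operator_monotone f \<and> f 1 = 0 \<and> (f has_real_derivative 1) (at 1)}"

definition op_mono_topology :: "(real \<Rightarrow> real) topology" where
  "op_mono_topology = subtopology (product_topology (\<lambda>_. euclideanreal) {0<..}) op_mono_funs"


section \<open>Probability measures with bounded support\<close>

definition borel_of_topology :: "'b topology \<Rightarrow> 'b measure" where
  "borel_of_topology T = sigma (topspace T) {U. openin T U}"

definition supp_measure :: "'b topology \<Rightarrow> 'b measure \<Rightarrow> 'b set" where
  "supp_measure T \<mu> = {x \<in> topspace T. \<forall>U. openin T U \<and> x \<in> U \<longrightarrow> 0 < emeasure \<mu> U}"

definition LP_topology ::
    "((real \<Rightarrow> real) \<times> ('e::complex_hilbert_space \<Rightarrow>\<^sub>L 'e)) topology" where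
  "LP_topology = prod_topology op_mono_topology (top_of_set pos_def_ops)"

definition bdd_prob_measures ::
    "((real \<Rightarrow> real) \<times> ('e::complex_hilbert_space \<Rightarrow>\<^sub>L 'e)) measure set" where
  "bdd_prob_measures = {\<mu>. prob_space \<mu> \<and> sets \<mu> = sets (borel_of_topology LP_topology) \<and>
      emeasure \<mu> (supp_measure LP_topology \<mu>) = 1 \<and>
      (\<exists>r. supp_measure LP_topology \<mu> \<subseteq> op_mono_funs \<times> op_interval r)}"

text \<open>The set \<open>\<Omega>\<close> may live in any type; the type argument names that type. Since the order
  only occurs as a hypothesis, a theorem that is polymorphic in \<open>'w\<close> covers every choice
  of \<open>\<Omega>\<close>.\<close>

definition measure_le ::
    "'w itself \<Rightarrow> ((real \<Rightarrow> real) \<times> ('e::complex_hilbert_space \<Rightarrow>\<^sub>L 'e)) measure \<Rightarrow>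
      ((real \<Rightarrow> real) \<times> ('e \<Rightarrow>\<^sub>L 'e)) measure \<Rightarrow> bool" where
  "measure_le _ \<mu>\<^sub>1 \<mu>\<^sub>2 \<longleftrightarrow>
    (\<exists>(\<Omega> :: 'w set) (\<pi> :: ((real \<Rightarrow> real) \<times> 'w) measure) F\<^sub>1 F\<^sub>2.
       prob_space \<pi> \<and> space \<pi> = op_mono_funs \<times> \<Omega> \<and>
       F\<^sub>1 \<in> measurable \<pi> (borel_of_topology LP_topology) \<and>
       F\<^sub>2 \<in> measurable \<pi> (borel_of_topology LP_topology) \<and>
       \<mu>\<^sub>1 = distr \<pi> (borel_of_topology LP_topology) F\<^sub>1 \<and>
       \<mu>\<^sub>2 = distr \<pi> (borel_of_topology LP_topology) F\<^sub>2 \<and>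
       (\<forall>f\<in>op_mono_funs. \<forall>\<omega>\<in>\<Omega>.
          fst (F\<^sub>1 (f, \<omega>)) = fst (F\<^sub>2 (f, \<omega>)) \<and> snd (F\<^sub>1 (f, \<omega>)) \<preceq> snd (F\<^sub>2 (f, \<omega>))))"


section \<open>The generalized Karcher equation\<close>

definition has_weak_integral ::
    "'b measure \<Rightarrow> ('b \<Rightarrow> ('e::complex_hilbert_space \<Rightarrow>\<^sub>L 'e)) \<Rightarrow> ('e \<Rightarrow>\<^sub>L 'e) \<Rightarrow> bool" where
  "has_weak_integral \<mu> g T \<longleftrightarrow> T \<in> self_adjoint_ops \<and>
     (\<forall>x y. has_bochner_integral \<mu> (\<lambda>z. cinner (g z x) y) (cinner (T x) y))"

definition karcher_equation ::
    "((real \<Rightarrow> real) \<times> ('e::complex_hilbert_space \<Rightarrow>\<^sub>L 'e)) measure \<Rightarrow> ('e \<Rightarrow>\<^sub>L 'e) \<Rightarrow> bool" where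
  "karcher_equation \<mu> X \<longleftrightarrow>
     has_weak_integral \<mu> (\<lambda>(f, A). op_fun f (op_inv_sqrt X o\<^sub>L A o\<^sub>L op_inv_sqrt X)) 0"

definition karcher_solution ::
    "((real \<Rightarrow> real) \<times> ('e::complex_hilbert_space \<Rightarrow>\<^sub>L 'e)) measure \<Rightarrow> ('e \<Rightarrow>\<^sub>L 'e)" where
  "karcher_solution \<mu> = (THE X. X \<in> pos_def_ops \<and> karcher_equation \<mu> X)"

end

theory Submission
  imports Defs "HOL-Computational_Algebra.Fundamental_Theorem_Algebra"
begin

text \<open>
  Write \<open>P\<^sub>f(X, A) = X\<^sup>1\<^sup>/\<^sup>2 f(X\<^sup>-\<^sup>1\<^sup>/\<^sup>2 A X\<^sup>-\<^sup>1\<^sup>/\<^sup>2) X\<^sup>1\<^sup>/\<^sup>2\<close>. After a congruence the generalized Karcher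
  equation says that \<open>G(X) = \<integral> P\<^sub>f(X, A) d\<mu>(f, A)\<close> vanishes. The proof rests on one inequality for \<open>P\<^sub>f\<close>,
  \<open>comparison_op_mono\<close>: if \<open>X \<le> c Z\<close> with \<open>c \<ge> 1\<close> and \<open>A \<le> A'\<close>, then for all vectors \<open>v\<close>
  \<open>\<langle>P\<^sub>f(X, A) v, v\<rangle> \<le> c \<langle>P\<^sub>f(Z, A') v, v\<rangle> - \<kappa> (c - 1) \<parallel>v\<parallel>\<^sup>2 + K \<parallel>(c Z - X) v\<parallel> \<parallel>v\<parallel>\<close>,
  with \<open>\<kappa> > 0\<close> and \<open>K\<close> depending only on an order interval that contains the operators. It says that \<open>P\<^sub>f\<close> is
  quasi-monotone in \<open>X\<close> (the last term vanishes when \<open>v\<close> is in the kernel of \<open>c Z - X\<close>), monotone in \<open>A\<close>, and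
  strictly subhomogeneous.

  For the Moebius kernels \<open>f\<^sub>s(t) = (t - 1) / ((1 - s) t + s)\<close>, \<open>0 \<le> s \<le> 1\<close>, the inequality follows from a
  variational formula: \<open>\<langle>P\<^sub>f(X, A) v, v\<rangle>\<close> is a minimum of expressions that are linear in \<open>(X, A)\<close>
  (\<open>mobius_variational\<close>, \<open>comparison_mobius\<close>). It passes to convex combinations and limits, and by Loewner's
  theorem these exhaust the normalized operator monotone functions (\<open>op_mono_funs_uniform_hull\<close>).
  Loewner's theorem is proved by duality. A functional with finite support that is nonnegative on the kernels corresponds to a
  polynomial that is nonnegative on a half-line, hence to a sum of squares, and each square is tested by a pair of
  matrices with interlacing spectra (\<open>operator_monotone_interlacing\<close>, \<open>operator_monotone_dual_cone\<close>).
  Hence a function that is not in the closed convex hull of the kernels is not operator monotone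
  (\<open>op_mono_funs_pointwise_hull\<close>).

  Given the inequality, consider the Euler step \<open>X \<mapsto> X + h G(X)\<close>. The failure of monotonicity,
  \<open>h K \<parallel>D v\<parallel> \<parallel>v\<parallel>\<close> with \<open>D = c Z - X\<close>, is absorbed by \<open>\<langle>D v, v\<rangle> \<ge> \<parallel>D v\<parallel>\<^sup>2 / \<parallel>D\<parallel>\<close> up to
  \<open>O(h\<^sup>2 \<parallel>D\<parallel>)\<close>, while strict subhomogeneity gains \<open>h \<kappa> (c - 1)\<close> (\<open>euler_comparison\<close>). For small \<open>h\<close> the gain
  wins. So the Euler step is a strict contraction for a Thompson type metric on an invariant order interval, and its fixed point
  solves the equation (\<open>karcher_solution_exists\<close>). If \<open>X\<close> and \<open>Y\<close> solve the equations of \<open>\<mu>\<^sub>1 \<le> \<mu>\<^sub>2\<close>, the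
  least \<open>c \<ge> 1\<close> with \<open>X \<le> c Y\<close> is \<open>1\<close>, since a larger one could be improved by an Euler step
  (\<open>solution_comparison\<close>); this gives monotonicity, and uniqueness for \<open>\<mu>\<^sub>1 = \<mu>\<^sub>2\<close>.\<close>

section \<open>Polynomials that are nonnegative on a half-line\<close>

lemma map_poly_of_real_add:
  "map_poly complex_of_real (p + q) = map_poly complex_of_real p + map_poly complex_of_real q"
  by (rule poly_eqI) (simp add: coeff_map_poly)

lemma map_poly_of_real_mult:
  "map_poly complex_of_real (p * q) = map_poly complex_of_real p * map_poly complex_of_real q"
  by (rule poly_eqI) (simp add: coeff_map_poly coeff_mult)

lemma map_poly_of_real_pCons:
  "map_poly complex_of_real (pCons a p) = pCons (of_real a) (map_poly complex_of_real p)"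
  by (rule poly_eqI) (simp add: coeff_map_poly coeff_pCons split: nat.split)

lemma poly_map_poly_of_real:
  "poly (map_poly complex_of_real p) (of_real x) = of_real (poly p x)"
  by (induction p) (simp_all add: map_poly_of_real_pCons)

text \<open>The quadratic case collects a pair of conjugate roots \<open>a \<plusminus> \<i> b\<close>. The lemma is used twice:
  for sums of squares, where the quadratic is a sum of two squares, and for the spectrum of a self-adjoint
  operator \<open>T\<close>, where \<open>(T - a)\<^sup>2 + b\<^sup>2\<close> is coercive.\<close>

lemma real_poly_factor:
  fixes p :: "real poly"
  assumes "degree p > 0"
  obtains (linear) r q where "p = [:- r, 1:] * q"
  | (quadratic) a b q where "b \<noteq> 0" "p = [:a\<^sup>2 + b\<^sup>2, - 2 * a, 1:] * q"
proof -
  let ?P = "map_poly complex_of_real p"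
  have "degree ?P = degree p" by simp
  with assms have "\<not> constant (poly ?P)" by (simp add: constant_degree)
  then obtain z where z: "poly ?P z = 0" using fundamental_theorem_of_algebra by blast
  show ?thesis
  proof (cases "Im z = 0")
    case True
    then have "z = complex_of_real (Re z)" by (simp add: complex_eq_iff)
    then have "poly p (Re z) = 0" using z by (metis of_real_eq_0_iff poly_map_poly_of_real)
    then have "[:- Re z, 1:] dvd p" by (simp add: poly_eq_0_iff_dvd)
    then show ?thesis using linear by (auto elim: dvdE)
  next
    case False
    define d where "d = [:(Re z)\<^sup>2 + (Im z)\<^sup>2, - 2 * Re z, 1:]"
    have d0: "poly (map_poly complex_of_real d) z = 0"
      by (simp add: d_def map_poly_of_real_pCons complex_eq_iff algebra_simps power2_eq_square)
    have dd: "degree d = 2" by (simp add: d_def)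
    define m where "m = p mod d"
    have pm: "p = d * (p div d) + m" by (simp add: m_def)
    have "degree m < 2" using degree_mod_less'[of d p] dd
      by (metis degree_0 degree_mod_less m_def pos2 zero_neq_numeral)
    have m0: "poly (map_poly complex_of_real m) z = 0"
      using z d0 by (subst (asm) pm) (simp add: map_poly_of_real_add map_poly_of_real_mult)
    obtain u v where m: "m = [:u, v:]"
    proof -
      have "m = [:coeff m 0, coeff m 1:]"
        by (rule poly_eqI) (use \<open>degree m < 2\<close> in \<open>auto simp: coeff_pCons coeff_eq_0 split: nat.splits\<close>)
      then show ?thesis using that by blast
    qed
    have "m = 0" using m0 False by (auto simp: m map_poly_of_real_pCons complex_eq_iff)
    then show ?thesis using pm quadratic[of "Im z" "Re z" "p div d"] False d_def by simp
  qed
qed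

text \<open>The cone of the polynomials \<open>\<Sum> q\<^sup>2 + x \<Sum> r\<^sup>2\<close>. The bound \<open>d\<close> on the degree of every single
  summand matters: it decides how many nodes a divided difference must have to be paired with the summand.\<close>

inductive halfline_sos :: "nat \<Rightarrow> real poly \<Rightarrow> bool" for d where
  halfline_sos_zero: "halfline_sos d 0"
| halfline_sos_square: "2 * degree q \<le> d \<Longrightarrow> halfline_sos d (q\<^sup>2)"
| halfline_sos_X_square: "2 * degree q + 1 \<le> d \<Longrightarrow> halfline_sos d ([:0, 1:] * q\<^sup>2)"
| halfline_sos_add: "halfline_sos d p \<Longrightarrow> halfline_sos d q \<Longrightarrow> halfline_sos d (p + q)"

lemma halfline_sos_mult_square:
  assumes "halfline_sos e q" "2 * degree r \<le> d"
  shows "halfline_sos (d + e) (r\<^sup>2 * q)"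
  using assms(1)
proof induction
  case halfline_sos_zero
  show ?case by (simp add: halfline_sos.halfline_sos_zero)
next
  case (halfline_sos_square q)
  have "2 * degree (r * q) \<le> d + e" using degree_mult_le[of r q] assms(2) halfline_sos_square by linarith
  then show ?case using halfline_sos.halfline_sos_square[of "r * q"] by (simp add: power_mult_distrib)
next
  case (halfline_sos_X_square q)
  have "2 * degree (r * q) + 1 \<le> d + e" using degree_mult_le[of r q] assms(2) halfline_sos_X_square by linarith
  then have "halfline_sos (d + e) ([:0, 1:] * (r * q)\<^sup>2)" by (rule halfline_sos.halfline_sos_X_square)
  then show ?case by (simp only: power_mult_distrib mult.left_commute mult.assoc)
next
  case (halfline_sos_add p q)
  then show ?case by (simp add: distrib_left halfline_sos.halfline_sos_add)
qed

lemma halfline_sos_mult_X_square: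
  assumes "halfline_sos e q" "2 * degree r + 1 \<le> d"
  shows "halfline_sos (d + e) ([:0, 1:] * r\<^sup>2 * q)"
  using assms(1)
proof induction
  case halfline_sos_zero
  show ?case by (simp add: halfline_sos.halfline_sos_zero)
next
  case (halfline_sos_square q)
  have "2 * degree (r * q) + 1 \<le> d + e" using degree_mult_le[of r q] assms(2) halfline_sos_square by linarith
  then have "halfline_sos (d + e) ([:0, 1:] * (r * q)\<^sup>2)" by (rule halfline_sos.halfline_sos_X_square)
  then show ?case by (simp only: power_mult_distrib mult.left_commute mult.assoc)
next
  case (halfline_sos_X_square q)
  have "degree ([:0, 1:] * (r * q)) \<le> 1 + (degree r + degree q)"
    using degree_mult_le[of "[:0, 1::real:]" "r * q"] degree_mult_le[of r q] by simp
  then have "2 * degree ([:0, 1:] * (r * q)) \<le> d + e"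
    using assms(2) halfline_sos_X_square by linarith
  then have "halfline_sos (d + e) (([:0, 1:] * (r * q))\<^sup>2)" by (rule halfline_sos.halfline_sos_square)
  moreover have "([:0, 1:] * (r * q))\<^sup>2 = [:0, 1:] * r\<^sup>2 * ([:0, 1:] * q\<^sup>2)"
    by (simp only: power2_eq_square ac_simps)
  ultimately show ?case by simp
next
  case (halfline_sos_add p q)
  then show ?case by (simp only: distrib_left halfline_sos.halfline_sos_add)
qed

text \<open>The cone is multiplicative because \<open>x r\<^sup>2 \<cdot> x r'\<^sup>2\<close> is the square of \<open>x r r'\<close>, so a polynomial
  may be treated factor by factor.\<close>

lemma halfline_sos_mult:
  assumes "halfline_sos d p" "halfline_sos e q"
  shows "halfline_sos (d + e) (p * q)"
  using assms(1)
proof induction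
  case halfline_sos_zero
  show ?case by (simp add: halfline_sos.halfline_sos_zero)
next
  case (halfline_sos_square r)
  then show ?case using halfline_sos_mult_square assms(2) by blast
next
  case (halfline_sos_X_square r)
  then show ?case using halfline_sos_mult_X_square assms(2) by blast
next
  case (halfline_sos_add p p')
  then show ?case by (simp only: distrib_right halfline_sos.halfline_sos_add)
qed

lemma halfline_sos_const: "0 \<le> c \<Longrightarrow> halfline_sos d [:c:]"
  using halfline_sos_square[of "[:sqrt c:]" d] by (simp add: power2_eq_square)

lemma halfline_sos_linear: "0 \<le> c \<Longrightarrow> halfline_sos 1 [:c, 1:]"
  using halfline_sos_add[OF halfline_sos_const[of c 1] halfline_sos_X_square[of 1 1]] by simp

lemma halfline_sos_quadratic: "halfline_sos 2 [:a\<^sup>2 + b\<^sup>2, - 2 * a, 1:]"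
  using halfline_sos_add[OF halfline_sos_square[of "[:- a, 1:]" 2] halfline_sos_const[of "b\<^sup>2" 2]]
  by (simp add: power2_eq_square add.commute)

lemma poly_nonneg_closure:
  fixes q :: "real poly"
  assumes "\<And>x. 0 \<le> x \<Longrightarrow> x \<noteq> r \<Longrightarrow> 0 \<le> poly q x" "0 \<le> r"
  shows "0 \<le> poly q r"
proof -
  have "(poly q \<longlongrightarrow> poly q r) (at_right r)"
    by (intro tendsto_intros) 
  moreover have "eventually (\<lambda>x. 0 \<le> poly q x) (at_right r)"
    unfolding eventually_at_right_field using assms by (intro exI[of _ "r+1"]) auto
  ultimately show ?thesis by (intro tendsto_lowerbound[of "poly q"]) auto
qed

text \<open>Factors are split off one root at a time: a root \<open>r \<le> 0\<close> gives the factor \<open>x + \<bar>r\<bar>\<close> of the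
  cone, a root \<open>r > 0\<close> is at least double because the polynomial does not change sign there, and a pair of
  conjugate roots gives a sum of two squares.\<close>

lemma nonneg_poly_imp_halfline_sos:
  fixes p :: "real poly"
  assumes "\<And>x. 0 \<le> x \<Longrightarrow> 0 \<le> poly p x"
  shows "halfline_sos (degree p) p"
  using assms
proof (induction "degree p" arbitrary: p rule: less_induct)
  case less
  show ?case
  proof (cases "degree p = 0")
    case True
    then obtain c where "p = [:c:]" by (rule degree_eq_zeroE)
    then show ?thesis using less.prems[of 0] by (simp add: halfline_sos_const)
  next
    case False
    have p0: "p \<noteq> 0" using False by auto
    from False have "degree p > 0" by simp
    then show ?thesis
    proof (cases rule: real_poly_factor)
      case (linear r q)
      have q0: "q \<noteq> 0" using p0 linear by auto
      have deg: "degree p = 1 + degree q" unfolding linear using q0 by (subst degree_mult_eq) auto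
      show ?thesis
      proof (cases "r \<le> 0")
        case True
        have pos: "0 \<le> poly q y" if "0 \<le> y" "y \<noteq> 0" for y
        proof -
          have "0 \<le> (y - r) * poly q y" using less.prems[OF that(1)] unfolding linear by (simp add: algebra_simps)
          moreover have "0 < y - r" using that True by simp
          ultimately show ?thesis by (simp only: zero_le_mult_iff) linarith
        qed
        have "0 \<le> poly q x" if "0 \<le> x" for x
          using poly_nonneg_closure[OF pos, of 0] pos[OF that] by (cases "x = 0") auto
        then have "halfline_sos (degree q) q" using less.hyps deg by simp
        then show ?thesis
          using halfline_sos_mult[OF halfline_sos_linear, of "- r"] True linear deg by simp
      next
        case False
        \<comment> \<open>A sign change of the cofactor at \<open>r\<close> shows that \<open>r\<close> is a root of it as well.\<close>
        have "0 \<le> poly q r"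
        proof (rule tendsto_lowerbound[of "poly q" _ "at_right r"])
          show "(poly q \<longlongrightarrow> poly q r) (at_right r)" by (intro tendsto_intros)
          show "eventually (\<lambda>x. 0 \<le> poly q x) (at_right r)"
            unfolding eventually_at_right_field
          proof (intro exI[of _ "r+1"] conjI allI impI)
            fix y assume "r < y"
            moreover have "0 \<le> (y - r) * poly q y"
              using less.prems[of y] \<open>r < y\<close> False unfolding linear by (simp add: algebra_simps)
            ultimately show "0 \<le> poly q y" by (simp only: zero_le_mult_iff) linarith
          qed simp
        qed simp
        moreover have "poly q r \<le> 0"
        proof (rule tendsto_upperbound[of "poly q" _ "at_left r"])
          show "(poly q \<longlongrightarrow> poly q r) (at_left r)" by (intro tendsto_intros)
          show "eventually (\<lambda>x. poly q x \<le> 0) (at_left r)"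
            unfolding eventually_at_left_field
          proof (intro exI[of _ 0] conjI allI impI)
            show "0 < r" using False by simp
            fix y assume "0 < y" "y < r"
            moreover have "0 \<le> (y - r) * poly q y"
              using less.prems[of y] \<open>0 < y\<close> unfolding linear by (simp add: algebra_simps)
            ultimately show "poly q y \<le> 0" by (simp only: zero_le_mult_iff) linarith
          qed
        qed simp
        ultimately have "poly q r = 0" by simp
        then obtain q' where q: "q = [:- r, 1:] * q'" by (auto simp: poly_eq_0_iff_dvd elim: dvdE)
        have q'0: "q' \<noteq> 0" using q0 q by auto
        have deg': "degree q = 1 + degree q'" unfolding q using q'0 by (subst degree_mult_eq) auto
        have p: "p = [:- r, 1:]\<^sup>2 * q'" unfolding linear q by (simp only: power2_eq_square mult.assoc)
        have pos: "0 \<le> poly q' x" if "0 \<le> x" "x \<noteq> r" for x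
        proof -
          have "0 \<le> (x - r)\<^sup>2 * poly q' x" using less.prems[OF that(1)] unfolding p by simp
          then show ?thesis using that by (simp add: zero_le_mult_iff)
        qed
        have "0 \<le> poly q' x" if "0 \<le> x" for x
          using poly_nonneg_closure[OF pos, of r] pos[OF that] False by (cases "x = r") auto
        then have "halfline_sos (degree q') q'" using less.hyps deg deg' by simp
        from halfline_sos_mult_square[OF this, of "[:- r, 1:]" 2] show ?thesis
          unfolding p[symmetric] using deg deg' by simp
      qed
    next
      case (quadratic a b q)
      have q0: "q \<noteq> 0" using p0 quadratic by auto
      have deg: "degree p = 2 + degree q" unfolding quadratic using q0 by (subst degree_mult_eq) auto
      have pos: "poly [:a\<^sup>2 + b\<^sup>2, - 2 * a, 1:] x > 0" for x
      proof -
        have "poly [:a\<^sup>2 + b\<^sup>2, - 2 * a, 1:] x = (x - a)\<^sup>2 + b\<^sup>2" by (simp add: power2_eq_square algebra_simps)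
        moreover have "(x - a)\<^sup>2 + b\<^sup>2 > 0" using quadratic(1) by (simp add: sum_power2_gt_zero_iff)
        ultimately show ?thesis by (simp only:)
      qed
      have "0 \<le> poly q x" if "0 \<le> x" for x
        using less.prems[OF that] pos[of x] unfolding quadratic poly_mult by (simp only: zero_le_mult_iff) linarith
      then have "halfline_sos (degree q) q" using less.hyps deg by simp
      then show ?thesis using halfline_sos_mult[OF halfline_sos_quadratic] quadratic deg by simp
    qed
  qed
qed

section \<open>Matrix monotonicity tested on interlacing spectra\<close>

lemma dim_mat_adjoint [simp]:
  "dim_row (mat_adjoint A) = dim_col A" "dim_col (mat_adjoint A) = dim_row A"
  by (simp_all add: mat_adjoint_def)

lemma mat_adjoint_carrier [simp]: "A \<in> carrier_mat n m \<Longrightarrow> mat_adjoint A \<in> carrier_mat m n"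
  by (rule carrier_matI) auto

lemma mat_adjoint_index [simp]:
  "i < dim_col A \<Longrightarrow> j < dim_row A \<Longrightarrow> mat_adjoint A $$ (i, j) = cnj (A $$ (j, i))"
  by (simp add: mat_adjoint_def mat_of_rows_index)

definition unitary_conj :: "nat \<Rightarrow> complex mat \<Rightarrow> (nat \<Rightarrow> real) \<Rightarrow> complex mat" where
  "unitary_conj n U d = U * mat_diag n (\<lambda>i. complex_of_real (d i)) * mat_adjoint U"

lemma unitary_conj_carrier [simp]: "U \<in> carrier_mat n n \<Longrightarrow> unitary_conj n U d \<in> carrier_mat n n"
  unfolding unitary_conj_def
  by (intro mult_carrier_mat[of _ n n _ n] mat_adjoint_carrier mat_diag_dim)

lemma unitary_conj_index:
  assumes "U \<in> carrier_mat n n" "i < n" "k < n"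
  shows "unitary_conj n U d $$ (i, k) = (\<Sum>j<n. U $$ (i, j) * of_real (d j) * cnj (U $$ (k, j)))"
  unfolding unitary_conj_def mat_diag_mult_right[OF assms(1)]
  using assms carrier_matD[OF assms(1)]
  by (subst index_mult_mat) (auto simp: scalar_prod_def atLeast0LessThan intro!: sum.cong)

lemma unitary_conj_adjoint:
  assumes "U \<in> carrier_mat n n"
  shows "mat_adjoint (unitary_conj n U d) = unitary_conj n U d"
proof (rule eq_matI)
  have c: "unitary_conj n U d \<in> carrier_mat n n" using assms by simp
  fix i j assume "i < dim_row (unitary_conj n U d)" "j < dim_col (unitary_conj n U d)"
  then have "i < n" "j < n" using c by auto
  then show "mat_adjoint (unitary_conj n U d) $$ (i, j) = unitary_conj n U d $$ (i, j)"
    using assms carrier_matD[OF c] by (simp add: unitary_conj_index ac_simps)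
qed (use assms in \<open>auto simp: unitary_conj_def\<close>)

lemma quadratic_form_eq_double_sum:
  fixes A :: "complex mat"
  assumes "A \<in> carrier_mat n n" "v \<in> carrier_vec n"
  shows "(A *\<^sub>v v) \<bullet>c v = (\<Sum>i<n. \<Sum>k<n. A $$ (i, k) * v $ k * cnj (v $ i))"
  using assms by (auto simp: scalar_prod_def sum_distrib_right atLeast0LessThan conjugate_complex_def intro!: sum.cong)

lemma unitary_conj_quadratic_form:
  assumes "U \<in> carrier_mat n n" "v \<in> carrier_vec n"
  shows "Re ((unitary_conj n U d *\<^sub>v v) \<bullet>c v) = (\<Sum>j<n. d j * (cmod (\<Sum>i<n. cnj (U $$ (i, j)) * v $ i))\<^sup>2)"
proof -
  have "(unitary_conj n U d *\<^sub>v v) \<bullet>c v =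
      (\<Sum>i<n. \<Sum>k<n. \<Sum>j<n. U $$ (i, j) * of_real (d j) * cnj (U $$ (k, j)) * v $ k * cnj (v $ i))"
    using assms by (simp add: quadratic_form_eq_double_sum[of _ n] unitary_conj_index sum_distrib_right)
  also have "\<dots> = (\<Sum>i<n. \<Sum>j<n. \<Sum>k<n. U $$ (i, j) * of_real (d j) * cnj (U $$ (k, j)) * v $ k * cnj (v $ i))"
    by (intro sum.cong refl sum.swap)
  also have "\<dots> = (\<Sum>j<n. \<Sum>i<n. \<Sum>k<n. U $$ (i, j) * of_real (d j) * cnj (U $$ (k, j)) * v $ k * cnj (v $ i))"
    by (rule sum.swap)
  also have "\<dots> = (\<Sum>j<n. of_real (d j) * ((\<Sum>k<n. cnj (U $$ (k, j)) * v $ k) * cnj (\<Sum>i<n. cnj (U $$ (i, j)) * v $ i)))"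
  proof (intro sum.cong refl)
    fix j
    have "(\<Sum>k<n. cnj (U $$ (k, j)) * v $ k) * cnj (\<Sum>i<n. cnj (U $$ (i, j)) * v $ i)
        = (\<Sum>i<n. \<Sum>k<n. cnj (U $$ (k, j)) * v $ k * (U $$ (i, j) * cnj (v $ i)))"
      by (simp add: cnj_sum sum_product) (rule sum.swap)
    then show "(\<Sum>i<n. \<Sum>k<n. U $$ (i, j) * of_real (d j) * cnj (U $$ (k, j)) * v $ k * cnj (v $ i)) =
        of_real (d j) * ((\<Sum>k<n. cnj (U $$ (k, j)) * v $ k) * cnj (\<Sum>i<n. cnj (U $$ (i, j)) * v $ i))"
      by (simp add: sum_distrib_left ac_simps)
  qed
  also have "\<dots> = of_real (\<Sum>j<n. d j * (cmod (\<Sum>i<n. cnj (U $$ (i, j)) * v $ i))\<^sup>2)"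
    by (simp only: complex_norm_square of_real_sum of_real_mult)
  finally show ?thesis by simp
qed

lemma unitary_conj_pos_def:
  assumes U: "U \<in> carrier_mat n n" "U * mat_adjoint U = 1\<^sub>m n" and d: "\<And>j. j < n \<Longrightarrow> 0 < d j"
  shows "mat_pos_def n (unitary_conj n U d)"
  unfolding mat_pos_def_def
proof (intro conjI ballI impI)
  fix v :: "complex vec" assume v: "v \<in> carrier_vec n" "v \<noteq> 0\<^sub>v n"
  have "\<exists>j<n. (\<Sum>i<n. cnj (U $$ (i, j)) * v $ i) \<noteq> 0"
  proof (rule ccontr)
    assume *: "\<not> ?thesis"
    have "mat_adjoint U *\<^sub>v v = 0\<^sub>v n"
      using U v * by (intro eq_vecI) (auto simp: scalar_prod_def atLeast0LessThan)
    then have "(U * mat_adjoint U) *\<^sub>v v = 0\<^sub>v n"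
      using U v by (subst assoc_mult_mat_vec[of _ n n _ n]) (auto intro!: eq_vecI simp: scalar_prod_def)
    then show False using U v by simp
  qed
  then obtain j where "j < n" "(\<Sum>i<n. cnj (U $$ (i, j)) * v $ i) \<noteq> 0" by blast
  then show "0 < Re ((unitary_conj n U d *\<^sub>v v) \<bullet>c v)"
    unfolding unitary_conj_quadratic_form[OF U(1) v(1)] using d
    by (intro sum_pos2[of _ j]) (auto intro!: mult_nonneg_nonneg[OF less_imp_le])
qed (use U in \<open>auto simp: unitary_conj_adjoint\<close>)

text \<open>Two unitary diagonalizations are intertwined by \<open>W = V\<^sup>* U\<close>. Its entry \<open>(i, j)\<close> vanishes unless
  \<open>d j = e i\<close>, so \<open>W\<close> also intertwines the diagonal matrices of the values of \<open>f\<close>; hence the function of a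
  matrix does not depend on the diagonalization.\<close>

lemma mat_fun_unitary_conj:
  assumes U: "U \<in> carrier_mat n n" "U * mat_adjoint U = 1\<^sub>m n"
  shows "mat_fun n f (unitary_conj n U d) = unitary_conj n U (\<lambda>i. f (d i))"
proof -
  have U': "mat_adjoint U * U = 1\<^sub>m n" using U by (intro mat_mult_left_right_inverse[of U n]) auto
  show ?thesis
    unfolding mat_fun_def
  proof (rule the_equality)
    show "\<exists>V e. V \<in> carrier_mat n n \<and> V * mat_adjoint V = 1\<^sub>m n \<and> mat_adjoint V * V = 1\<^sub>m n \<and>
      unitary_conj n U d = V * mat_diag n (\<lambda>i. complex_of_real (e i)) * mat_adjoint V \<and>
      unitary_conj n U (\<lambda>i. f (d i)) = V * mat_diag n (\<lambda>i. complex_of_real (f (e i))) * mat_adjoint V"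
      using U U' unfolding unitary_conj_def by blast
  next
    fix B
    assume "\<exists>V e. V \<in> carrier_mat n n \<and> V * mat_adjoint V = 1\<^sub>m n \<and> mat_adjoint V * V = 1\<^sub>m n \<and>
      unitary_conj n U d = V * mat_diag n (\<lambda>i. complex_of_real (e i)) * mat_adjoint V \<and>
      B = V * mat_diag n (\<lambda>i. complex_of_real (f (e i))) * mat_adjoint V"
    then obtain V e where V: "V \<in> carrier_mat n n" "V * mat_adjoint V = 1\<^sub>m n" "mat_adjoint V * V = 1\<^sub>m n"
      and e: "U * mat_diag n (\<lambda>i. complex_of_real (d i)) * mat_adjoint U = V * mat_diag n (\<lambda>i. complex_of_real (e i)) * mat_adjoint V"
      and B: "B = V * mat_diag n (\<lambda>i. complex_of_real (f (e i))) * mat_adjoint V"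
      unfolding unitary_conj_def by blast
    let ?D = "\<lambda>d. mat_diag n (\<lambda>i. complex_of_real (d i))"
    let ?Us = "mat_adjoint U" and ?Vs = "mat_adjoint V"
    have cUs: "?Us \<in> carrier_mat n n" and cVs: "?Vs \<in> carrier_mat n n" using U V by auto
    note c = U(1) V(1) cUs cVs
    define W where "W = ?Vs * U"
    have cW: "W \<in> carrier_mat n n" using c unfolding W_def by auto
    have DD: "?D g \<in> carrier_mat n n" for g by simp
    have cancel: "?Vs * (V * X) = X" "V * (?Vs * X) = X" if "X \<in> carrier_mat n n" for X
      using c V that by (simp_all add: assoc_mult_mat[of _ n n _ n _ n, symmetric] del: assoc_mult_mat)
    note cs = mult_carrier_mat[of _ n n _ n] c DD
    have "W * ?D d = ?Vs * (U * ?D d * ?Us) * U"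
      unfolding W_def by (simp add: assoc_mult_mat[of _ n n _ n _ n] cs U' right_mult_one_mat[OF DD])
    also have "\<dots> = ?D e * W"
      unfolding W_def e by (simp add: assoc_mult_mat[of _ n n _ n _ n] cs cancel)
    finally have WD: "W * ?D d = ?D e * W" .
    have "W $$ (i, j) * f (d j) = f (e i) * W $$ (i, j)" if "i < n" "j < n" for i j
    proof -
      have "(W * ?D d) $$ (i, j) = (?D e * W) $$ (i, j)" using WD by simp
      then have "W $$ (i, j) * d j = e i * W $$ (i, j)"
        using that by (simp add: mat_diag_mult_left[OF cW] mat_diag_mult_right[OF cW])
      then show ?thesis by auto
    qed
    then have Wf: "W * ?D (\<lambda>i. f (d i)) = ?D (\<lambda>i. f (e i)) * W"
      using cW by (intro eq_matI) (auto simp: mat_diag_mult_left[OF cW] mat_diag_mult_right[OF cW])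
    have "U * ?D (\<lambda>i. f (d i)) * ?Us = V * (W * ?D (\<lambda>i. f (d i))) * ?Us"
      unfolding W_def by (simp add: assoc_mult_mat[of _ n n _ n _ n] cs cancel)
    also have "\<dots> = V * ?D (\<lambda>i. f (e i)) * ?Vs"
      unfolding Wf unfolding W_def by (simp add: assoc_mult_mat[of _ n n _ n _ n] cs U right_mult_one_mat[OF cVs])
    finally show "B = unitary_conj n U (\<lambda>i. f (d i))" unfolding B unitary_conj_def by simp
  qed
qed

text \<open>Operator monotonicity for the pair \<open>A = diag(lam)\<close>, \<open>B = V diag(mu) V\<^sup>T\<close> with \<open>B - A = a a\<^sup>T\<close>,
  tested on a real vector \<open>x\<close>. From here on matrices are replaced by sums over the two spectra.\<close>

lemma operator_monotone_orthogonal: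
  fixes V :: "nat \<Rightarrow> nat \<Rightarrow> real" and x :: "nat \<Rightarrow> real"
  assumes f: "operator_monotone f"
    and orth: "\<And>j k. j < n \<Longrightarrow> k < n \<Longrightarrow> (\<Sum>i<n. V i j * V i k) = (if j = k then 1 else 0)"
    and pos: "\<And>i. i < n \<Longrightarrow> 0 < lam i" "\<And>j. j < n \<Longrightarrow> 0 < mu j"
    and rank1: "\<And>i k. i < n \<Longrightarrow> k < n \<Longrightarrow> (\<Sum>j<n. V i j * mu j * V k j) = (if i = k then lam i else 0) + a i * a k"
  shows "(\<Sum>i<n. f (lam i) * (x i)\<^sup>2) \<le> (\<Sum>j<n. f (mu j) * (\<Sum>i<n. V i j * x i)\<^sup>2)"
proof -
  define U where "U = Matrix.mat n n (\<lambda>(i, j). complex_of_real (V i j))"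
  have cU: "U \<in> carrier_mat n n" by (simp add: U_def)
  have "mat_adjoint U * U = 1\<^sub>m n"
  proof (rule eq_matI)
    fix j k assume "j < dim_row (1\<^sub>m n :: complex mat)" "k < dim_col (1\<^sub>m n :: complex mat)"
    then have "j < n" "k < n" by auto
    then have "(mat_adjoint U * U) $$ (j, k) = (\<Sum>i<n. complex_of_real (V i j * V i k))"
      by (simp add: U_def scalar_prod_def atLeast0LessThan)
    also have "\<dots> = complex_of_real (\<Sum>i<n. V i j * V i k)" by simp
    also have "\<dots> = (1\<^sub>m n) $$ (j, k)" using \<open>j < n\<close> \<open>k < n\<close> by (subst orth) auto
    finally show "(mat_adjoint U * U) $$ (j, k) = (1\<^sub>m n) $$ (j, k)" .
  qed (use cU in auto)
  then have UU: "U * mat_adjoint U = 1\<^sub>m n"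
    using cU mat_mult_left_right_inverse[of "mat_adjoint U" n U] by auto
  have c1: "(1\<^sub>m n :: complex mat) \<in> carrier_mat n n" and one: "(1\<^sub>m n :: complex mat) * mat_adjoint (1\<^sub>m n) = 1\<^sub>m n"
  proof -
    have "mat_adjoint (1\<^sub>m n :: complex mat) = 1\<^sub>m n"
      by (rule eq_matI) auto
    then show "(1\<^sub>m n :: complex mat) * mat_adjoint (1\<^sub>m n) = 1\<^sub>m n" by simp
  qed simp
  note dims = carrier_matD[OF unitary_conj_carrier[OF c1]] carrier_matD[OF unitary_conj_carrier[OF cU]]
  let ?A = "unitary_conj n (1\<^sub>m n) lam" and ?B = "unitary_conj n U mu"
  have ent: "(?B - ?A) $$ (i, k) = complex_of_real (a i * a k)" if "i < n" "k < n" for i k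
  proof -
    have "?A $$ (i, k) = (\<Sum>j<n. if j = i then if i = k then of_real (lam i) else 0 else 0)"
      using that by (subst unitary_conj_index[OF c1]) (auto intro!: sum.cong simp del: sum.delta sum.delta')
    also have "\<dots> = (if i = k then of_real (lam i) else 0)" using that by simp
    finally have A: "?A $$ (i, k) = (if i = k then of_real (lam i) else 0)" .
    have "?B $$ (i, k) = of_real (\<Sum>j<n. V i j * mu j * V k j)"
      using that by (subst unitary_conj_index[OF cU]) (auto simp: U_def)
    with A show ?thesis using that dims unfolding rank1[OF that] by simp
  qed
  have cBA: "?B - ?A \<in> carrier_mat n n" using cU c1 by (intro minus_carrier_mat) auto
  have adj: "mat_adjoint (?B - ?A) = ?B - ?A"
  proof (rule eq_matI)
    fix i j assume "i < dim_row (?B - ?A)" "j < dim_col (?B - ?A)"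
    then have ij: "i < n" "j < n" using cBA by auto
    then have "mat_adjoint (?B - ?A) $$ (i, j) = cnj ((?B - ?A) $$ (j, i))"
      using cBA by (intro mat_adjoint_index) auto
    then show "mat_adjoint (?B - ?A) $$ (i, j) = (?B - ?A) $$ (i, j)"
      using ij by (simp only: ent complex_cnj_complex_of_real mult.commute)
  qed (use cBA dims in auto)
  have "mat_pos_semidef n (?B - ?A)"
    unfolding mat_pos_semidef_def
  proof (intro conjI ballI)
    fix v :: "complex vec" assume v: "v \<in> carrier_vec n"
    have "((?B - ?A) *\<^sub>v v) \<bullet>c v = (\<Sum>i<n. \<Sum>k<n. (a k * v $ k) * cnj (a i * v $ i))"
      unfolding quadratic_form_eq_double_sum[OF cBA v] by (intro sum.cong refl) (simp add: ent del: index_minus_mat)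
    also have "\<dots> = (\<Sum>k<n. a k * v $ k) * cnj (\<Sum>k<n. a k * v $ k)"
      by (subst sum.swap) (simp add: sum_product cnj_sum)
    also have "\<dots> = complex_of_real ((cmod (\<Sum>k<n. a k * v $ k))\<^sup>2)"
      by (simp only: complex_norm_square of_real_sum of_real_mult)
    finally show "0 \<le> Re (((?B - ?A) *\<^sub>v v) \<bullet>c v)" by simp
  qed (rule cBA adj)+
  moreover have "mat_pos_def n ?A" "mat_pos_def n ?B"
    using unitary_conj_pos_def[OF c1 one] unitary_conj_pos_def[OF cU UU] pos by auto
  ultimately have "mat_pos_semidef n (mat_fun n f ?B - mat_fun n f ?A)"
    using f unfolding operator_monotone_def by blast
  then have psd: "mat_pos_semidef n (unitary_conj n U (\<lambda>i. f (mu i)) - unitary_conj n (1\<^sub>m n) (\<lambda>i. f (lam i)))" (is "mat_pos_semidef n (?FB - ?FA)")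
    by (simp only: mat_fun_unitary_conj[OF c1 one] mat_fun_unitary_conj[OF cU UU])
  define v where "v = Matrix.vec n (\<lambda>i. complex_of_real (x i))"
  have v: "v \<in> carrier_vec n" by (simp add: v_def)
  have cF: "?FB \<in> carrier_mat n n" "?FA \<in> carrier_mat n n" using cU c1 by auto
  have cD: "?FB - ?FA \<in> carrier_mat n n" using cF by (intro minus_carrier_mat)
  have "0 \<le> Re (((?FB - ?FA) *\<^sub>v v) \<bullet>c v)" using psd v unfolding mat_pos_semidef_def by blast
  also have "((?FB - ?FA) *\<^sub>v v) \<bullet>c v = (?FB *\<^sub>v v) \<bullet>c v - (?FA *\<^sub>v v) \<bullet>c v"
    unfolding quadratic_form_eq_double_sum[OF cD v] quadratic_form_eq_double_sum[OF cF(1) v]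
      quadratic_form_eq_double_sum[OF cF(2) v] sum_subtractf[symmetric]
    by (intro sum.cong refl) (simp add: dims left_diff_distrib)
  also have "Re \<dots> = (\<Sum>j<n. f (mu j) * (cmod (\<Sum>i<n. cnj (U $$ (i, j)) * v $ i))\<^sup>2)
      - (\<Sum>j<n. f (lam j) * (cmod (\<Sum>i<n. cnj ((1\<^sub>m n) $$ (i, j)) * v $ i))\<^sup>2)"
    by (simp add: unitary_conj_quadratic_form[OF cU v] unitary_conj_quadratic_form[OF c1 v])
  also have "(\<Sum>j<n. f (mu j) * (cmod (\<Sum>i<n. cnj (U $$ (i, j)) * v $ i))\<^sup>2) = (\<Sum>j<n. f (mu j) * (\<Sum>i<n. V i j * x i)\<^sup>2)"
  proof (intro sum.cong refl arg_cong2[of _ _ _ _ "(*)"])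
    fix j assume "j \<in> {..<n}"
    then have "(\<Sum>i<n. cnj (U $$ (i, j)) * v $ i) = of_real (\<Sum>i<n. V i j * x i)"
      by (simp add: U_def v_def)
    then show "(cmod (\<Sum>i<n. cnj (U $$ (i, j)) * v $ i))\<^sup>2 = (\<Sum>i<n. V i j * x i)\<^sup>2"
      by (simp only: norm_of_real power2_abs)
  qed
  also have "(\<Sum>j<n. f (lam j) * (cmod (\<Sum>i<n. cnj ((1\<^sub>m n) $$ (i, j)) * v $ i))\<^sup>2) = (\<Sum>i<n. f (lam i) * (x i)\<^sup>2)"
  proof (intro sum.cong refl arg_cong2[of _ _ _ _ "(*)"])
    fix j assume j: "j \<in> {..<n}"
    then have "(\<Sum>i<n. cnj ((1\<^sub>m n) $$ (i, j)) * v $ i) = (\<Sum>i<n. if i = j then of_real (x j) else 0)"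
      by (intro sum.cong) (auto simp: v_def)
    then have "(\<Sum>i<n. cnj ((1\<^sub>m n) $$ (i, j)) * v $ i) = of_real (x j)" using j by simp
    then show "(cmod (\<Sum>i<n. cnj ((1\<^sub>m n) $$ (i, j)) * v $ i))\<^sup>2 = (x j)\<^sup>2"
      by (simp only: norm_of_real power2_abs)
  qed
  finally show ?thesis by simp
qed

lemma degree_prod_linear:
  fixes x :: "'i \<Rightarrow> real"
  assumes "finite I"
  shows "degree (\<Prod>i\<in>I. [:- x i, 1:]) = card I" "lead_coeff (\<Prod>i\<in>I. [:- x i, 1:]) = 1"
proof -
  show *: "degree (\<Prod>i\<in>I. [:- x i, 1:]) = card I"
    by (subst degree_prod_eq_sum_degree) auto
  show "lead_coeff (\<Prod>i\<in>I. [:- x i, 1:]) = 1"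
    by (simp add: lead_coeff_prod)
qed

lemma poly_prod_linear: "poly (\<Prod>i\<in>I. [:- x i, 1:]) z = (\<Prod>i\<in>I. z - x i)" for x :: "'i \<Rightarrow> real"
  by (simp add: poly_prod algebra_simps)

lemma lagrange_interpolation:
  fixes x :: "'i \<Rightarrow> real"
  assumes I: "finite I" "inj_on x I" and q: "degree q < card I"
  shows "q = (\<Sum>i\<in>I. Polynomial.smult (poly q (x i) / (\<Prod>k\<in>I - {i}. x i - x k)) (\<Prod>k\<in>I - {i}. [:- x k, 1:]))"
    (is "q = ?p")
proof (rule ccontr)
  assume "q \<noteq> ?p"
  then have d0: "q - ?p \<noteq> 0" by simp
  have "degree ?p \<le> card I - 1"
  proof (rule degree_sum_le)
    fix i assume "i \<in> I"
    then show "degree (Polynomial.smult (poly q (x i) / (\<Prod>k\<in>I - {i}. x i - x k)) (\<Prod>k\<in>I - {i}. [:- x k, 1:])) \<le> card I - 1"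
      using I by (intro order.trans[OF degree_smult_le]) (simp add: degree_prod_linear)
  qed (use I in auto)
  then have deg: "degree (q - ?p) < card I"
    using q degree_diff_le_max[of q ?p] by linarith
  have "poly (q - ?p) (x j) = 0" if j: "j \<in> I" for j
  proof -
    have "poly ?p (x j) = (\<Sum>i\<in>I. poly q (x i) / (\<Prod>k\<in>I - {i}. x i - x k) * (\<Prod>k\<in>I - {i}. x j - x k))"
      by (simp add: poly_sum poly_prod_linear)
    also have "\<dots> = (\<Sum>i\<in>I. if i = j then poly q (x j) else 0)"
    proof (intro sum.cong refl)
      fix i assume i: "i \<in> I"
      show "poly q (x i) / (\<Prod>k\<in>I - {i}. x i - x k) * (\<Prod>k\<in>I - {i}. x j - x k) = (if i = j then poly q (x j) else 0)"
      proof (cases "i = j")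
        case True
        have "(\<Prod>k\<in>I - {i}. x i - x k) \<noteq> 0" using I i by (auto simp: inj_on_def)
        with True show ?thesis by simp
      next
        case False
        then have "(\<Prod>k\<in>I - {i}. x j - x k) = 0" using I j by auto
        with False show ?thesis by simp
      qed
    qed
    also have "\<dots> = poly q (x j)" using I j by simp
    finally show ?thesis by simp
  qed
  then have "x ` I \<subseteq> {z. poly (q - ?p) z = 0}" by blast
  then have "card (x ` I) \<le> card {z. poly (q - ?p) z = 0}"
    using d0 by (intro card_mono poly_roots_finite)
  also have "\<dots> \<le> degree (q - ?p)" by (rule poly_roots_degree[OF d0])
  finally show False using deg I by (simp add: card_image)
qed

text \<open>The partial fraction expansion of \<open>q(z) / \<Prod>(z - x\<^sub>k)\<close>. Together with the next lemma it carries all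
  the identities for the orthogonal matrix of the interlacing construction.\<close>

lemma lagrange_partial_fractions:
  fixes x :: "'i \<Rightarrow> real"
  assumes I: "finite I" "inj_on x I" and q: "degree q < card I" and z: "z \<notin> x ` I"
  shows "(\<Sum>i\<in>I. poly q (x i) / ((\<Prod>k\<in>I - {i}. x i - x k) * (z - x i))) = poly q z / (\<Prod>k\<in>I. z - x k)"
proof -
  have nz: "(\<Prod>k\<in>I. z - x k) \<noteq> 0" using I z by auto
  have "poly q z = (\<Sum>i\<in>I. poly q (x i) / (\<Prod>k\<in>I - {i}. x i - x k) * (\<Prod>k\<in>I - {i}. z - x k))"
    by (subst (1) lagrange_interpolation[OF I q]) (simp add: poly_sum poly_prod_linear)
  also have "\<dots> = (\<Sum>i\<in>I. poly q (x i) / ((\<Prod>k\<in>I - {i}. x i - x k) * (z - x i))) * (\<Prod>k\<in>I. z - x k)"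
    unfolding sum_distrib_right
  proof (intro sum.cong refl)
    fix i assume i: "i \<in> I"
    have "z - x i \<noteq> 0" using i z by auto
    moreover have "(\<Prod>k\<in>I. z - x k) = (z - x i) * (\<Prod>k\<in>I - {i}. z - x k)"
      using I(1) i by (rule prod.remove)
    ultimately show "poly q (x i) / (\<Prod>k\<in>I - {i}. x i - x k) * (\<Prod>k\<in>I - {i}. z - x k)
      = poly q (x i) / ((\<Prod>k\<in>I - {i}. x i - x k) * (z - x i)) * (\<Prod>k\<in>I. z - x k)"
      by simp
  qed
  finally show ?thesis using nz by (simp add: field_simps)
qed

lemma lagrange_top_coeff:
  fixes x :: "'i \<Rightarrow> real"
  assumes I: "finite I" "inj_on x I" and q: "degree q < card I"
  shows "(\<Sum>i\<in>I. poly q (x i) / (\<Prod>k\<in>I - {i}. x i - x k)) = coeff q (card I - 1)"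
proof -
  have "coeff (\<Prod>k\<in>I - {i}. [:- x k, 1:]) (card I - 1) = 1" if "i \<in> I" for i
    using degree_prod_linear[of "I - {i}" x] I that by simp
  then show ?thesis
    by (subst (2) lagrange_interpolation[OF I q]) (simp add: coeff_sum)
qed

text \<open>For interlacing nodes there is an explicit pair of matrices with these spectra whose difference has
  rank one. With \<open>L = \<Prod>(z - lam\<^sub>k)\<close> and \<open>M = \<Prod>(z - mu\<^sub>k)\<close> the orthogonal matrix
  \<open>V i j = a i * b j / (mu j - lam i)\<close> of Cauchy type, where \<open>a\<^sup>2 = - M / L'\<close> at \<open>lam\<close> and \<open>b\<^sup>2 = L / M'\<close> at
  \<open>mu\<close>, satisfies \<open>V diag(mu) V\<^sup>T = diag(lam) + a a\<^sup>T\<close>. By Lagrange interpolation the components of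
  \<open>V\<^sup>T x\<close> for \<open>x i = q(lam i) / (L' i * a i)\<close> are the values \<open>q(mu j)\<close>, up to the factors \<open>b j / L(mu j)\<close>.\<close>

lemma operator_monotone_interlacing:
  fixes lam mu :: "nat \<Rightarrow> real"
  assumes f: "operator_monotone f" and pos: "\<And>i. i < n \<Longrightarrow> 0 < lam i"
    and lm: "\<And>i. i < n \<Longrightarrow> lam i < mu i" and ml: "\<And>i k. i < k \<Longrightarrow> k < n \<Longrightarrow> mu i < lam k"
    and q: "degree q < n"
  shows "0 \<le> (\<Sum>i<n. f (lam i) * (poly q (lam i))\<^sup>2 / ((\<Prod>k\<in>{..<n} - {i}. lam i - lam k) * (\<Prod>k<n. lam i - mu k)))
    + (\<Sum>j<n. f (mu j) * (poly q (mu j))\<^sup>2 / ((\<Prod>k<n. mu j - lam k) * (\<Prod>k\<in>{..<n} - {j}. mu j - mu k)))"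
proof -
  let ?I = "{..<n}"
  have lam_less: "lam i < lam k" if "i < k" "k < n" for i k
    using lm[of i] ml[of i k] that by linarith
  have mu_less: "mu i < mu k" if "i < k" "k < n" for i k
    using lm[of k] ml[of i k] that by linarith
  have inj: "inj_on lam ?I" "inj_on mu ?I"
    using lam_less mu_less by (auto simp: inj_on_def) (metis less_irrefl nat_neq_iff)+
  have ne: "mu j \<noteq> lam i" if "i < n" "j < n" for i j
    using lm[of i] lm[of j] ml[of i j] ml[of j i] lam_less[of i j] that
    by (cases i j rule: linorder_cases) force+
  then have nml: "mu j \<notin> lam ` ?I" "lam j \<notin> mu ` ?I" if "j < n" for j using that by force+
  define L where "L z = (\<Prod>k<n. z - lam k)" for z
  define M where "M z = (\<Prod>k<n. z - mu k)" for z
  define L' where "L' i = (\<Prod>k\<in>?I - {i}. lam i - lam k)" for i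
  define M' where "M' j = (\<Prod>k\<in>?I - {j}. mu j - mu k)" for j
  \<comment> \<open>Interlacing: all factors come in pairs of equal sign, except the one with \<open>k = i\<close>.\<close>
  have sign_lam: "L' i * M (lam i) < 0" if "i < n" for i
  proof -
    have "0 < (\<Prod>k\<in>?I - {i}. (lam i - lam k) * (lam i - mu k))"
    proof (rule prod_pos)
      fix k assume k: "k \<in> ?I - {i}"
      then show "0 < (lam i - lam k) * (lam i - mu k)"
        using lam_less[of i k] lam_less[of k i] lm[of k] ml[of k i] that
        by (cases i k rule: linorder_cases) (auto intro: mult_neg_neg)
    qed
    then have "(lam i - mu i) * (\<Prod>k\<in>?I - {i}. (lam i - lam k) * (lam i - mu k)) < 0"
      using lm[OF that] by (intro mult_neg_pos) auto
    also have "(lam i - mu i) * (\<Prod>k\<in>?I - {i}. (lam i - lam k) * (lam i - mu k)) = L' i * M (lam i)"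
      unfolding M_def L'_def using that by (subst (2) prod.remove[of _ i]) (auto simp: prod.distrib)
    finally show ?thesis .
  qed
  have sign_mu: "0 < L (mu j) * M' j" if "j < n" for j
  proof -
    have "0 < (\<Prod>k\<in>?I - {j}. (mu j - lam k) * (mu j - mu k))"
    proof (rule prod_pos)
      fix k assume k: "k \<in> ?I - {j}"
      then show "0 < (mu j - lam k) * (mu j - mu k)"
        using mu_less[of j k] mu_less[of k j] lm[of k] ml[of j k] that
        by (cases j k rule: linorder_cases) (auto intro: mult_neg_neg)
    qed
    then have "0 < (mu j - lam j) * (\<Prod>k\<in>?I - {j}. (mu j - lam k) * (mu j - mu k))"
      using lm[OF that] by simp
    also have "(mu j - lam j) * (\<Prod>k\<in>?I - {j}. (mu j - lam k) * (mu j - mu k)) = L (mu j) * M' j"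
      unfolding L_def M'_def using that by (subst (2) prod.remove[of _ j]) (auto simp: prod.distrib)
    finally show ?thesis .
  qed
  define a where "a i = sqrt (- M (lam i) / L' i)" for i
  define b where "b j = sqrt (L (mu j) / M' j)" for j
  have a2: "(a i)\<^sup>2 = - M (lam i) / L' i" and a0: "a i \<noteq> 0" and L'0: "L' i \<noteq> 0" and M0: "M (lam i) \<noteq> 0" if "i < n" for i
  proof -
    have "0 < - M (lam i) / L' i" using sign_lam[OF that]
      by (auto simp: mult_less_0_iff intro: divide_neg_pos divide_pos_neg)
    then show "(a i)\<^sup>2 = - M (lam i) / L' i" "a i \<noteq> 0" unfolding a_def by auto
    show "L' i \<noteq> 0" "M (lam i) \<noteq> 0" using sign_lam[OF that] by auto
  qed
  have b2: "(b j)\<^sup>2 = L (mu j) / M' j" and M'0: "M' j \<noteq> 0" and L0: "L (mu j) \<noteq> 0" if "j < n" for j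
  proof -
    have "0 < L (mu j) / M' j" using sign_mu[OF that] by (auto simp: zero_less_divide_iff zero_less_mult_iff)
    then show "(b j)\<^sup>2 = L (mu j) / M' j" unfolding b_def by auto
    show "M' j \<noteq> 0" "L (mu j) \<noteq> 0" using sign_mu[OF that] by auto
  qed
  define V where "V i j = a i * b j / (mu j - lam i)" for i j
  define x where "x i = poly q (lam i) / (L' i * a i)" for i
  define Mp where "Mp j = (\<Prod>k\<in>?I - {j}. [:- mu k, 1:])" for j
  define Lp where "Lp i = (\<Prod>k\<in>?I - {i}. [:- lam k, 1:])" for i
  have Mp: "degree (Mp j) < card ?I" "M z = (z - mu j) * poly (Mp j) z" "poly (Mp j) (mu j) = M' j"
    "k < n \<Longrightarrow> k \<noteq> j \<Longrightarrow> poly (Mp j) (mu k) = 0" if "j < n" for j k z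
  proof -
    show "degree (Mp j) < card ?I" using that by (simp add: Mp_def degree_prod_linear)
    show "M z = (z - mu j) * poly (Mp j) z"
      unfolding M_def Mp_def poly_prod_linear using that by (intro prod.remove) auto
    show "poly (Mp j) (mu j) = M' j" by (simp add: Mp_def poly_prod_linear M'_def)
    show "poly (Mp j) (mu k) = 0" if "k < n" "k \<noteq> j" using that by (auto simp: Mp_def poly_prod_linear)
  qed
  have Lp: "degree (Lp i) < card ?I" "coeff (Lp i) (card ?I - 1) = 1" "L z = (z - lam i) * poly (Lp i) z"
    "poly (Lp i) (lam i) = L' i" "k < n \<Longrightarrow> k \<noteq> i \<Longrightarrow> poly (Lp i) (lam k) = 0" if "i < n" for i k z
  proof -
    show "degree (Lp i) < card ?I" using that by (simp add: Lp_def degree_prod_linear)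
    show "coeff (Lp i) (card ?I - 1) = 1" using degree_prod_linear[of "?I - {i}" lam] that by (simp add: Lp_def)
    show "L z = (z - lam i) * poly (Lp i) z"
      unfolding L_def Lp_def poly_prod_linear using that by (intro prod.remove) auto
    show "poly (Lp i) (lam i) = L' i" by (simp add: Lp_def poly_prod_linear L'_def)
    show "poly (Lp i) (lam k) = 0" if "k < n" "k \<noteq> i" using that by (auto simp: Lp_def poly_prod_linear)
  qed
  \<comment> \<open>The partial fractions of \<open>M(z) / ((z - mu j) L(z))\<close> are evaluated at \<open>mu k\<close>, a zero of \<open>M(z) / (z - mu j)\<close> unless \<open>k = j\<close>.\<close>
  have orth: "(\<Sum>i<n. V i j * V i k) = (if j = k then 1 else 0)" if j: "j < n" and k: "k < n" for j k
  proof -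
    have "(\<Sum>i<n. V i j * V i k) = b j * b k * (\<Sum>i<n. poly (Mp j) (lam i) / (L' i * (mu k - lam i)))"
      unfolding sum_distrib_left
    proof (intro sum.cong refl)
      fix i assume i: "i \<in> ?I"
      have "V i j * V i k = b j * b k * ((a i)\<^sup>2 / ((mu j - lam i) * (mu k - lam i)))"
        by (simp add: V_def power2_eq_square)
      also have "(a i)\<^sup>2 / ((mu j - lam i) * (mu k - lam i)) = poly (Mp j) (lam i) / (L' i * (mu k - lam i))"
      proof -
        have "(a i)\<^sup>2 = (mu j - lam i) * poly (Mp j) (lam i) / L' i"
          using a2[of i] i by (simp add: Mp(2)[OF j, of "lam i"] algebra_simps)
        then show ?thesis using ne[of i j] i j by simp
      qed
      finally show "V i j * V i k = b j * b k * (poly (Mp j) (lam i) / (L' i * (mu k - lam i)))" .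
    qed
    also have "\<dots> = b j * b k * (poly (Mp j) (mu k) / L (mu k))"
      unfolding L'_def L_def using lagrange_partial_fractions[OF _ inj(1) Mp(1)[OF j] nml(1)[OF k]] by simp
    also have "\<dots> = (if j = k then 1 else 0)"
      using Mp(3,4)[OF j] k b2[OF j] M'0[OF j] L0[OF j] by (auto simp: power2_eq_square)
    finally show ?thesis .
  qed
  \<comment> \<open>\<open>mu j / (mu j - lam k) = 1 - lam k / (lam k - mu j)\<close>: the first term gives \<open>a a\<^sup>T\<close>, the second the diagonal.\<close>
  have rank1: "(\<Sum>j<n. V i j * mu j * V k j) = (if i = k then lam i else 0) + a i * a k" if i: "i < n" and k: "k < n" for i k
  proof -
    have "(\<Sum>j<n. V i j * mu j * V k j) = a i * a k * (\<Sum>j<n. poly (Lp i) (mu j) / M' j - lam k * (poly (Lp i) (mu j) / (M' j * (lam k - mu j))))"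
      unfolding sum_distrib_left
    proof (intro sum.cong refl)
      fix j assume "j \<in> ?I"
      then have j: "j < n" by simp
      have "V i j * mu j * V k j = a i * a k * ((b j)\<^sup>2 * mu j / ((mu j - lam i) * (mu j - lam k)))"
        by (simp add: V_def power2_eq_square)
      also have "(b j)\<^sup>2 * mu j / ((mu j - lam i) * (mu j - lam k)) = poly (Lp i) (mu j) / M' j * (mu j / (mu j - lam k))"
        using b2[OF j] M'0[OF j] ne[OF i j] ne[OF k j] by (simp add: Lp(3)[OF i])
      also have "mu j / (mu j - lam k) = 1 - lam k / (lam k - mu j)"
        using ne[OF k j] by (simp add: field_simps)
      finally show "V i j * mu j * V k j = a i * a k * (poly (Lp i) (mu j) / M' j - lam k * (poly (Lp i) (mu j) / (M' j * (lam k - mu j))))"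
        by (simp add: right_diff_distrib)
    qed
    also have "(\<Sum>j<n. poly (Lp i) (mu j) / M' j - lam k * (poly (Lp i) (mu j) / (M' j * (lam k - mu j))))
        = 1 - lam k * (poly (Lp i) (lam k) / M (lam k))"
      unfolding sum_subtractf sum_distrib_left[symmetric] M'_def M_def
      using lagrange_partial_fractions[OF _ inj(2) Lp(1)[OF i] nml(2)[OF k]]
        lagrange_top_coeff[OF _ inj(2) Lp(1)[OF i]] Lp(2)[OF i] by simp
    also have "a i * a k * (1 - lam k * (poly (Lp i) (lam k) / M (lam k))) = (if i = k then lam i else 0) + a i * a k"
    proof (cases "i = k")
      case True
      have "a i * a k * (1 - lam k * (poly (Lp i) (lam k) / M (lam k))) = a i * a k - (a i)\<^sup>2 * (lam i * (L' i / M (lam i)))"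
        using True Lp(4)[OF i] by (simp add: power2_eq_square algebra_simps)
      also have "(a i)\<^sup>2 * (lam i * (L' i / M (lam i))) = - lam i"
        using a2[OF i] L'0[OF i] M0[OF i] by simp
      finally show ?thesis using True by simp
    next
      case False
      then show ?thesis using Lp(5)[OF i k] by simp
    qed
    finally show ?thesis .
  qed
  have "(\<Sum>i<n. f (lam i) * (x i)\<^sup>2) \<le> (\<Sum>j<n. f (mu j) * (\<Sum>i<n. V i j * x i)\<^sup>2)"
    using f orth pos _ rank1
  proof (rule operator_monotone_orthogonal)
    show "0 < mu j" if "j < n" for j using pos[OF that] lm[OF that] by simp
  qed
  also have "(\<Sum>i<n. f (lam i) * (x i)\<^sup>2) = (\<Sum>i<n. - (f (lam i) * (poly q (lam i))\<^sup>2 / (L' i * M (lam i))))"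
  proof (intro sum.cong refl)
    fix i assume i: "i \<in> ?I"
    then show "f (lam i) * (x i)\<^sup>2 = - (f (lam i) * (poly q (lam i))\<^sup>2 / (L' i * M (lam i)))"
      using a2[of i] L'0[of i] M0[of i] by (simp add: x_def power_divide power_mult_distrib) (simp add: power2_eq_square)
  qed
  also have "(\<Sum>j<n. f (mu j) * (\<Sum>i<n. V i j * x i)\<^sup>2) = (\<Sum>j<n. f (mu j) * (poly q (mu j))\<^sup>2 / (L (mu j) * M' j))"
  proof (intro sum.cong refl)
    fix j assume "j \<in> ?I"
    then have j: "j < n" by simp
    have "(\<Sum>i<n. V i j * x i) = b j * (\<Sum>i<n. poly q (lam i) / (L' i * (mu j - lam i)))"
      unfolding sum_distrib_left using a0 by (intro sum.cong) (auto simp: V_def x_def)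
    also have "\<dots> = b j * (poly q (mu j) / L (mu j))"
      unfolding L'_def L_def using lagrange_partial_fractions[OF _ inj(1) _ nml(1)[OF j], of q] q by simp
    finally show "f (mu j) * (\<Sum>i<n. V i j * x i)\<^sup>2 = f (mu j) * (poly q (mu j))\<^sup>2 / (L (mu j) * M' j)"
      using b2[OF j] L0[OF j] M'0[OF j] by (simp add: power_mult_distrib power_divide) (simp add: power2_eq_square)
  qed
  finally show ?thesis unfolding L_def M_def L'_def M'_def by (simp add: sum_negf)
qed

section \<open>The dual cone of the operator monotone functions\<close>

text \<open>The sum is the divided difference of \<open>q\<^sup>2 f\<close> at the \<open>2 n\<close> nodes in \<open>T\<close>: every node set of even size
  interlaces after sorting, with the even positions as \<open>lam\<close> and the odd ones as \<open>mu\<close>.\<close>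

lemma operator_monotone_divided_difference:
  assumes f: "operator_monotone f" and T: "finite T" "T \<subseteq> {0<..}" "card T = 2 * n" and q: "degree q < n"
  shows "0 \<le> (\<Sum>t\<in>T. f t * (poly q t)\<^sup>2 / (\<Prod>u\<in>T - {t}. t - u))"
proof -
  define xs where "xs = sorted_list_of_set T"
  have xs: "sorted_wrt (<) xs" "set xs = T" "length xs = 2 * n"
    using T by (auto simp: xs_def)
  define lam where "lam i = xs ! (2 * i)" for i
  define mu where "mu i = xs ! (2 * i + 1)" for i
  let ?I = "{..<n}"
  have less: "xs ! i < xs ! j" if "i < j" "j < 2 * n" for i j
    using sorted_wrt_nth_less[OF xs(1) that(1)] that xs(3) by simp
  have lm: "lam i < mu i" if "i < n" for i unfolding lam_def mu_def using that by (intro less) auto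
  have ml: "mu i < lam k" if "i < k" "k < n" for i k unfolding lam_def mu_def using that by (intro less) auto
  have inj: "inj_on lam ?I" "inj_on mu ?I"
    unfolding lam_def mu_def by (intro linorder_inj_onI' less_imp_neq less; auto)+
  have Tx: "T = (!) xs ` {..<2 * n}" using xs by (auto simp: set_conv_nth)
  have ev: "{..<2 * n} = (\<lambda>i. 2 * i) ` ?I \<union> (\<lambda>i. 2 * i + 1) ` ?I"
  proof (intro equalityI subsetI)
    fix k assume "k \<in> {..<2 * n}"
    then show "k \<in> (\<lambda>i. 2 * i) ` ?I \<union> (\<lambda>i. 2 * i + 1) ` ?I"
      by (cases "even k") (auto elim!: evenE oddE)
  qed auto
  have Tu: "T = lam ` ?I \<union> mu ` ?I"
    unfolding Tx ev image_Un image_image lam_def mu_def by simp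
  have ne: "mu j \<noteq> lam i" if "i < n" "j < n" for i j
  proof -
    have "2 * i < 2 * j + 1 \<or> 2 * j + 1 < 2 * i" by presburger
    then show ?thesis
      unfolding lam_def mu_def using less[of "2 * i" "2 * j + 1"] less[of "2 * j + 1" "2 * i"] that
      by (elim disjE) fastforce+
  qed
  have disj: "lam ` ?I \<inter> mu ` ?I = {}" using ne by force
  have sum_T: "(\<Sum>t\<in>T. g t) = (\<Sum>i<n. g (lam i)) + (\<Sum>j<n. g (mu j))" for g :: "real \<Rightarrow> real"
    unfolding Tu using disj inj by (subst sum.union_disjoint) (auto simp: sum.reindex)
  have pl: "(\<Prod>u\<in>T - {lam i}. lam i - u) = (\<Prod>k\<in>?I - {i}. lam i - lam k) * (\<Prod>k<n. lam i - mu k)" if i: "i < n" for i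
  proof -
    have "lam i \<notin> mu ` ?I" using disj i by blast
    then have "T - {lam i} = lam ` (?I - {i}) \<union> mu ` ?I"
      unfolding Tu using inj \<open>lam i \<notin> mu ` ?I\<close> i by (auto simp: inj_on_def)
    moreover have "inj_on lam (?I - {i})" using inj by (auto intro: inj_on_subset)
    moreover have "lam ` (?I - {i}) \<inter> mu ` ?I = {}" using disj by blast
    ultimately show ?thesis
      using inj(2) by (simp add: prod.union_disjoint prod.reindex)
  qed
  have pm: "(\<Prod>u\<in>T - {mu j}. mu j - u) = (\<Prod>k<n. mu j - lam k) * (\<Prod>k\<in>?I - {j}. mu j - mu k)" if j: "j < n" for j
  proof -
    have "mu j \<notin> lam ` ?I" using disj j by blast
    then have "T - {mu j} = lam ` ?I \<union> mu ` (?I - {j})"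
      unfolding Tu using inj \<open>mu j \<notin> lam ` ?I\<close> j by (auto simp: inj_on_def)
    moreover have "inj_on mu (?I - {j})" using inj by (auto intro: inj_on_subset)
    moreover have "lam ` ?I \<inter> mu ` (?I - {j}) = {}" using disj by blast
    ultimately show ?thesis
      using inj(1) by (simp add: prod.union_disjoint prod.reindex)
  qed
  have "0 < lam i" if "i < n" for i using T(2) Tu that by auto
  from operator_monotone_interlacing[of f n lam mu q, OF f this lm ml q] show ?thesis
    unfolding sum_T by (simp add: pl pm)
qed

text \<open>This is where the domain is the whole half-line. Two nodes \<open>e\<close> and \<open>R\<close> are added near its ends,
  and the polynomial \<open>(t - e) (t - R) q\<close> removes both from the sum again. What remains is
  \<open>\<Sum> c t * ((t - e) * (t - R))\<close>, which for \<open>e = 1 / R\<close> and large \<open>R\<close> is dominated by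
  \<open>- R * (\<Sum> c t * t)\<close>.\<close>

lemma operator_monotone_divided_difference_halfline:
  assumes f: "operator_monotone f" and T: "finite T" "T \<subseteq> {0<..}" "card T = 2 * n" and q: "degree q + 2 \<le> n"
  shows "(\<Sum>t\<in>T. t * f t * (poly q t)\<^sup>2 / (\<Prod>u\<in>T - {t}. t - u)) \<le> 0"
proof (rule ccontr)
  define c where "c t = f t * (poly q t)\<^sup>2 / (\<Prod>u\<in>T - {t}. t - u)" for t
  define S where "S k = (\<Sum>t\<in>T. c t * t ^ k)" for k
  assume "\<not> ?thesis"
  then have S1: "0 < S 1" by (simp add: S_def c_def ac_simps)
  define R where "R = 1 + (\<Sum>t\<in>T. t + 1 / t) + \<bar>S 2 + S 0\<bar> / S 1"
  have tpos: "0 < t" if "t \<in> T" for t using T that by auto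
  have nn: "0 \<le> t + 1 / t" if "t \<in> T" for t
    using tpos[OF that] by (intro add_nonneg_nonneg) auto
  have R: "t < R" "1 / R < t" "0 < R" if "t \<in> T" for t
  proof -
    have "t + 1 / t \<le> (\<Sum>t\<in>T. t + 1 / t)" using T(1) nn by (intro member_le_sum that) auto
    moreover have "0 \<le> \<bar>S 2 + S 0\<bar> / S 1" using S1 by simp
    moreover have "0 < t" "0 < 1 / t" using tpos[OF that] by auto
    ultimately have *: "t < R" "1 / t < R" unfolding R_def by linarith+
    then show "t < R" "0 < R" using \<open>0 < t\<close> by auto
    show "1 / R < t" using * \<open>0 < t\<close> by (simp add: field_simps)
  qed
  obtain t0 where t0: "t0 \<in> T" using T(3) q by fastforce
  define e where "e = 1 / R"
  have e: "0 < e" "e < R" "e \<notin> T" "R \<notin> T" "e * R = 1" "e < t0"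
    using R[OF t0] R unfolding e_def by force+
  let ?T = "insert e (insert R T)"
  define p where "p = [:- e, 1:] * [:- R, 1:] * q"
  have polyp: "poly p t = (t - e) * (t - R) * poly q t" for t by (simp add: p_def algebra_simps)
  have "degree p \<le> degree q + 2"
    using degree_mult_le[of "[:- e, 1:] * [:- R, 1:]" q] degree_mult_le[of "[:- e, 1:]" "[:- R, 1:]"] by (simp add: p_def)
  then have "degree p < Suc n" using q by simp
  moreover have "card ?T = 2 * Suc n" using T e by simp
  moreover have "finite ?T" "?T \<subseteq> {0<..}" using T e R[OF t0] by auto
  ultimately have "0 \<le> (\<Sum>t\<in>?T. f t * (poly p t)\<^sup>2 / (\<Prod>u\<in>?T - {t}. t - u))"
    using operator_monotone_divided_difference[OF f] by blast
  also have "\<dots> = (\<Sum>t\<in>T. f t * (poly p t)\<^sup>2 / (\<Prod>u\<in>?T - {t}. t - u))"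
    by (rule sum.mono_neutral_right) (use T e in \<open>auto simp: polyp\<close>)
  also have "\<dots> = (\<Sum>t\<in>T. c t * ((t - e) * (t - R)))"
  proof (intro sum.cong refl)
    fix t assume t: "t \<in> T"
    have "?T - {t} = insert e (insert R (T - {t}))" using e t by auto
    then have pr: "(\<Prod>u\<in>?T - {t}. t - u) = (t - e) * ((t - R) * (\<Prod>u\<in>T - {t}. t - u))"
      using T e by simp
    have "t - e \<noteq> 0" "t - R \<noteq> 0" using R[OF t] unfolding e_def by auto
    then show "f t * (poly p t)\<^sup>2 / (\<Prod>u\<in>?T - {t}. t - u) = c t * ((t - e) * (t - R))"
      unfolding pr c_def polyp by (simp add: power2_eq_square)
  qed
  also have "\<dots> = S 2 - (e + R) * S 1 + S 0"
  proof -
    have "c t * ((t - e) * (t - R)) = c t * t ^ 2 - (e + R) * (c t * t ^ 1) + c t * t ^ 0" for t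
    proof -
      have "(t - e) * (t - R) = t ^ 2 - (e + R) * t + 1"
        using e(5) by (simp add: algebra_simps power2_eq_square)
      then show ?thesis by (simp add: algebra_simps)
    qed
    then show ?thesis by (simp add: S_def sum.distrib sum_subtractf sum_distrib_left)
  qed
  finally have "(e + R) * S 1 \<le> \<bar>S 2 + S 0\<bar>" by linarith
  moreover have "\<bar>S 2 + S 0\<bar> < (e + R) * S 1"
  proof -
    have "0 \<le> (\<Sum>t\<in>T. t + 1 / t)" using nn by (rule sum_nonneg)
    then have "\<bar>S 2 + S 0\<bar> / S 1 < e + R" unfolding R_def using e(1) by linarith
    then show ?thesis using S1 by (simp add: field_simps)
  qed
  ultimately show False by simp
qed

lemma halfline_sos_mono: "halfline_sos d p \<Longrightarrow> d \<le> e \<Longrightarrow> halfline_sos e p"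
  by (induction rule: halfline_sos.induct) (blast intro: halfline_sos.intros order.trans)+

lemma degree_le_pred:
  assumes "degree p \<le> m" "coeff p m = 0"
  shows "degree p \<le> m - 1"
proof (cases "degree p = m")
  case True
  then have "p = 0" using assms(2) by (metis leading_coeff_0_iff)
  then show ?thesis by simp
qed (use assms in auto)

text \<open>A functional \<open>f \<mapsto> \<Sum> c t * f t\<close> that kills constants and is nonnegative on all the functions
  \<open>- 1 / (t + l)\<close> is nonnegative on every operator monotone function. Clearing denominators in the
  hypothesis gives a polynomial \<open>N\<close> in \<open>l\<close> that is nonnegative on the half-line, and \<open>c t\<close> is recovered as
  \<open>N(- t) / \<Prod>(t - u)\<close>. So \<open>\<Sum> c t * f t\<close> is linear in \<open>N\<close>, and each summand of its sum-of-squares form is one of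
  the two inequalities for divided differences.\<close>

lemma operator_monotone_dual_cone_even:
  assumes f: "operator_monotone f" and T: "finite T" "T \<subseteq> {0<..}" "card T = 2 * n" "T \<noteq> {}"
    and c: "(\<Sum>t\<in>T. c t) = 0" "\<And>l. 0 \<le> l \<Longrightarrow> (\<Sum>t\<in>T. c t / (t + l)) \<le> 0"
  shows "0 \<le> (\<Sum>t\<in>T. c t * f t)"
proof -
  define N where "N = (\<Sum>t\<in>T. Polynomial.smult (- c t) (\<Prod>u\<in>T - {t}. [:u, 1:]))"
  have n: "0 < n" using T by (cases n) auto
  have tpos: "0 < t" if "t \<in> T" for t using T that by auto
  have dp: "degree (\<Prod>u\<in>T - {t}. [:u, 1:]) = 2 * n - 1" "coeff (\<Prod>u\<in>T - {t}. [:u, 1:]) (2 * n - 1) = 1" if "t \<in> T" for t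
    using degree_prod_linear[of "T - {t}" uminus] T that by auto
  have "degree N \<le> 2 * n - 1"
    unfolding N_def by (rule degree_sum_le) (use T in \<open>auto intro!: order.trans[OF degree_smult_le] simp: dp\<close>)
  \<comment> \<open>The top coefficient is \<open>- \<Sum> c\<close>; this lowers the degree to what the divided differences admit.\<close>
  moreover have "coeff N (2 * n - 1) = 0"
    unfolding N_def coeff_sum coeff_smult using c(1) by (simp add: dp[simplified] sum_negf)
  ultimately have degN: "degree N \<le> 2 * n - 2" using degree_le_pred[of N "2 * n - 1"] by simp
  have polyN: "poly N l = - (\<Sum>t\<in>T. c t * (\<Prod>u\<in>T - {t}. l + u))" for l
    unfolding N_def by (simp add: poly_sum poly_prod sum_negf add.commute)
  have "0 \<le> poly N l" if l: "0 \<le> l" for l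
  proof -
    have "(\<Sum>t\<in>T. c t * (\<Prod>u\<in>T - {t}. l + u)) = (\<Sum>t\<in>T. c t / (t + l)) * (\<Prod>u\<in>T. l + u)"
      unfolding sum_distrib_right
    proof (intro sum.cong refl)
      fix t assume t: "t \<in> T"
      have "(\<Prod>u\<in>T. l + u) = (l + t) * (\<Prod>u\<in>T - {t}. l + u)" using T(1) t by (rule prod.remove)
      moreover have "l + t \<noteq> 0" using tpos[OF t] l by simp
      ultimately show "c t * (\<Prod>u\<in>T - {t}. l + u) = c t / (t + l) * (\<Prod>u\<in>T. l + u)" by (simp add: add.commute)
    qed
    also have "\<dots> \<le> 0"
      using c(2)[OF l] l tpos by (intro mult_nonpos_nonneg prod_nonneg) (auto intro: add_nonneg_nonneg less_imp_le)
    finally show ?thesis by (simp add: polyN)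
  qed
  then have sos: "halfline_sos (2 * n - 2) N"
    using nonneg_poly_imp_halfline_sos halfline_sos_mono degN by blast
  have ct: "c t = poly N (- t) / (\<Prod>u\<in>T - {t}. t - u)" if t: "t \<in> T" for t
  proof -
    have "(\<Sum>s\<in>T. c s * (\<Prod>u\<in>T - {s}. - t + u)) = (\<Sum>s\<in>T. if s = t then c t * (\<Prod>u\<in>T - {t}. - t + u) else 0)"
      using T(1) t by (intro sum.cong) auto
    also have "\<dots> = c t * (\<Prod>u\<in>T - {t}. - 1 * (t - u))" using T(1) t by simp
    also have "\<dots> = c t * ((- 1) ^ card (T - {t}) * (\<Prod>u\<in>T - {t}. t - u))"
      by (simp only: prod.distrib prod_constant)
    also have "(- 1 :: real) ^ card (T - {t}) = - 1" using T t n by simp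
    finally have "poly N (- t) = c t * (\<Prod>u\<in>T - {t}. t - u)" by (simp add: polyN)
    moreover have "(\<Prod>u\<in>T - {t}. t - u) \<noteq> 0" using T by auto
    ultimately show ?thesis by simp
  qed
  have deg: "degree (pcompose q [:0, -1:]) = degree q" for q :: "real poly"
    by (simp add: degree_pcompose)
  have "0 \<le> (\<Sum>t\<in>T. f t * poly N (- t) / (\<Prod>u\<in>T - {t}. t - u))"
    using sos
  proof induction
    case (halfline_sos_square q)
    then show ?case
      using operator_monotone_divided_difference[OF f T(1-3), of "pcompose q [:0, -1:]"] n
      by (simp add: poly_pcompose deg)
  next
    case (halfline_sos_X_square q)
    then have "degree (pcompose q [:0, -1:]) + 2 \<le> n" using deg by simp
    from operator_monotone_divided_difference_halfline[OF f T(1-3) this]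
    show ?case by (simp add: poly_pcompose sum_negf ac_simps)
  next
    case (halfline_sos_add p q)
    then show ?case by (simp add: distrib_left add_divide_distrib sum.distrib)
  qed simp
  also have "\<dots> = (\<Sum>t\<in>T. c t * f t)" by (intro sum.cong refl) (simp add: ct)
  finally show ?thesis .
qed

text \<open>An odd number of nodes is made even by a fresh node of weight \<open>0\<close>.\<close>

lemma operator_monotone_dual_cone:
  assumes f: "operator_monotone f" and T: "finite T" "T \<subseteq> {0<..}"
    and c: "(\<Sum>t\<in>T. c t) = 0" "\<And>l. 0 \<le> l \<Longrightarrow> (\<Sum>t\<in>T. c t / (t + l)) \<le> 0"
  shows "0 \<le> (\<Sum>t\<in>T. c t * f t)"
proof (cases "even (card T)")
  case True
  then obtain n where "card T = 2 * n" by (auto elim: evenE)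
  then show ?thesis using operator_monotone_dual_cone_even[OF f T] c by (cases "T = {}") auto
next
  case False
  have "\<exists>u. u \<in> {0<..} - T" using infinite_super[of "{0<..} - T" "{0::real<..}"] T
    by (metis Diff_infinite_finite all_not_in_conv finite.emptyI infinite_Ioi)
  then obtain u where u: "0 < u" "u \<notin> T" by auto
  let ?c = "c(u := 0)"
  have cc: "(\<Sum>t\<in>insert u T. ?c t * g t) = (\<Sum>t\<in>T. c t * g t)" for g :: "real \<Rightarrow> real"
    using T u by (subst sum.insert) (auto intro!: sum.cong)
  have "even (card (insert u T))" using False T u by simp
  then obtain n where n: "card (insert u T) = 2 * n" by (rule evenE)
  have "0 \<le> (\<Sum>t\<in>insert u T. ?c t * f t)"
    using T u c cc[of "\<lambda>_. 1"] cc[of "\<lambda>t. 1 / (t + l)" for l]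
    by (intro operator_monotone_dual_cone_even[OF f _ _ n]) auto
  then show ?thesis by (simp only: cc)
qed

section \<open>Approximation of operator monotone functions by Moebius kernels\<close>

text \<open>For \<open>0 \<le> s \<le> 1\<close> these are the extreme points of the set of normalized operator monotone
  functions; \<open>s = 1\<close> is \<open>t - 1\<close> and \<open>s = 0\<close> is \<open>1 - 1 / t\<close>.\<close>

definition mobius_kernel :: "real \<Rightarrow> real \<Rightarrow> real" where
  "mobius_kernel s t = (t - 1) / ((1 - s) * t + s)"

text \<open>The convex hull, built by mixing two functions at a time, so that linear properties of the kernels pass
  to it by rule induction.\<close>

inductive kernel_hull :: "(real \<Rightarrow> real) \<Rightarrow> bool" where
  kernel_hull_mobius: "0 \<le> s \<Longrightarrow> s \<le> 1 \<Longrightarrow> kernel_hull (mobius_kernel s)"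
| kernel_hull_mix: "kernel_hull k \<Longrightarrow> kernel_hull l \<Longrightarrow> 0 \<le> u \<Longrightarrow> u \<le> 1 \<Longrightarrow> kernel_hull (\<lambda>t. (1 - u) * k t + u * l t)"

lemma mobius_denominator_bounds:
  assumes "0 \<le> s" "s \<le> 1" "0 < (t::real)"
  shows "min 1 t \<le> (1 - s) * t + s" "(1 - s) * t + s \<le> max 1 t" "0 < (1 - s) * t + s"
proof -
  have "(1 - s) * min 1 t + s * min 1 t \<le> (1 - s) * t + s * 1"
    using assms by (intro add_mono mult_left_mono) auto
  then show 1: "min 1 t \<le> (1 - s) * t + s" by (simp add: algebra_simps)
  have "(1 - s) * t + s * 1 \<le> (1 - s) * max 1 t + s * max 1 t"
    using assms by (intro add_mono mult_left_mono) auto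
  then show "(1 - s) * t + s \<le> max 1 t" by (simp add: algebra_simps)
  show "0 < (1 - s) * t + s" using 1 assms(3) by linarith
qed

lemma mobius_kernel_diff:
  assumes "0 \<le> s" "s \<le> 1" "0 < t" "0 < u"
  shows "mobius_kernel s t - mobius_kernel s u = (t - u) / (((1 - s) * t + s) * ((1 - s) * u + s))"
proof -
  have "(1 - s) * t + s \<noteq> 0" "(1 - s) * u + s \<noteq> 0"
    using mobius_denominator_bounds(3) assms by force+
  then show ?thesis unfolding mobius_kernel_def by (simp add: diff_frac_eq) (simp add: algebra_simps)
qed

lemma kernel_hull_increment:
  assumes "kernel_hull k" "0 < u" "u \<le> t"
  shows "0 \<le> k t - k u" "k t - k u \<le> (t - u) / (min 1 u)\<^sup>2"
  using assms(1)
proof induction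
  case (kernel_hull_mobius s)
  have b: "min 1 u \<le> (1 - s) * t + s" "min 1 u \<le> (1 - s) * u + s"
    using mobius_denominator_bounds(1)[of s t] mobius_denominator_bounds(1)[of s u] kernel_hull_mobius assms by auto
  have m: "0 < min 1 u" using assms by simp
  then have "(min 1 u)\<^sup>2 \<le> ((1 - s) * t + s) * ((1 - s) * u + s)"
    unfolding power2_eq_square using b by (intro mult_mono) linarith+
  moreover have "0 < (min 1 u)\<^sup>2" using m by simp
  moreover have "0 < ((1 - s) * t + s) * ((1 - s) * u + s)" using b m by (intro mult_pos_pos) linarith+
  moreover have "mobius_kernel s t - mobius_kernel s u = (t - u) / (((1 - s) * t + s) * ((1 - s) * u + s))"
    using kernel_hull_mobius assms by (intro mobius_kernel_diff) auto
  ultimately show "0 \<le> mobius_kernel s t - mobius_kernel s u"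
    "mobius_kernel s t - mobius_kernel s u \<le> (t - u) / (min 1 u)\<^sup>2"
    using assms by (auto intro!: divide_left_mono divide_nonneg_pos mult_pos_pos)
next
  case (kernel_hull_mix k l v)
  have e: "(1 - v) * k t + v * l t - ((1 - v) * k u + v * l u) = (1 - v) * (k t - k u) + v * (l t - l u)"
    by (simp add: algebra_simps)
  { case 1
    show ?case unfolding e using kernel_hull_mix by (intro add_nonneg_nonneg mult_nonneg_nonneg) auto }
  { case 2
    have "(1 - v) * (k t - k u) + v * (l t - l u) \<le> (1 - v) * ((t - u) / (min 1 u)\<^sup>2) + v * ((t - u) / (min 1 u)\<^sup>2)"
      using kernel_hull_mix by (intro add_mono mult_left_mono) auto
    also have "\<dots> = (t - u) / (min 1 u)\<^sup>2" by (simp only: left_diff_distrib)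
    finally show ?case unfolding e . }
qed

lemma kernel_hull_bound:
  assumes "kernel_hull k" "0 < t"
  shows "\<bar>k t\<bar> \<le> t + 1 / t"
  using assms(1)
proof induction
  case (kernel_hull_mobius s)
  have d: "min 1 t \<le> (1 - s) * t + s" "0 < (1 - s) * t + s"
    using mobius_denominator_bounds[of s t] kernel_hull_mobius assms by auto
  have pos: "0 < 1 / t" using assms by simp
  show ?case
  proof (cases "1 \<le> t")
    case True
    then have "\<bar>mobius_kernel s t\<bar> \<le> (t - 1) / 1"
      unfolding mobius_kernel_def using d by (simp add: abs_divide divide_le_eq) (metis True diff_ge_0_iff_ge mult_left_mono mult.right_neutral min.absorb1)
    also have "\<dots> \<le> t + 1 / t" using add_left_mono[OF order.trans[of "- 1" 0 "1 / t"], of t] assms by simp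
    finally show ?thesis .
  next
    case False
    then have "\<bar>mobius_kernel s t\<bar> \<le> (1 - t) / t"
      unfolding mobius_kernel_def using d assms by (auto simp: abs_divide intro!: frac_le)
    also have "\<dots> = 1 / t - 1" using assms by (simp add: field_simps)
    finally show ?thesis using assms by linarith
  qed
next
  case (kernel_hull_mix k l v)
  have "\<bar>(1 - v) * k t + v * l t\<bar> \<le> (1 - v) * \<bar>k t\<bar> + v * \<bar>l t\<bar>"
    using kernel_hull_mix by (intro order.trans[OF abs_triangle_ineq]) (simp add: abs_mult)
  also have "\<dots> \<le> (1 - v) * (t + 1 / t) + v * (t + 1 / t)"
    using kernel_hull_mix by (intro add_mono mult_left_mono) auto
  finally show ?case by (simp only: left_diff_distrib) simp
qed

text \<open>No functional with finite support separates \<open>f\<close> strictly from all kernels. The kernels and \<open>f\<close>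
  share the value \<open>0\<close> and the derivative \<open>1\<close> at \<open>1\<close>, so subtracting the functional from a multiple of a difference
  quotient at \<open>1\<close> turns the separation into a functional \<open>e\<close> that is nonnegative on the kernels and negative on
  \<open>f\<close>, against the description of the dual cone.\<close>

lemma op_mono_funs_not_separated:
  assumes f: "f \<in> op_mono_funs" and T: "finite T" "T \<subseteq> {0<..}" and d: "0 < d"
    and sep: "\<And>s. 0 \<le> s \<Longrightarrow> s \<le> 1 \<Longrightarrow> (\<Sum>t\<in>T. c t * mobius_kernel s t) \<le> (\<Sum>t\<in>T. c t * f t) - d"
  shows False
proof -
  define F where "F = (\<Sum>t\<in>T. c t * f t)"
  define M where "M = F - d"
  have om: "operator_monotone f" and f1: "f 1 = 0" and df: "(f has_real_derivative 1) (at 1)"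
    using f by (auto simp: op_mono_funs_def)
  have "((\<lambda>h. (f (1 + h) - f 1) / h) \<longlongrightarrow> 1) (at 0)" using df by (simp add: DERIV_def)
  then have "((\<lambda>h. f (1 + h) / h) \<longlongrightarrow> 1) (at_right 0)"
    unfolding f1 by (simp add: filterlim_at_split)
  then have "((\<lambda>h. (M + 2 * \<bar>M\<bar> * h) * (f (1 + h) / h)) \<longlongrightarrow> (M + 2 * \<bar>M\<bar> * 0) * 1) (at_right 0)"
    by (intro tendsto_intros)
  moreover have "(M + 2 * \<bar>M\<bar> * 0) * 1 < F" using d by (simp add: M_def)
  ultimately have "eventually (\<lambda>h. (M + 2 * \<bar>M\<bar> * h) * (f (1 + h) / h) < F) (at_right 0)"
    by (rule order_tendstoD)
  moreover have "eventually (\<lambda>h. \<forall>t\<in>T. 1 + h \<noteq> t) (at_right (0::real))"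
  proof (rule eventually_ball_finite[OF T(1)], rule ballI)
    fix t :: real
    have "eventually (\<lambda>h. h \<noteq> t - 1) (at_right 0)" by (rule eventually_neq_at_within)
    then show "eventually (\<lambda>h. 1 + h \<noteq> t) (at_right 0)" by eventually_elim auto
  qed
  moreover have "eventually (\<lambda>h::real. 0 < h) (at_right 0)" by (rule eventually_at_right_less)
  ultimately have "eventually (\<lambda>h. (M + 2 * \<bar>M\<bar> * h) * (f (1 + h) / h) < F \<and> (\<forall>t\<in>T. 1 + h \<noteq> t) \<and> 0 < h) (at_right 0)"
    by (intro eventually_conj)
  then obtain h where h: "(M + 2 * \<bar>M\<bar> * h) * (f (1 + h) / h) < F" "1 + h \<notin> T" "0 < h"
    by (auto dest!: eventually_happens'[OF trivial_limit_at_right_real])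
  \<comment> \<open>The summand \<open>2 \<bar>M\<bar> h\<close> compensates that the difference quotients of the kernels are only \<open>1 / (1 + (1 - s) h)\<close>.\<close>
  define \<beta> where "\<beta> = (M + 2 * \<bar>M\<bar> * h) / h"
  define \<gamma> where "\<gamma> = (\<Sum>t\<in>T. c t) - \<beta>"
  define e where "e t = - (if t \<in> T then c t else 0) + (if t = 1 + h then \<beta> else 0) + (if t = 1 then \<gamma> else 0)" for t
  let ?T = "insert 1 (insert (1 + h) T)"
  have sum_e: "(\<Sum>t\<in>?T. e t * g t) = - (\<Sum>t\<in>T. c t * g t) + \<beta> * g (1 + h) + \<gamma> * g 1" for g
  proof -
    have "(\<Sum>t\<in>?T. e t * g t) = (\<Sum>t\<in>?T. - (if t \<in> T then c t * g t else 0))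
        + (\<Sum>t\<in>?T. if t = 1 + h then \<beta> * g (1 + h) else 0) + (\<Sum>t\<in>?T. if t = 1 then \<gamma> * g 1 else 0)"
      unfolding sum.distrib[symmetric] by (intro sum.cong refl) (auto simp: e_def algebra_simps)
    also have "(\<Sum>t\<in>?T. - (if t \<in> T then c t * g t else 0)) = - (\<Sum>t\<in>T. c t * g t)"
    proof -
      have "(\<Sum>t\<in>?T. if t \<in> T then c t * g t else 0) = (\<Sum>t\<in>?T \<inter> {t. t \<in> T}. c t * g t)"
        using T by (subst sum.inter_restrict) auto
      also have "?T \<inter> {t. t \<in> T} = T" by auto
      finally show ?thesis by (simp add: sum_negf)
    qed
    finally show ?thesis using T by simp
  qed
  have "0 \<le> (\<Sum>t\<in>?T. e t * f t)"
  proof (rule operator_monotone_dual_cone[OF om])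
    show "finite ?T" "?T \<subseteq> {0<..}" using T h by auto
    show sum0: "(\<Sum>t\<in>?T. e t) = 0"
      using sum_e[of "\<lambda>_. 1"] by (simp add: \<gamma>_def)
    fix l :: real assume l: "0 \<le> l"
    define s where "s = l / (1 + l)"
    have s: "0 \<le> s" "s \<le> 1" using l by (auto simp: s_def)
    \<comment> \<open>With \<open>s = l / (1 + l)\<close> the kernel is, up to an additive constant, a positive multiple of \<open>- 1 / (t + l)\<close>.\<close>
    have ker: "mobius_kernel s t = (1 + l) - (1 + l)\<^sup>2 * (1 / (t + l))" if "0 < t" for t
    proof -
      have "(1 - s) * t + s = (t + l) / (1 + l)" 
      proof -
        have "1 - s = 1 / (1 + l)" unfolding s_def using l by (simp add: field_simps)
        then show ?thesis unfolding s_def by (simp add: add_divide_distrib)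
      qed
      then have "mobius_kernel s t = (t - 1) * (1 + l) / (t + l)" by (simp add: mobius_kernel_def)
      also have "\<dots> = (1 + l) - (1 + l)\<^sup>2 * (1 / (t + l))"
        using l that by (simp add: field_simps power2_eq_square)
      finally show ?thesis .
    qed
    have "(\<Sum>t\<in>?T. e t * mobius_kernel s t) = (\<Sum>t\<in>?T. (1 + l) * e t - (1 + l)\<^sup>2 * (e t / (t + l)))"
      using T h by (intro sum.cong refl) (subst ker, auto simp: algebra_simps)
    also have "\<dots> = (1 + l) * (\<Sum>t\<in>?T. e t) - (1 + l)\<^sup>2 * (\<Sum>t\<in>?T. e t / (t + l))"
      by (simp only: sum_subtractf sum_distrib_left)
    also have "\<dots> = - ((1 + l)\<^sup>2 * (\<Sum>t\<in>?T. e t / (t + l)))" unfolding sum0 by simp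
    finally have eq: "(\<Sum>t\<in>?T. e t * mobius_kernel s t) = - ((1 + l)\<^sup>2 * (\<Sum>t\<in>?T. e t / (t + l)))" .
    have "M \<le> \<beta> * mobius_kernel s (1 + h)"
    proof -
      have den: "1 + (1 - s) * h > 0" using s h by (intro add_pos_nonneg) auto
      have "(1 - s) * (1 + h) + s = 1 + (1 - s) * h" by (simp add: algebra_simps)
      then have "\<beta> * mobius_kernel s (1 + h) = (M + 2 * \<bar>M\<bar> * h) / (1 + (1 - s) * h)"
        using h by (simp add: \<beta>_def mobius_kernel_def)
      moreover have "M * (1 + (1 - s) * h) \<le> M + 2 * \<bar>M\<bar> * h"
      proof -
        have "M * ((1 - s) * h) \<le> \<bar>M\<bar> * (2 * h)"
          using s h by (intro mult_mono) (auto intro: mult_right_mono)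
        then show ?thesis by (simp add: algebra_simps)
      qed
      ultimately show ?thesis using den by (simp add: le_divide_eq)
    qed
    then have "0 \<le> (\<Sum>t\<in>?T. e t * mobius_kernel s t)"
      using sep[OF s] unfolding sum_e F_def[symmetric] M_def[symmetric] by (simp add: mobius_kernel_def)
    then have "(1 + l)\<^sup>2 * (\<Sum>t\<in>?T. e t / (t + l)) \<le> 0" using eq by simp
    moreover have "0 < (1 + l)\<^sup>2" using l by simp
    ultimately show "(\<Sum>t\<in>?T. e t / (t + l)) \<le> 0" by (simp only: mult_le_0_iff) linarith
  qed
  then show False using h unfolding sum_e f1 F_def[symmetric] by (simp add: \<beta>_def)
qed

text \<open>Let \<open>d\<close> be the infimum of the squared distances on \<open>T\<close> of \<open>f\<close> to the hull. If \<open>d > 0\<close>, then for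
  an almost optimal \<open>k\<close> a small step of size \<open>u\<close> from \<open>k\<close> towards any kernel cannot improve the distance much;
  so \<open>f - k\<close>, read as a functional, separates \<open>f\<close> from all kernels.\<close>

lemma op_mono_funs_pointwise_hull:
  assumes f: "f \<in> op_mono_funs" and T: "finite T" "T \<subseteq> {0<..}" and \<epsilon>: "0 < \<epsilon>"
  shows "\<exists>k. kernel_hull k \<and> (\<forall>t\<in>T. \<bar>f t - k t\<bar> < \<epsilon>)"
proof -
  define E where "E k = (\<Sum>t\<in>T. (f t - k t)\<^sup>2)" for k
  define d where "d = Inf (E ` Collect kernel_hull)"
  have ne: "E ` Collect kernel_hull \<noteq> {}" using kernel_hull_mobius[of 0] by auto
  have E0: "0 \<le> E k" for k by (simp add: E_def sum_nonneg)
  have bdd: "bdd_below (E ` Collect kernel_hull)" using E0 by (intro bdd_belowI[of _ 0]) auto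
  have dE: "d \<le> E k" if "kernel_hull k" for k
    unfolding d_def using that by (intro cInf_lower bdd) auto
  have "d \<le> 0"
  proof (rule ccontr)
    assume "\<not> d \<le> 0"
    then have d: "0 < d" by simp
    define B where "B = (\<Sum>t\<in>T. (2 * (t + 1 / t))\<^sup>2)"
    have B: "0 \<le> B" by (simp add: B_def sum_nonneg)
    define u where "u = min 1 (d / (2 * (B + 1)))"
    have u: "0 < u" "u \<le> 1" "u * B \<le> d / 2"
    proof -
      show "0 < u" "u \<le> 1" using d B by (auto simp: u_def)
      have "u * B \<le> d / (2 * (B + 1)) * (B + 1)" using B d by (intro mult_mono) (auto simp: u_def)
      also have "\<dots> = d / 2" using B by (simp add: field_simps)
      finally show "u * B \<le> d / 2" .
    qed
    have "d < d + u * d / 2" using u d by simp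
    then have "\<exists>y\<in>E ` Collect kernel_hull. y < d + u * d / 2"
      unfolding d_def using cInf_lessD[OF ne] by blast
    then obtain k where k: "kernel_hull k" "E k < d + u * d / 2" by auto
    show False
    proof (rule op_mono_funs_not_separated[OF f T, of "d / 2" "\<lambda>t. f t - k t"])
      fix s :: real assume s: "0 \<le> s" "s \<le> 1"
      let ?m = "mobius_kernel s"
      define P where "P = (\<Sum>t\<in>T. (f t - k t) * (?m t - k t))"
      define Q where "Q = (\<Sum>t\<in>T. (?m t - k t)\<^sup>2)"
      have hm: "kernel_hull ?m" using s by (rule kernel_hull_mobius)
      have "Q \<le> B"
        unfolding Q_def B_def
      proof (rule sum_mono)
        fix t assume "t \<in> T"
        then have b: "\<bar>?m t\<bar> \<le> t + 1 / t" "\<bar>k t\<bar> \<le> t + 1 / t" using kernel_hull_bound hm k T by auto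
        have "\<bar>?m t - k t\<bar> \<le> (t + 1 / t) + (t + 1 / t)"
          by (rule order.trans[OF abs_triangle_ineq4 add_mono[OF b]])
        also have "\<dots> \<le> \<bar>2 * (t + 1 / t)\<bar>" by (simp only: mult_2 abs_ge_self)
        finally have "\<bar>?m t - k t\<bar> \<le> \<bar>2 * (t + 1 / t)\<bar>" .
        then show "(?m t - k t)\<^sup>2 \<le> (2 * (t + 1 / t))\<^sup>2" by (simp only: abs_le_square_iff)
      qed
      have "d \<le> E (\<lambda>t. (1 - u) * k t + u * ?m t)"
        using k hm u by (intro dE kernel_hull_mix) auto
      also have "\<dots> = (\<Sum>t\<in>T. (f t - k t)\<^sup>2 - 2 * u * ((f t - k t) * (?m t - k t)) + u\<^sup>2 * (?m t - k t)\<^sup>2)"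
        unfolding E_def by (intro sum.cong refl) (simp add: power2_eq_square algebra_simps)
      also have "\<dots> = E k - 2 * u * P + u\<^sup>2 * Q"
        unfolding E_def P_def Q_def by (simp only: sum.distrib sum_subtractf sum_distrib_left)
      finally have "2 * u * P < u * d / 2 + u\<^sup>2 * Q" using k by linarith
      also have "\<dots> \<le> u * d / 2 + u * (d / 2)"
      proof -
        have "u\<^sup>2 * Q \<le> u\<^sup>2 * B" using \<open>Q \<le> B\<close> by (intro mult_left_mono) auto
        also have "\<dots> = u * (u * B)" by (simp add: power2_eq_square)
        also have "\<dots> \<le> u * (d / 2)" using u by (intro mult_left_mono) auto
        finally show ?thesis by linarith
      qed
      finally have "u * (2 * P) < u * d" by (simp add: algebra_simps)
      then have "P \<le> d / 2" using u by simp
      moreover have "P = (\<Sum>t\<in>T. (f t - k t) * ?m t) - (\<Sum>t\<in>T. (f t - k t) * f t) + E k"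
        unfolding P_def E_def sum_subtractf[symmetric] sum.distrib[symmetric]
        by (intro sum.cong refl) (simp add: power2_eq_square algebra_simps)
      ultimately show "(\<Sum>t\<in>T. (f t - k t) * ?m t) \<le> (\<Sum>t\<in>T. (f t - k t) * f t) - d / 2"
        using dE[OF k(1)] by linarith
    qed (use d in auto)
  qed
  then have "\<exists>y\<in>E ` Collect kernel_hull. y < \<epsilon>\<^sup>2"
    using cInf_lessD[OF ne, of "\<epsilon>\<^sup>2"] \<epsilon> unfolding d_def[symmetric] by (simp add: order.strict_trans1)
  then obtain k where k: "kernel_hull k" "E k < \<epsilon>\<^sup>2" by auto
  have "\<bar>f t - k t\<bar> < \<epsilon>" if "t \<in> T" for t
  proof -
    have "(f t - k t)\<^sup>2 \<le> E k" unfolding E_def using T that by (intro member_le_sum) auto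
    then have "(f t - k t)\<^sup>2 < \<epsilon>\<^sup>2" using k by linarith
    then show ?thesis using \<epsilon> abs_le_square_iff[of \<epsilon> "f t - k t"] by linarith
  qed
  then show ?thesis using k by blast
qed

lemma op_mono_funs_one: "f \<in> op_mono_funs \<Longrightarrow> f 1 = 0"
  by (simp add: op_mono_funs_def)

lemma op_mono_funs_increment:
  assumes f: "f \<in> op_mono_funs" and u: "0 < u" "u \<le> t"
  shows "0 \<le> f t - f u" "f t - f u \<le> (t - u) / (min 1 u)\<^sup>2"
proof -
  have ap: "\<exists>k. kernel_hull k \<and> \<bar>f t - k t\<bar> < e / 2 \<and> \<bar>f u - k u\<bar> < e / 2" if "0 < e" for e
    using op_mono_funs_pointwise_hull[OF f, of "{t, u}" "e / 2"] that u by auto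
  have "- e \<le> f t - f u" if "0 < e" for e
  proof -
    from ap[OF that] obtain k where "kernel_hull k" "\<bar>f t - k t\<bar> < e / 2" "\<bar>f u - k u\<bar> < e / 2" by blast
    with kernel_hull_increment(1)[of k u t] u show ?thesis by linarith
  qed
  from this[of "(f u - f t) / 2"] show "0 \<le> f t - f u" by argo
  show "f t - f u \<le> (t - u) / (min 1 u)\<^sup>2"
  proof (rule field_le_epsilon)
    fix e :: real assume "0 < e"
    from ap[OF this] obtain k where "kernel_hull k" "\<bar>f t - k t\<bar> < e / 2" "\<bar>f u - k u\<bar> < e / 2" by blast
    with kernel_hull_increment(2)[of k u t] u show "f t - f u \<le> (t - u) / (min 1 u)\<^sup>2 + e" by linarith
  qed
qed

lemma op_mono_funs_bound:
  assumes f: "f \<in> op_mono_funs" and t: "0 < t"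
  shows "\<bar>f t\<bar> \<le> t + 1 / t"
proof (rule field_le_epsilon)
  fix e :: real assume "0 < e"
  then obtain k where "kernel_hull k" "\<bar>f t - k t\<bar> < e"
    using op_mono_funs_pointwise_hull[OF f, of "{t}" e] t by auto
  with kernel_hull_bound[of k t] t show "\<bar>f t\<bar> \<le> t + 1 / t + e" by linarith
qed

text \<open>The common modulus of continuity of all normalized operator monotone functions and of the hull. It turns
  pointwise closeness on a finite net into uniform closeness.\<close>

definition lipschitz_above :: "real \<Rightarrow> (real \<Rightarrow> real) \<Rightarrow> bool" where
  "lipschitz_above a g \<longleftrightarrow> (\<forall>t\<ge>a. \<forall>u\<ge>a. \<bar>g t - g u\<bar> \<le> \<bar>t - u\<bar> / (min 1 a)\<^sup>2)"

lemma lipschitz_aboveI: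
  assumes inc: "\<And>u t. 0 < u \<Longrightarrow> u \<le> t \<Longrightarrow> 0 \<le> g t - g u" "\<And>u t. 0 < u \<Longrightarrow> u \<le> t \<Longrightarrow> g t - g u \<le> (t - u) / (min 1 u)\<^sup>2"
    and a: "0 < a"
  shows "lipschitz_above a g"
proof -
  have le: "\<bar>g t - g u\<bar> \<le> \<bar>t - u\<bar> / (min 1 a)\<^sup>2" if "a \<le> t" "t \<le> u" for t u
  proof -
    have "g u - g t \<le> (u - t) / (min 1 t)\<^sup>2" "0 \<le> g u - g t" using inc that a by auto
    moreover have "(u - t) / (min 1 t)\<^sup>2 \<le> (u - t) / (min 1 a)\<^sup>2"
      using that a by (intro divide_left_mono power_mono) auto
    ultimately show ?thesis using that by simp
  qed
  have "\<bar>g t - g u\<bar> \<le> \<bar>t - u\<bar> / (min 1 a)\<^sup>2" if "a \<le> t" "a \<le> u" for t u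
    using le[of t u] le[of u t] that by (cases "t \<le> u") (simp_all add: abs_minus_commute)
  then show ?thesis by (simp add: lipschitz_above_def)
qed

lemma kernel_hull_lipschitz: "kernel_hull k \<Longrightarrow> 0 < a \<Longrightarrow> lipschitz_above a k"
  by (intro lipschitz_aboveI kernel_hull_increment)

lemma op_mono_funs_lipschitz: "f \<in> op_mono_funs \<Longrightarrow> 0 < a \<Longrightarrow> lipschitz_above a f"
  by (intro lipschitz_aboveI op_mono_funs_increment)

lemma lipschitz_above_continuous_on:
  assumes g: "lipschitz_above a g" and a: "0 < a"
  shows "continuous_on {a..b} g"
proof (rule continuous_onI)
  fix x e :: real assume x: "x \<in> {a..b}" and e: "0 < e"
  have c: "0 < (min 1 a)\<^sup>2" using a by simp
  show "\<exists>d>0. \<forall>x'\<in>{a..b}. dist x' x < d \<longrightarrow> dist (g x') (g x) \<le> e"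
  proof (intro exI[of _ "e * (min 1 a)\<^sup>2"] conjI ballI impI)
    fix x' assume "x' \<in> {a..b}" "dist x' x < e * (min 1 a)\<^sup>2"
    then have "\<bar>x' - x\<bar> / (min 1 a)\<^sup>2 < e" "\<bar>g x' - g x\<bar> \<le> \<bar>x' - x\<bar> / (min 1 a)\<^sup>2"
      using g x c by (auto simp: lipschitz_above_def dist_real_def divide_less_eq)
    then show "dist (g x') (g x) \<le> e" by (simp add: dist_real_def)
  qed (use e c in auto)
qed

lemma kernel_hull_continuous_on: "kernel_hull k \<Longrightarrow> 0 < a \<Longrightarrow> continuous_on {a..b} k"
  by (intro lipschitz_above_continuous_on kernel_hull_lipschitz)

lemma op_mono_funs_continuous_on: "f \<in> op_mono_funs \<Longrightarrow> 0 < a \<Longrightarrow> continuous_on {a..b} f"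
  by (intro lipschitz_above_continuous_on op_mono_funs_lipschitz)

lemma lipschitz_close_on_net:
  fixes a b e :: real
  assumes "0 < a" "0 < e"
  shows "\<exists>T. finite T \<and> T \<subseteq> {a..b} \<and>
    (\<forall>f g. lipschitz_above a f \<longrightarrow> lipschitz_above a g \<longrightarrow> (\<forall>t\<in>T. \<bar>f t - g t\<bar> < e / 3) \<longrightarrow>
      (\<forall>t\<in>{a..b}. \<bar>f t - g t\<bar> < e))"
proof -
  define c where "c = (min 1 a)\<^sup>2"
  have c: "0 < c" using assms by (simp add: c_def)
  define r where "r = e * c / 3"
  have r: "0 < r" using c assms by (simp add: r_def)
  obtain T where T: "T \<subseteq> {a..b}" "finite T" "{a..b} \<subseteq> (\<Union>u\<in>T. ball u r)"
    by (rule compactE_image[of "{a..b}" "{a..b}" "\<lambda>u. ball u r"]) (use r in auto)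
  show ?thesis
  proof (intro exI[of _ T] conjI allI impI ballI T)
    fix f g t
    assume f: "lipschitz_above a f" and g: "lipschitz_above a g"
      and fg: "\<forall>t\<in>T. \<bar>f t - g t\<bar> < e / 3" and t: "t \<in> {a..b}"
    from t T obtain u where u: "u \<in> T" "\<bar>t - u\<bar> < r" by (fastforce simp: dist_real_def abs_minus_commute)
    then have "\<bar>t - u\<bar> / c < e / 3" using c by (simp add: r_def field_simps)
    moreover have fu: "\<bar>f t - f u\<bar> \<le> \<bar>t - u\<bar> / c" and gu: "\<bar>g t - g u\<bar> \<le> \<bar>t - u\<bar> / c"
      using f g t u T by (auto simp: lipschitz_above_def c_def)
    ultimately show "\<bar>f t - g t\<bar> < e"
      using fu gu fg[rule_format, OF u(1)] by linarith
  qed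
qed

lemma op_mono_funs_uniform_hull:
  assumes f: "f \<in> op_mono_funs" and a: "0 < a" and e: "0 < e"
  shows "\<exists>k. kernel_hull k \<and> (\<forall>t\<in>{a..b}. \<bar>f t - k t\<bar> < e)"
proof -
  obtain T where T: "finite T" "T \<subseteq> {a..b}"
    "\<forall>f g. lipschitz_above a f \<longrightarrow> lipschitz_above a g \<longrightarrow> (\<forall>t\<in>T. \<bar>f t - g t\<bar> < e / 3) \<longrightarrow>
      (\<forall>t\<in>{a..b}. \<bar>f t - g t\<bar> < e)"
    using lipschitz_close_on_net[OF a e, of b] by blast
  have "T \<subseteq> {0<..}" using T(2) a by auto
  then obtain k where k: "kernel_hull k" "\<forall>t\<in>T. \<bar>f t - k t\<bar> < e / 3"
    using op_mono_funs_pointwise_hull[OF f T(1), of "e / 3"] e by auto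
  have "\<forall>t\<in>{a..b}. \<bar>f t - k t\<bar> < e"
    using T(3) op_mono_funs_lipschitz[OF f a] kernel_hull_lipschitz[OF k(1) a] k(2) by blast
  then show ?thesis using k by blast
qed

section \<open>Forms and self-adjoint operators on a complex Hilbert space\<close>

text \<open>The real inner product. All estimates are made with it; complex linearity is carried separately by
  membership in \<^const>\<open>self_adjoint_ops\<close>.\<close>

definition ip :: "'e::complex_hilbert_space \<Rightarrow> 'e \<Rightarrow> real" where
  "ip x y = Re (cinner x y)"

lemma cinner_add_right: "cinner x (y + z) = cinner x y + cinner (x::'e::complex_hilbert_space) z"
  using cinner_add_left[of y z x] cinner_commute[of x] by (metis complex_cnj_add)

lemma cinner_scaleC_right: "cinner x (c *\<^sub>C y) = cnj c * cinner (x::'e::complex_hilbert_space) y"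
  using cinner_scaleC_left[of c y x] cinner_commute[of x] by (metis complex_cnj_mult)

lemma cinner_scaleR_left: "cinner (r *\<^sub>R x) y = of_real r * cinner (x::'e::complex_hilbert_space) y"
  by (simp add: scaleR_scaleC cinner_scaleC_left)

lemma cinner_scaleR_right: "cinner x (r *\<^sub>R y) = of_real r * cinner (x::'e::complex_hilbert_space) y"
  by (simp add: scaleR_scaleC cinner_scaleC_right)

lemma ip_commute: "ip x y = ip y x"
  unfolding ip_def by (subst cinner_commute) simp

lemma ip_self: "ip x x = (norm x)\<^sup>2"
  by (simp add: ip_def norm_eq_sqrt_cinner cinner_self_nonneg)

lemma quadratic_nonneg_discriminant:
  fixes a b c :: real
  assumes "\<And>t. 0 \<le> a + 2 * b * t + c * t\<^sup>2"
  shows "b\<^sup>2 \<le> a * c"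
proof -
  have c: "0 \<le> c"
  proof (rule ccontr)
    assume "\<not> 0 \<le> c"
    then have c: "c < 0" by simp
    define t where "t = sqrt ((\<bar>a\<bar> + 1) / (- c))"
    have "0 < (\<bar>a\<bar> + 1) / (- c)" using c by (intro divide_pos_pos) auto
    then have "c * t\<^sup>2 = - (\<bar>a\<bar> + 1)" using c unfolding t_def by (subst real_sqrt_pow2) auto
    moreover have "0 \<le> a + c * t\<^sup>2" using assms[of t] assms[of "- t"] by simp
    ultimately show False by linarith
  qed
  show ?thesis
  proof (cases "c = 0")
    case True
    have "b = 0"
    proof (rule ccontr)
      assume "b \<noteq> 0"
      with assms[of "- (\<bar>a\<bar> + 1) / (2 * b)"] True show False by simp
    qed
    with True show ?thesis by simp
  next
    case False
    with c have "0 < c" by simp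
    have "0 \<le> c * (a + 2 * b * (- b / c) + c * (- b / c)\<^sup>2)"
      using assms[of "- b / c"] c by (rule mult_nonneg_nonneg[rotated])
    also have "\<dots> = a * c - b\<^sup>2" using \<open>0 < c\<close> by (simp add: field_simps power2_eq_square)
    finally show ?thesis by simp
  qed
qed

lemma ip_add_left: "ip (x + y) z = ip x z + ip y z"
  and ip_add_right: "ip x (y + z) = ip x y + ip x z"
  and ip_scaleR_left: "ip (r *\<^sub>R x) y = r * ip x y"
  and ip_scaleR_right: "ip x (r *\<^sub>R y) = r * ip x y"
  by (simp_all add: ip_def cinner_add_left cinner_add_right cinner_scaleR_left cinner_scaleR_right)

lemma ip_minus_left: "ip (- x) y = - ip x y"
  and ip_minus_right: "ip x (- y) = - ip x y"
  using ip_scaleR_left[of "-1" x y] ip_scaleR_right[of x "-1" y] by simp_all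

lemma ip_diff_left: "ip (x - y) z = ip x z - ip y z"
  and ip_diff_right: "ip x (y - z) = ip x y - ip x z"
  using ip_add_left[of x "- y" z] ip_add_right[of x y "- z"] by (simp_all add: ip_minus_left ip_minus_right)

lemma ip_zero [simp]: "ip 0 y = 0" "ip x 0 = 0"
  using ip_scaleR_left[of 0 0 y] ip_scaleR_right[of x 0 0] by simp_all

lemmas ip_simps = ip_add_left ip_add_right ip_diff_left ip_diff_right ip_minus_left ip_minus_right
  ip_scaleR_left ip_scaleR_right

lemma ip_cauchy_schwarz: "\<bar>ip x y\<bar> \<le> norm x * norm y"
proof -
  have "0 \<le> (norm x)\<^sup>2 + 2 * ip x y * t + (norm y)\<^sup>2 * t\<^sup>2" for t
  proof -
    have "ip (x + t *\<^sub>R y) (x + t *\<^sub>R y) = ip x x + 2 * ip x y * t + ip y y * t\<^sup>2"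
      by (simp add: ip_simps ip_commute[of y x] power2_eq_square algebra_simps)
    then show ?thesis unfolding ip_self by (metis zero_le_power2)
  qed
  then have "(ip x y)\<^sup>2 \<le> (norm x)\<^sup>2 * (norm y)\<^sup>2" by (rule quadratic_nonneg_discriminant)
  then have "(ip x y)\<^sup>2 \<le> (norm x * norm y)\<^sup>2" by (simp add: power_mult_distrib)
  then show ?thesis by (simp add: power2_le_iff_abs_le)
qed

lemma cinner_ip: "cinner x y = Complex (ip x y) (ip x (\<i> *\<^sub>C y))"
  by (simp add: complex_eq_iff ip_def cinner_scaleC_right)

lemma ip_eqI: "(\<And>y. ip x y = ip z y) \<Longrightarrow> x = z"
proof -
  assume "\<And>y. ip x y = ip z y"
  then have "ip (x - z) (x - z) = 0" by (simp add: ip_diff_left)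
  then show "x = z" by (simp add: ip_self)
qed

lemma norm_ii_scaleC: "norm (\<i> *\<^sub>C x) = norm (x::'e::complex_hilbert_space)"
  by (simp add: norm_eq_sqrt_cinner cinner_scaleC_left cinner_scaleC_right)

lemma norm_cinner_le: "cmod (cinner x y) \<le> 2 * (norm x * norm y)"
proof -
  have "cmod (cinner x y) \<le> \<bar>Re (cinner x y)\<bar> + \<bar>Im (cinner x y)\<bar>" by (rule cmod_le)
  also have "\<dots> \<le> norm x * norm y + norm x * norm y"
    using ip_cauchy_schwarz[of x y] ip_cauchy_schwarz[of x "\<i> *\<^sub>C y"]
    by (intro add_mono) (simp_all add: cinner_ip norm_ii_scaleC)
  finally show ?thesis by simp
qed

lemma bounded_bilinear_ip: "bounded_bilinear (ip :: 'e::complex_hilbert_space \<Rightarrow> 'e \<Rightarrow> real)"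
  by standard (auto simp: ip_simps intro!: exI[of _ 1] ip_cauchy_schwarz)

lemmas tendsto_ip = bounded_bilinear.tendsto[OF bounded_bilinear_ip]

lemma self_adjoint_ops_iff:
  "T \<in> self_adjoint_ops \<longleftrightarrow> (\<forall>c x. T (c *\<^sub>C x) = c *\<^sub>C T x) \<and> (\<forall>x y. ip (T x) y = ip x (T y))"
proof -
  have "cinner (T x) y = cinner x (T y)"
    if "\<forall>c x. T (c *\<^sub>C x) = c *\<^sub>C T x" "\<forall>x y. ip (T x) y = ip x (T y)" for x y
    using that by (simp add: cinner_ip)
  then show ?thesis unfolding self_adjoint_ops_def by (auto simp: ip_def)
qed

lemma sa_ip: "T \<in> self_adjoint_ops \<Longrightarrow> ip (T x) y = ip x (T y)"
  by (simp add: self_adjoint_ops_iff)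

lemma scaleC_scaleR_commute: "c *\<^sub>C (r *\<^sub>R x) = r *\<^sub>R (c *\<^sub>C (x::'e::complex_hilbert_space))"
  by (simp add: scaleR_scaleC scaleC_scaleC mult.commute)

lemma scaleC_diff_right: "c *\<^sub>C (x - y) = c *\<^sub>C x - c *\<^sub>C (y::'e::complex_hilbert_space)"
  using scaleC_add_right[of c "x - y" y] by simp

lemma scaleC_zero_right: "c *\<^sub>C (0::'e::complex_hilbert_space) = 0"
  using scaleC_diff_right[of c 0 0] by simp

lemma sa_zero [simp]: "0 \<in> self_adjoint_ops"
  and sa_id [simp]: "id_blinfun \<in> self_adjoint_ops"
  by (simp_all add: self_adjoint_ops_iff scaleC_zero_right)

lemma sa_add [simp]: "S \<in> self_adjoint_ops \<Longrightarrow> T \<in> self_adjoint_ops \<Longrightarrow> S + T \<in> self_adjoint_ops"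
  and sa_diff [simp]: "S \<in> self_adjoint_ops \<Longrightarrow> T \<in> self_adjoint_ops \<Longrightarrow> S - T \<in> self_adjoint_ops"
  and sa_scaleR [simp]: "T \<in> self_adjoint_ops \<Longrightarrow> r *\<^sub>R T \<in> self_adjoint_ops"
  by (simp_all add: self_adjoint_ops_iff blinfun.add_left blinfun.diff_left blinfun.scaleR_left ip_simps
      scaleC_add_right scaleC_diff_right scaleC_scaleR_commute)

lemma sa_compose_commute:
  "S \<in> self_adjoint_ops \<Longrightarrow> T \<in> self_adjoint_ops \<Longrightarrow> S o\<^sub>L T = T o\<^sub>L S \<Longrightarrow> S o\<^sub>L T \<in> self_adjoint_ops"
  unfolding self_adjoint_ops_iff by simp (metis blinfun_apply_blinfun_compose)

lemma sa_sandwich [simp]: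
  "S \<in> self_adjoint_ops \<Longrightarrow> T \<in> self_adjoint_ops \<Longrightarrow> S o\<^sub>L T o\<^sub>L S \<in> self_adjoint_ops"
  unfolding self_adjoint_ops_iff by simp

lemma sa_limit:
  assumes "\<And>n. S n \<in> self_adjoint_ops" "S \<longlonglongrightarrow> T"
  shows "T \<in> self_adjoint_ops"
  unfolding self_adjoint_ops_iff
proof (intro conjI allI)
  have lim: "(\<lambda>n. S n x) \<longlonglongrightarrow> T x" for x
    using assms(2) by (intro blinfun.tendsto) auto
  fix c x y
  have "(\<lambda>n. ip (S n x) y) \<longlonglongrightarrow> ip (T x) y" "(\<lambda>n. ip x (S n y)) \<longlonglongrightarrow> ip x (T y)"
    by (intro tendsto_ip lim tendsto_const)+
  moreover have "ip (S n x) y = ip x (S n y)" for n using assms(1) by (rule sa_ip)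
  ultimately show "ip (T x) y = ip x (T y)" using LIMSEQ_unique by simp
  have "ip (T (c *\<^sub>C x)) z = ip (c *\<^sub>C T x) z" for z
  proof -
    have adj: "ip (c *\<^sub>C u) z = ip u (cnj c *\<^sub>C z)" for u
      by (simp add: ip_def cinner_scaleC_left cinner_scaleC_right)
    have "(\<lambda>n. ip (S n (c *\<^sub>C x)) z) \<longlonglongrightarrow> ip (T (c *\<^sub>C x)) z"
      by (intro tendsto_ip lim tendsto_const)
    moreover have "(\<lambda>n. ip (S n x) (cnj c *\<^sub>C z)) \<longlonglongrightarrow> ip (T x) (cnj c *\<^sub>C z)"
      by (intro tendsto_ip lim tendsto_const)
    moreover have "ip (S n (c *\<^sub>C x)) z = ip (S n x) (cnj c *\<^sub>C z)" for n
      using assms(1)[of n] by (simp add: self_adjoint_ops_iff adj)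
    ultimately show ?thesis using LIMSEQ_unique adj by simp
  qed
  then show "T (c *\<^sub>C x) = c *\<^sub>C T x" by (rule ip_eqI)
qed

lemma op_le_iff:
  "A \<preceq> B \<longleftrightarrow> A \<in> self_adjoint_ops \<and> B \<in> self_adjoint_ops \<and> (\<forall>x. ip (A x) x \<le> ip (B x) x)"
  unfolding op_le_def pos_semidef_def ip_def[symmetric] by (auto simp: blinfun.diff_left ip_simps)

definition op_between :: "real \<Rightarrow> real \<Rightarrow> ('e::complex_hilbert_space \<Rightarrow>\<^sub>L 'e) set" where
  "op_between a b = {T. a *\<^sub>R id_blinfun \<preceq> T \<and> T \<preceq> b *\<^sub>R id_blinfun}"

lemma op_between_iff:
  "T \<in> op_between a b \<longleftrightarrow> T \<in> self_adjoint_ops \<and> (\<forall>x. a * (norm x)\<^sup>2 \<le> ip (T x) x \<and> ip (T x) x \<le> b * (norm x)\<^sup>2)"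
  unfolding op_between_def op_le_iff by (auto simp: blinfun.scaleR_left ip_simps ip_self)

lemma op_betweenD:
  assumes "T \<in> op_between a b"
  shows "T \<in> self_adjoint_ops" "a * (norm x)\<^sup>2 \<le> ip (T x) x" "ip (T x) x \<le> b * (norm x)\<^sup>2"
  using assms by (auto simp: op_between_iff)

lemma op_between_mono: "T \<in> op_between a b \<Longrightarrow> a' \<le> a \<Longrightarrow> b \<le> b' \<Longrightarrow> T \<in> op_between a' b'"
  unfolding op_between_iff by (meson mult_right_mono order.trans zero_le_power2)

lemma op_interval_eq: "op_interval r = op_between (exp (- r)) (exp r)"
  by (simp add: op_interval_def op_between_def)

lemma pos_def_ops_iff: "T \<in> pos_def_ops \<longleftrightarrow> (\<exists>a b. 0 < a \<and> T \<in> op_between a b)"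
proof
  assume "T \<in> pos_def_ops"
  then obtain k :: nat where "1 \<le> k" "T \<in> op_between (1 / real k) (real k)"
    unfolding pos_def_ops_def op_between_def by auto
  then show "\<exists>a b. 0 < a \<and> T \<in> op_between a b" by (intro exI[of _ "1 / real k"] exI[of _ "real k"]) auto
next
  assume "\<exists>a b. 0 < a \<and> T \<in> op_between a b"
  then obtain a b where ab: "0 < a" "T \<in> op_between a b" by blast
  obtain k :: nat where k: "1 / a + \<bar>b\<bar> + 1 \<le> real k" using real_arch_simple by blast
  have a1: "0 < 1 / a" using ab by simp
  have k1: "1 \<le> real k" "1 / a \<le> real k" "b \<le> real k" using k a1 by (smt (verit))+
  have "1 / real k \<le> a" using k1 ab by (simp add: field_simps)
  then have "T \<in> op_between (1 / real k) (real k)" using op_between_mono[OF ab(2)] k1 by blast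
  then show "T \<in> pos_def_ops" using k1 by (auto simp: pos_def_ops_def op_between_def op_le_iff)
qed

text \<open>Polarization with a vector \<open>y\<close> of the same norm as \<open>x\<close> in the direction of \<open>T x\<close>.\<close>

lemma sa_norm_le:
  assumes T: "T \<in> self_adjoint_ops" and M: "\<And>x. \<bar>ip (T x) x\<bar> \<le> M * (norm x)\<^sup>2"
    and M0: "0 \<le> M"
  shows "norm T \<le> M"
proof (rule norm_blinfun_bound[OF M0])
  fix x
  show "norm (T x) \<le> M * norm x"
  proof (cases "T x = 0 \<or> x = 0")
    case True
    then show ?thesis using M0 by auto
  next
    case False
    define t where "t = norm x / norm (T x)"
    have t: "0 < t" using False by (simp add: t_def)
    define y where "y = t *\<^sub>R T x"
    have ny: "norm y = norm x" using False by (simp add: y_def t_def)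
    have "4 * ip (T x) y = ip (T (x + y)) (x + y) - ip (T (x - y)) (x - y)"
      using sa_ip[OF T, of y x] ip_commute[of y "T x"] by (simp add: blinfun.add_right blinfun.diff_right ip_simps)
    also have "\<dots> \<le> M * (norm (x + y))\<^sup>2 + M * (norm (x - y))\<^sup>2"
      using M[of "x + y"] M[of "x - y"] by linarith
    also have "\<dots> = 2 * M * ((norm x)\<^sup>2 + (norm y)\<^sup>2)"
      by (simp add: ip_self[symmetric] ip_simps algebra_simps)
    also have "\<dots> = 4 * (M * norm x * norm x)" by (simp add: ny power2_eq_square)
    finally have "ip (T x) y \<le> M * norm x * norm x" by simp
    moreover have "ip (T x) y = norm (T x) * norm x"
      unfolding y_def t_def using False by (simp add: ip_simps ip_self power2_eq_square)
    ultimately show ?thesis using False by simp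
  qed
qed

lemma op_between_norm_le:
  fixes T :: "'e::complex_hilbert_space \<Rightarrow>\<^sub>L 'e"
  assumes T: "T \<in> op_between a b" and "- M \<le> a" "b \<le> M" "0 \<le> M"
  shows "norm T \<le> M"
proof (rule sa_norm_le)
  fix x :: 'e
  have "- M * (norm x)\<^sup>2 \<le> a * (norm x)\<^sup>2" "b * (norm x)\<^sup>2 \<le> M * (norm x)\<^sup>2"
    using assms by (intro mult_right_mono; simp)+
  then show "\<bar>ip (T x) x\<bar> \<le> M * (norm x)\<^sup>2"
    using op_betweenD(2,3)[OF T, of x] by linarith
qed (use assms op_betweenD in auto)

text \<open>The Cauchy-Schwarz inequality of the form \<open>\<langle>W x, y\<rangle>\<close> at \<open>y = W x\<close>.\<close>

lemma psd_norm_square_le: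
  fixes W :: "'e::complex_hilbert_space \<Rightarrow>\<^sub>L 'e"
  assumes W: "W \<in> self_adjoint_ops" "\<And>x. 0 \<le> ip (W x) x" "\<And>x. ip (W x) x \<le> M * (norm x)\<^sup>2"
  shows "(norm (W x))\<^sup>2 \<le> M * ip (W x) x"
proof (cases "W x = 0")
  case True
  then show ?thesis by simp
next
  case False
  let ?y = "W x"
  have "0 \<le> ip (W x) x + 2 * ip (W x) ?y * t + ip (W ?y) ?y * t\<^sup>2" for t
  proof -
    have "0 \<le> ip (W (x + t *\<^sub>R ?y)) (x + t *\<^sub>R ?y)" by (rule W(2))
    then show ?thesis
      using sa_ip[OF W(1), of ?y x]
      by (simp add: blinfun.add_right blinfun.scaleR_right ip_simps power2_eq_square algebra_simps)
  qed
  then have "(ip (W x) ?y)\<^sup>2 \<le> ip (W x) x * ip (W ?y) ?y" by (rule quadratic_nonneg_discriminant)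
  also have "\<dots> \<le> ip (W x) x * (M * (norm ?y)\<^sup>2)" using W by (intro mult_left_mono) auto
  finally have "(norm ?y)\<^sup>2 * (norm ?y)\<^sup>2 \<le> (M * ip (W x) x) * (norm ?y)\<^sup>2"
    by (simp add: ip_self power2_eq_square ac_simps)
  then show ?thesis using False by (simp only: mult_le_cancel_right) auto
qed

definition op_inverse :: "('e::complex_hilbert_space \<Rightarrow>\<^sub>L 'e) \<Rightarrow> ('e \<Rightarrow>\<^sub>L 'e) \<Rightarrow> bool" where
  "op_inverse T S \<longleftrightarrow> S o\<^sub>L T = id_blinfun \<and> T o\<^sub>L S = id_blinfun"

lemma op_inverse_apply:
  assumes "op_inverse T S" shows "S (T x) = x" "T (S x) = x"
  using assms unfolding op_inverse_def by (metis blinfun_apply_blinfun_compose blinfun_apply_id_blinfun id_apply)+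

text \<open>The equation \<open>T x = y\<close> is the fixed point equation of \<open>x \<mapsto> x - \<tau> (T x - y)\<close>, which is a
  contraction for \<open>\<tau> = 1 / (\<parallel>T\<parallel> + c)\<close>, where the form of \<open>1 - \<tau> T\<close> lies between \<open>0\<close> and \<open>1 - \<tau> c\<close>.\<close>

lemma coercive_invertible:
  fixes T :: "'e::complex_hilbert_space \<Rightarrow>\<^sub>L 'e"
  assumes T: "T \<in> self_adjoint_ops" and c: "0 < c" "\<And>x. c * (norm x)\<^sup>2 \<le> ip (T x) x"
  shows "\<exists>S. op_inverse T S"
proof -
  define \<tau> where "\<tau> = 1 / (norm T + c)"
  have \<tau>: "0 < \<tau>" using c by (simp add: \<tau>_def add_nonneg_pos)
  define q where "q = 1 - \<tau> * c"
  have q: "0 \<le> q" "q < 1"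
  proof -
    have "\<tau> * c \<le> 1" using c by (simp add: \<tau>_def divide_le_eq add_nonneg_pos)
    then show "0 \<le> q" by (simp add: q_def)
    show "q < 1" using \<tau> c by (simp add: q_def)
  qed
  define K where "K = id_blinfun - \<tau> *\<^sub>R T"
  have Tn: "ip (T x) x \<le> norm T * (norm x)\<^sup>2" for x
  proof -
    have "ip (T x) x \<le> norm (T x) * norm x" using ip_cauchy_schwarz[of "T x" x] by linarith
    also have "\<dots> \<le> (norm T * norm x) * norm x" by (intro mult_right_mono norm_blinfun) auto
    finally show ?thesis by (simp add: power2_eq_square)
  qed
  have "norm K \<le> q"
  proof (rule sa_norm_le)
    show "K \<in> self_adjoint_ops" using T by (simp add: K_def)
    fix x
    have e: "ip (K x) x = (norm x)\<^sup>2 - \<tau> * ip (T x) x"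
      by (simp add: K_def blinfun.diff_left blinfun.scaleR_left ip_simps ip_self)
    have "\<tau> * ip (T x) x \<le> \<tau> * ((norm T + c) * (norm x)\<^sup>2)"
      using Tn[of x] c \<tau> by (intro mult_left_mono) (auto simp: distrib_right intro: add_increasing2)
    also have "\<dots> = (norm x)\<^sup>2" using c norm_ge_zero[of T] unfolding \<tau>_def by (simp add: add_nonneg_eq_0_iff)
    finally have "\<tau> * ip (T x) x \<le> (norm x)\<^sup>2" .
    moreover have "\<tau> * (c * (norm x)\<^sup>2) \<le> \<tau> * ip (T x) x" using c \<tau> by (intro mult_left_mono) auto
    ultimately show "\<bar>ip (K x) x\<bar> \<le> q * (norm x)\<^sup>2" unfolding e q_def by (simp add: algebra_simps)
  qed (rule q)
  then have Kq: "norm (K x) \<le> q * norm x" for x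
    by (meson mult_right_mono norm_blinfun norm_ge_zero order.trans)
  have ex: "\<exists>x. T x = y" for y
  proof -
    have "\<exists>!x. K x + \<tau> *\<^sub>R y = x"
    proof (rule banach_fix_type[OF q])
      show "\<forall>x z. dist (K x + \<tau> *\<^sub>R y) (K z + \<tau> *\<^sub>R y) \<le> q * dist x z"
        using Kq by (auto simp: dist_norm blinfun.diff_right[symmetric])
    qed
    then obtain x where "K x + \<tau> *\<^sub>R y = x" by blast
    then have "x - \<tau> *\<^sub>R T x + \<tau> *\<^sub>R y = x" by (simp add: K_def blinfun.diff_left blinfun.scaleR_left)
    moreover have "u = v" if "x - u + v = x" for u v :: 'e using that by (simp add: algebra_simps)
    ultimately have "\<tau> *\<^sub>R T x = \<tau> *\<^sub>R y" by blast
    then show ?thesis using \<tau> by (metis scaleR_cancel_left less_irrefl)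
  qed
  have below: "c * norm x \<le> norm (T x)" for x
  proof (cases "x = 0")
    case False
    have "c * (norm x)\<^sup>2 \<le> norm (T x) * norm x"
      using c(2)[of x] ip_cauchy_schwarz[of "T x" x] by linarith
    then show ?thesis using False by (simp add: power2_eq_square)
  qed simp
  define g where "g y = (SOME x. T x = y)" for y
  have Tg: "T (g y) = y" for y unfolding g_def by (rule someI_ex[OF ex])
  have inj: "x = z" if "T x = T z" for x z
  proof -
    have "T (x - z) = 0" using that by (simp add: blinfun.diff_right)
    then have "c * norm (x - z) \<le> 0" using below[of "x - z"] by simp
    then show ?thesis using c(1) by (simp add: mult_le_0_iff)
  qed
  have gT: "g (T x) = x" for x by (rule inj) (rule Tg)
  have lin: "bounded_linear g"
  proof (rule bounded_linear_intro[of _ "1 / c"])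
    show "g (x + y) = g x + g y" for x y by (rule inj) (simp add: Tg blinfun.add_right)
    show "g (r *\<^sub>R x) = r *\<^sub>R g x" for r x by (rule inj) (simp add: Tg blinfun.scaleR_right)
    show "norm (g x) \<le> norm x * (1 / c)" for x using below[of "g x"] c(1) by (simp add: Tg field_simps)
  qed
  define S where "S = Blinfun g"
  have S: "blinfun_apply S = g" unfolding S_def by (rule bounded_linear_Blinfun_apply[OF lin])
  have "op_inverse T S"
    unfolding op_inverse_def by (auto intro!: blinfun_eqI simp: S gT Tg)
  then show ?thesis by blast
qed

section \<open>Spectrum and functional calculus\<close>

lemma op_poly_eq_sum:
  assumes "degree p \<le> n"
  shows "op_poly p T = (\<Sum>i\<le>n. coeff p i *\<^sub>R (((\<lambda>S. T o\<^sub>L S) ^^ i) id_blinfun))"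
  unfolding op_poly_def using assms
  by (intro sum.mono_neutral_left) (auto simp: coeff_eq_0)

lemma op_poly_0 [simp]: "op_poly 0 T = 0"
  by (simp add: op_poly_def)

lemma op_poly_add: "op_poly (p + q) T = op_poly p T + op_poly q T"
proof -
  let ?n = "max (degree p) (degree q)"
  have "degree (p + q) \<le> ?n" by (rule degree_add_le_max)
  then show ?thesis
    by (simp add: op_poly_eq_sum[of _ ?n] scaleR_add_left sum.distrib)
qed

lemma op_poly_smult: "op_poly (Polynomial.smult c p) T = c *\<^sub>R op_poly p T"
  by (simp add: op_poly_eq_sum[of _ "degree p"] degree_smult_le scaleR_sum_right)

lemma op_poly_diff: "op_poly (p - q) T = op_poly p T - op_poly q T"
proof -
  have "p - q = p + Polynomial.smult (-1) q" by simp
  then show ?thesis by (simp only: op_poly_add op_poly_smult) simp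
qed

lemma op_poly_pCons: "op_poly (pCons a p) T = a *\<^sub>R id_blinfun + (T o\<^sub>L op_poly p T)"
proof -
  have "op_poly (pCons a p) T = (\<Sum>i\<le>Suc (degree p). coeff (pCons a p) i *\<^sub>R (((\<lambda>S. T o\<^sub>L S) ^^ i) id_blinfun))"
    by (rule op_poly_eq_sum) (simp add: degree_pCons_le)
  also have "\<dots> = a *\<^sub>R id_blinfun + (\<Sum>i\<le>degree p. coeff p i *\<^sub>R (T o\<^sub>L (((\<lambda>S. T o\<^sub>L S) ^^ i) id_blinfun)))"
    by (subst sum.atMost_Suc_shift) simp
  also have "(\<Sum>i\<le>degree p. coeff p i *\<^sub>R (T o\<^sub>L (((\<lambda>S. T o\<^sub>L S) ^^ i) id_blinfun))) = T o\<^sub>L op_poly p T"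
    unfolding op_poly_def
    by (simp add: bounded_bilinear.sum_right[OF bounded_bilinear_blinfun_compose]
        bounded_bilinear.scaleR_right[OF bounded_bilinear_blinfun_compose])
  finally show ?thesis .
qed

lemmas blinfun_compose_linear =
  bounded_bilinear.add_left[OF bounded_bilinear_blinfun_compose]
  bounded_bilinear.add_right[OF bounded_bilinear_blinfun_compose]
  bounded_bilinear.diff_left[OF bounded_bilinear_blinfun_compose]
  bounded_bilinear.diff_right[OF bounded_bilinear_blinfun_compose]
  bounded_bilinear.minus_left[OF bounded_bilinear_blinfun_compose]
  bounded_bilinear.minus_right[OF bounded_bilinear_blinfun_compose]
  bounded_bilinear.scaleR_left[OF bounded_bilinear_blinfun_compose]
  bounded_bilinear.scaleR_right[OF bounded_bilinear_blinfun_compose]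

lemma blinfun_compose_id [simp]: "id_blinfun o\<^sub>L T = T" "T o\<^sub>L id_blinfun = T"
  by (auto intro: blinfun_eqI)

lemma blinfun_compose_assoc: "(A o\<^sub>L B) o\<^sub>L C = A o\<^sub>L (B o\<^sub>L C)"
  by (auto intro: blinfun_eqI)

lemma op_poly_mult: "op_poly (p * q) T = op_poly p T o\<^sub>L op_poly q T"
proof (induction p)
  case (pCons a p)
  then show ?case
    by (simp add: op_poly_add op_poly_smult op_poly_pCons blinfun_compose_linear blinfun_compose_assoc)
qed simp

lemma op_poly_const: "op_poly [:c:] T = c *\<^sub>R id_blinfun"
  by (simp add: op_poly_pCons)

lemma op_poly_X: "op_poly [:0, 1:] T = T"
  by (simp add: op_poly_pCons)

lemma sa_op_poly [simp]:
  assumes "T \<in> self_adjoint_ops"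
  shows "op_poly p T \<in> self_adjoint_ops"
proof (induction p)
  case (pCons a p)
  have "T o\<^sub>L op_poly p T = op_poly ([:0, 1:] * p) T" by (simp only: op_poly_mult op_poly_X)
  also have "\<dots> = op_poly (p * [:0, 1:]) T" by (simp only: mult.commute)
  also have "\<dots> = op_poly p T o\<^sub>L T" by (simp only: op_poly_mult op_poly_X)
  finally show ?case using pCons assms by (simp add: op_poly_pCons sa_compose_commute)
qed simp

lemma op_inverse_compose:
  assumes "op_inverse A A'" "op_inverse B B'"
  shows "op_inverse (A o\<^sub>L B) (B' o\<^sub>L A')"
  using op_inverse_apply[OF assms(1)] op_inverse_apply[OF assms(2)]
  unfolding op_inverse_def by (auto intro!: blinfun_eqI)

lemma real_spectrum_iff: "t \<in> real_spectrum T \<longleftrightarrow> (\<nexists>S. op_inverse (T - t *\<^sub>R id_blinfun) S)"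
  by (simp add: real_spectrum_def op_inverse_def)

lemma op_poly_invertible:
  assumes T: "T \<in> self_adjoint_ops" and q: "q \<noteq> 0" "\<And>r. poly q r = 0 \<Longrightarrow> r \<notin> real_spectrum T"
  shows "\<exists>S. op_inverse (op_poly q T) S"
  using q
proof (induction "degree q" arbitrary: q rule: less_induct)
  case less
  show ?case
  proof (cases "degree q = 0")
    case True
    then obtain c where c: "q = [:c:]" by (rule degree_eq_zeroE)
    then have "c \<noteq> 0" using less.prems by auto
    then have "op_inverse (op_poly q T) ((1 / c) *\<^sub>R id_blinfun)"
      unfolding c op_poly_const op_inverse_def by (simp add: blinfun_compose_linear)
    then show ?thesis by blast
  next
    case False
    then have "degree q > 0" by simp
    then show ?thesis
    proof (cases rule: real_poly_factor)
      case (linear r q')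
      have q': "q' \<noteq> 0" using less.prems(1) linear by auto
      have "degree q = 1 + degree q'" unfolding linear using q' by (subst degree_mult_eq) auto
      moreover have "poly q r = 0" by (simp add: linear)
      ultimately obtain S where S: "op_inverse (op_poly q' T) S"
        using less.hyps[of q'] less.prems(2) q' unfolding linear by force
      have "op_poly [:- r, 1:] T = T - r *\<^sub>R id_blinfun" by (simp add: op_poly_pCons)
      moreover have "r \<notin> real_spectrum T" using less.prems(2) \<open>poly q r = 0\<close> by blast
      ultimately obtain S' where "op_inverse (op_poly [:- r, 1:] T) S'" by (auto simp: real_spectrum_iff)
      then show ?thesis using op_inverse_compose[OF _ S] unfolding linear op_poly_mult by blast
    next
      case (quadratic a b q')
      have q': "q' \<noteq> 0" using less.prems(1) quadratic by auto
      have "degree q = 2 + degree q'" unfolding quadratic using q' by (subst degree_mult_eq) auto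
      then obtain S where S: "op_inverse (op_poly q' T) S"
        using less.hyps[of q'] less.prems(2) q' unfolding quadratic by force
      let ?d = "[:a\<^sup>2 + b\<^sup>2, - 2 * a, 1:]"
      have "\<exists>S. op_inverse (op_poly ?d T) S"
      proof (rule coercive_invertible)
        show "op_poly ?d T \<in> self_adjoint_ops" using T by simp
        show "0 < b\<^sup>2" using quadratic by simp
        fix x
        have "ip (op_poly ?d T x) x = (norm (T x - a *\<^sub>R x))\<^sup>2 + b\<^sup>2 * (norm x)\<^sup>2"
        proof -
          have "op_poly ?d T x = (a\<^sup>2 + b\<^sup>2) *\<^sub>R x + (T (T x) - (2 * a) *\<^sub>R T x)"
            by (simp add: op_poly_pCons blinfun.add_left blinfun.diff_left blinfun.scaleR_left blinfun.diff_right blinfun.scaleR_right)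
          then have "ip (op_poly ?d T x) x = (a\<^sup>2 + b\<^sup>2) * ip x x + ip (T x) (T x) - 2 * a * ip (T x) x"
            using sa_ip[OF T, of "T x" x] by (simp add: ip_simps)
          moreover have "(norm (T x - a *\<^sub>R x))\<^sup>2 = ip (T x) (T x) - 2 * a * ip (T x) x + a\<^sup>2 * ip x x"
            unfolding ip_self[symmetric, of "T x - a *\<^sub>R x"] ip_simps ip_commute[of x "T x"]
            by (simp add: power2_eq_square algebra_simps)
          ultimately show ?thesis by (simp add: ip_self algebra_simps)
        qed
        then show "b\<^sup>2 * (norm x)\<^sup>2 \<le> ip (op_poly ?d T x) x" by simp
      qed
      then show ?thesis using op_inverse_compose[OF _ S] unfolding quadratic op_poly_mult by blast
    qed
  qed
qed

text \<open>The infimum \<open>m\<close> of the form of \<open>R\<close> on unit vectors lies in the spectrum: if \<open>W = R - m\<close>, which is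
  positive semidefinite, had a bounded inverse, then \<open>\<parallel>W x\<parallel>\<^sup>2 \<le> M \<langle>W x, x\<rangle>\<close> would bound its form away from \<open>0\<close>. A
  nonzero vector is required, since the zero space has empty spectra.\<close>

lemma form_infimum_not_invertible:
  fixes R :: "'e::complex_hilbert_space \<Rightarrow>\<^sub>L 'e"
  assumes R: "R \<in> self_adjoint_ops" and x0: "x0 \<noteq> 0"
  obtains m where "\<And>x. m * (norm x)\<^sup>2 \<le> ip (R x) x" "m * (norm x0)\<^sup>2 \<le> ip (R x0) x0"
    "m \<in> real_spectrum R"
proof -
  define V where "V = (\<lambda>x. ip (R x) x / (norm x)\<^sup>2) ` {x. x \<noteq> 0}"
  define m where "m = Inf V"
  have bnd: "\<bar>ip (R x) x\<bar> \<le> norm R * (norm x)\<^sup>2" for x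
  proof -
    have "\<bar>ip (R x) x\<bar> \<le> norm (R x) * norm x" by (rule ip_cauchy_schwarz)
    also have "\<dots> \<le> (norm R * norm x) * norm x" by (intro mult_right_mono norm_blinfun) auto
    finally show ?thesis by (simp add: power2_eq_square)
  qed
  have ne: "V \<noteq> {}" using x0 by (auto simp: V_def)
  have bdd: "bdd_below V"
  proof (rule bdd_belowI)
    fix v assume "v \<in> V"
    then obtain x where "x \<noteq> 0" "v = ip (R x) x / (norm x)\<^sup>2" by (auto simp: V_def)
    then show "- norm R \<le> v" using bnd[of x] by (simp add: le_divide_eq)
  qed
  have m: "m * (norm x)\<^sup>2 \<le> ip (R x) x" for x
  proof (cases "x = 0")
    case False
    then have "m \<le> ip (R x) x / (norm x)\<^sup>2" unfolding m_def by (intro cInf_lower bdd) (auto simp: V_def)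
    then show ?thesis using False by (simp add: le_divide_eq)
  qed simp
  have "m \<in> real_spectrum R"
    unfolding real_spectrum_iff
  proof
    let ?W = "R - m *\<^sub>R id_blinfun"
    assume "\<exists>S. op_inverse ?W S"
    then obtain S where S: "op_inverse ?W S" by blast
    have W: "?W \<in> self_adjoint_ops" using R by simp
    have Wf: "ip (?W x) x = ip (R x) x - m * (norm x)\<^sup>2" for x
      by (simp add: blinfun.diff_left blinfun.scaleR_left ip_simps ip_self)
    define M where "M = norm R + \<bar>m\<bar> + 1"
    have M: "0 < M" by (simp add: M_def add_nonneg_pos)
    have WM: "ip (?W x) x \<le> M * (norm x)\<^sup>2" for x
    proof -
      have "- m * (norm x)\<^sup>2 \<le> (\<bar>m\<bar> + 1) * (norm x)\<^sup>2" by (intro mult_right_mono) auto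
      then show ?thesis using bnd[of x] unfolding Wf M_def by (simp add: algebra_simps)
    qed
    define s where "s = norm S + 1"
    have s: "0 < s" by (simp add: s_def add_nonneg_pos)
    define \<eta> where "\<eta> = 1 / (s\<^sup>2 * M)"
    have \<eta>: "0 < \<eta>" using s M by (simp add: \<eta>_def)
    have low: "(m + \<eta>) * (norm x)\<^sup>2 \<le> ip (R x) x" for x
    proof -
      have "norm x = norm (S (?W x))" by (simp only: op_inverse_apply[OF S])
      also have "\<dots> \<le> norm S * norm (?W x)" by (rule norm_blinfun)
      also have "\<dots> \<le> s * norm (?W x)" by (intro mult_right_mono) (auto simp: s_def)
      finally have "(norm x)\<^sup>2 \<le> (s * norm (?W x))\<^sup>2" by (intro power_mono) auto
      also have "\<dots> = s\<^sup>2 * (norm (?W x))\<^sup>2" by (simp add: power_mult_distrib)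
      also have "\<dots> \<le> s\<^sup>2 * (M * ip (?W x) x)"
        using psd_norm_square_le[OF W _ WM, of x] m Wf by (intro mult_left_mono) auto
      finally have "\<eta> * (norm x)\<^sup>2 \<le> ip (?W x) x"
        unfolding \<eta>_def using s M by (simp add: divide_le_eq ac_simps)
      then show ?thesis unfolding Wf by (simp add: algebra_simps)
    qed
    have "m + \<eta> \<le> m"
      unfolding m_def
    proof (rule cInf_greatest[OF ne])
      fix v assume "v \<in> V"
      then obtain x where "x \<noteq> 0" "v = ip (R x) x / (norm x)\<^sup>2" by (auto simp: V_def)
      then show "Inf V + \<eta> \<le> v" using low[of x] by (simp add: le_divide_eq m_def)
    qed
    then show False using \<eta> by simp
  qed
  then show ?thesis using that m by blast
qed

text \<open>If the infimum \<open>m\<close> of the form of \<open>p(T)\<close> were negative, then \<open>p - m\<close> would be positive on the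
  spectrum, and \<open>p(T) - m\<close> would be invertible as a product of invertible factors. The nonemptiness of the
  spectrum excludes that \<open>p\<close> is the constant \<open>m\<close>.\<close>

lemma op_poly_nonneg:
  fixes T :: "'e::complex_hilbert_space \<Rightarrow>\<^sub>L 'e"
  assumes T: "T \<in> self_adjoint_ops" and p: "\<And>t. t \<in> real_spectrum T \<Longrightarrow> 0 \<le> poly p t"
  shows "0 \<le> ip (op_poly p T x) x"
proof (rule ccontr)
  assume neg: "\<not> 0 \<le> ip (op_poly p T x) x"
  then have x: "x \<noteq> 0" by auto
  obtain t0 where t0: "t0 \<in> real_spectrum T" using form_infimum_not_invertible[OF T x] by blast
  obtain m where m: "m * (norm x)\<^sup>2 \<le> ip (op_poly p T x) x" "m \<in> real_spectrum (op_poly p T)"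
    using form_infimum_not_invertible[OF sa_op_poly[OF T] x] by metis
  have m0: "m < 0"
  proof (rule ccontr)
    assume "\<not> m < 0"
    then have "0 \<le> m * (norm x)\<^sup>2" by simp
    with m neg show False by linarith
  qed
  let ?q = "p - [:m:]"
  have qp: "op_poly ?q T = op_poly p T - m *\<^sub>R id_blinfun" by (simp only: op_poly_diff op_poly_const)
  have pq: "0 < poly ?q t" if "t \<in> real_spectrum T" for t using p[OF that] m0 by simp
  have "?q \<noteq> 0" using pq[OF t0] by auto
  moreover have "r \<notin> real_spectrum T" if "poly ?q r = 0" for r using pq that by force
  ultimately have "\<exists>S. op_inverse (op_poly ?q T) S" by (rule op_poly_invertible[OF T])
  with m(2) show False unfolding qp by (simp add: real_spectrum_iff)
qed

lemma op_poly_between: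
  assumes T: "T \<in> self_adjoint_ops" and p: "\<And>t. t \<in> real_spectrum T \<Longrightarrow> a \<le> poly p t \<and> poly p t \<le> b"
  shows "op_poly p T \<in> op_between a b"
  unfolding op_between_iff
proof (intro conjI allI)
  fix x
  have "0 \<le> ip (op_poly (p - [:a:]) T x) x" "0 \<le> ip (op_poly ([:b:] - p) T x) x"
    using p by (intro op_poly_nonneg[OF T]; simp)+
  then show "a * (norm x)\<^sup>2 \<le> ip (op_poly p T x) x" "ip (op_poly p T x) x \<le> b * (norm x)\<^sup>2"
    by (simp_all add: op_poly_diff op_poly_const blinfun.diff_left blinfun.scaleR_left ip_simps ip_self)
qed (use T in simp)

lemma real_spectrum_subset:
  assumes T: "T \<in> op_between a b"
  shows "real_spectrum T \<subseteq> {a..b}"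
proof
  fix t assume t: "t \<in> real_spectrum T"
  note TH = op_betweenD(1)[OF T]
  show "t \<in> {a..b}"
  proof (rule ccontr)
    assume "t \<notin> {a..b}"
    then consider "t < a" | "b < t" by fastforce
    then have "\<exists>S. op_inverse (T - t *\<^sub>R id_blinfun) S"
    proof cases
      case 1
      show ?thesis
      proof (rule coercive_invertible)
        show "0 < a - t" using 1 by simp
        show "(a - t) * (norm x)\<^sup>2 \<le> ip ((T - t *\<^sub>R id_blinfun) x) x" for x
          using op_betweenD(2)[OF T, of x]
          by (simp add: blinfun.diff_left blinfun.scaleR_left ip_simps ip_self algebra_simps)
      qed (use TH in simp)
    next
      case 2
      have "\<exists>S. op_inverse (t *\<^sub>R id_blinfun - T) S"
      proof (rule coercive_invertible)
        show "0 < t - b" using 2 by simp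
        show "(t - b) * (norm x)\<^sup>2 \<le> ip ((t *\<^sub>R id_blinfun - T) x) x" for x
          using op_betweenD(3)[OF T, of x]
          by (simp add: blinfun.diff_left blinfun.scaleR_left ip_simps ip_self algebra_simps)
      qed (use TH in simp)
      then obtain S where "op_inverse (t *\<^sub>R id_blinfun - T) S" by blast
      then have "op_inverse (T - t *\<^sub>R id_blinfun) ((- 1) *\<^sub>R S)"
        unfolding op_inverse_def by (simp add: blinfun_compose_linear)
      then show ?thesis by blast
    qed
    with t show False by (simp add: real_spectrum_iff)
  qed
qed

lemma op_poly_norm_le:
  assumes T: "T \<in> self_adjoint_ops" and p: "\<And>t. t \<in> real_spectrum T \<Longrightarrow> \<bar>poly p t\<bar> \<le> e" and e: "0 \<le> e"
  shows "norm (op_poly p T) \<le> e"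
  proof (rule op_between_norm_le[OF op_poly_between[OF T, where p = p and a = "- e" and b = e]])
  fix t assume "t \<in> real_spectrum T"
  then show "- e \<le> poly p t \<and> poly p t \<le> e" using p[of t] by (simp add: abs_le_iff)
qed (use e in auto)

text \<open>The bound of \<open>\<parallel>p(T)\<parallel>\<close> by the values of \<open>p\<close> on the spectrum makes the limit exist and makes it independent of
  the approximating polynomials, so the description in the definition of \<^const>\<open>op_fun\<close> determines it.\<close>

lemma op_fun_limit:
  assumes T: "T \<in> op_between a b" and p: "uniform_limit {a..b} (\<lambda>n. poly (p n)) f sequentially"
  shows "(\<lambda>n. op_poly (p n) T) \<longlonglongrightarrow> op_fun f T"
proof -
  note TH = op_betweenD(1)[OF T]
  let ?\<sigma> = "real_spectrum T"
  have ps: "uniform_limit ?\<sigma> (\<lambda>n. poly (p n)) f sequentially"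
    using p real_spectrum_subset[OF T] by (rule uniform_limit_on_subset)
  have "Cauchy (\<lambda>n. op_poly (p n) T)"
  proof (rule CauchyI)
    fix e :: real assume e: "0 < e"
    obtain N where N: "\<And>n t. N \<le> n \<Longrightarrow> t \<in> ?\<sigma> \<Longrightarrow> dist (poly (p n) t) (f t) < e / 4"
      using ps e unfolding uniform_limit_sequentially_iff by (meson zero_less_divide_iff zero_less_numeral)
    show "\<exists>M. \<forall>m\<ge>M. \<forall>n\<ge>M. norm (op_poly (p m) T - op_poly (p n) T) < e"
    proof (intro exI allI impI)
      fix m n assume mn: "N \<le> m" "N \<le> n"
      have "norm (op_poly (p m - p n) T) \<le> e / 2"
      proof (rule op_poly_norm_le[OF TH])
        fix t assume "t \<in> ?\<sigma>"
        then show "\<bar>poly (p m - p n) t\<bar> \<le> e / 2"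
          using N[OF mn(1), of t] N[OF mn(2), of t] unfolding dist_real_def poly_diff by linarith
      qed (use e in simp)
      then show "norm (op_poly (p m) T - op_poly (p n) T) < e" using e by (simp add: op_poly_diff)
    qed
  qed
  then obtain S where S: "(\<lambda>n. op_poly (p n) T) \<longlonglongrightarrow> S" using Cauchy_convergent convergent_def by blast
  have "op_fun f T = S"
    unfolding op_fun_def
  proof (rule the_equality)
    show "\<exists>p. uniform_limit ?\<sigma> (\<lambda>n. poly (p n)) f sequentially \<and> (\<lambda>n. op_poly (p n) T) \<longlonglongrightarrow> S"
      using ps S by blast
  next
    fix S' assume "\<exists>p. uniform_limit ?\<sigma> (\<lambda>n. poly (p n)) f sequentially \<and> (\<lambda>n. op_poly (p n) T) \<longlonglongrightarrow> S'"
    then obtain q where q: "uniform_limit ?\<sigma> (\<lambda>n. poly (q n)) f sequentially" "(\<lambda>n. op_poly (q n) T) \<longlonglongrightarrow> S'"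
      by blast
    have "(\<lambda>n. op_poly (q n) T - op_poly (p n) T) \<longlonglongrightarrow> 0"
    proof (rule LIMSEQ_I)
      fix e :: real assume e: "0 < e"
      obtain N where N: "\<And>n t. N \<le> n \<Longrightarrow> t \<in> ?\<sigma> \<Longrightarrow> dist (poly (p n) t) (f t) < e / 4"
        using ps e unfolding uniform_limit_sequentially_iff by (meson zero_less_divide_iff zero_less_numeral)
      obtain M where M: "\<And>n t. M \<le> n \<Longrightarrow> t \<in> ?\<sigma> \<Longrightarrow> dist (poly (q n) t) (f t) < e / 4"
        using q(1) e unfolding uniform_limit_sequentially_iff by (meson zero_less_divide_iff zero_less_numeral)
      show "\<exists>no. \<forall>n\<ge>no. norm (op_poly (q n) T - op_poly (p n) T - 0) < e"
      proof (intro exI allI impI)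
        fix n assume n: "max M N \<le> n"
        have "norm (op_poly (q n - p n) T) \<le> e / 2"
        proof (rule op_poly_norm_le[OF TH])
          fix t assume "t \<in> ?\<sigma>"
          then show "\<bar>poly (q n - p n) t\<bar> \<le> e / 2"
            using N[of n t] M[of n t] n unfolding dist_real_def poly_diff by linarith
        qed (use e in simp)
        then show "norm (op_poly (q n) T - op_poly (p n) T - 0) < e" using e by (simp add: op_poly_diff)
      qed
    qed
    moreover have "(\<lambda>n. op_poly (q n) T - op_poly (p n) T) \<longlonglongrightarrow> S' - S"
      by (intro tendsto_diff q S)
    ultimately show "S' = S" using LIMSEQ_unique by fastforce
  qed
  with S show ?thesis by simp
qed

lemma uniform_poly_approximation:
  fixes f :: "real \<Rightarrow> real"
  assumes "continuous_on {a..b} f"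
  obtains p where "uniform_limit {a..b} (\<lambda>n. poly (p n)) f sequentially"
proof -
  have "\<exists>p. \<forall>t\<in>{a..b}. \<bar>f t - poly p t\<bar> < 1 / Suc n" for n
  proof -
    have n: "(0::real) < 1 / Suc n" by simp
    obtain g where g: "real_polynomial_function g" "\<And>t. t \<in> {a..b} \<Longrightarrow> \<bar>f t - g t\<bar> < 1 / Suc n"
      using Stone_Weierstrass_real_polynomial_function[OF compact_Icc assms n] by blast
    from g(1) obtain c N where "g = (\<lambda>x. \<Sum>i\<le>N. c i * x ^ i)"
      unfolding real_polynomial_function_iff_sum by blast
    then have "g = poly (\<Sum>i\<le>N. monom (c i) i)" by (auto simp: poly_sum poly_monom)
    with g(2) show ?thesis by blast
  qed
  then obtain p where p: "\<And>n t. t \<in> {a..b} \<Longrightarrow> \<bar>f t - poly (p n) t\<bar> < 1 / Suc n" by metis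
  have "uniform_limit {a..b} (\<lambda>n. poly (p n)) f sequentially"
    unfolding uniform_limit_sequentially_iff
  proof (intro allI impI)
    fix e :: real assume "0 < e"
    then obtain N where N: "1 / Suc N < e" using nat_approx_posE by blast
    show "\<exists>N. \<forall>n\<ge>N. \<forall>t\<in>{a..b}. dist (poly (p n) t) (f t) < e"
    proof (intro exI allI impI ballI)
      fix n t assume "N \<le> n" and t: "t \<in> {a..b}"
      then have "1 / real (Suc n) \<le> 1 / Suc N" by (simp add: frac_le)
      then show "dist (poly (p n) t) (f t) < e" using p[OF t, of n] N by (simp add: dist_real_def abs_minus_commute)
    qed
  qed
  then show ?thesis by (rule that)
qed

lemma op_fun_poly: "T \<in> op_between a b \<Longrightarrow> op_fun (poly p) T = op_poly p T"
  using op_fun_limit[of T a b "\<lambda>_. p" "poly p"] by (simp add: LIMSEQ_const_iff uniform_limit_const)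

lemma op_fun_cong:
  assumes T: "T \<in> op_between a b" and f: "continuous_on {a..b} f" and fg: "\<And>t. t \<in> {a..b} \<Longrightarrow> f t = g t"
  shows "op_fun f T = op_fun g T"
proof -
  obtain p where p: "uniform_limit {a..b} (\<lambda>n. poly (p n)) f sequentially"
    by (rule uniform_poly_approximation[OF f])
  have q: "uniform_limit {a..b} (\<lambda>n. poly (p n)) g sequentially"
    using p unfolding uniform_limit_sequentially_iff by (simp add: fg)
  show ?thesis by (rule LIMSEQ_unique[OF op_fun_limit[OF T p] op_fun_limit[OF T q]])
qed

lemma sa_op_fun:
  assumes T: "T \<in> op_between a b" and f: "continuous_on {a..b} f"
  shows "op_fun f T \<in> self_adjoint_ops"
proof -
  obtain p where p: "uniform_limit {a..b} (\<lambda>n. poly (p n)) f sequentially"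
    by (rule uniform_poly_approximation[OF f])
  show ?thesis by (rule sa_limit[OF sa_op_poly[OF op_betweenD(1)[OF T]] op_fun_limit[OF T p]])
qed

lemma op_fun_add:
  assumes T: "T \<in> op_between a b" and f: "continuous_on {a..b} f" and g: "continuous_on {a..b} g"
  shows "op_fun (\<lambda>t. f t + g t) T = op_fun f T + op_fun g T"
proof -
  obtain p where p: "uniform_limit {a..b} (\<lambda>n. poly (p n)) f sequentially"
    by (rule uniform_poly_approximation[OF f])
  obtain q where q: "uniform_limit {a..b} (\<lambda>n. poly (q n)) g sequentially"
    by (rule uniform_poly_approximation[OF g])
  have "uniform_limit {a..b} (\<lambda>n. poly (p n + q n)) (\<lambda>t. f t + g t) sequentially"
  proof -
    have "poly (p n + q n) = (\<lambda>t. poly (p n) t + poly (q n) t)" for n by auto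
    then show ?thesis using uniform_limit_add[OF p q] by presburger
  qed
  from LIMSEQ_unique[OF op_fun_limit[OF T this, unfolded op_poly_add] tendsto_add[OF op_fun_limit[OF T p] op_fun_limit[OF T q]]]
  show ?thesis .
qed

lemma op_fun_mult:
  assumes T: "T \<in> op_between a b" and f: "continuous_on {a..b} f" and g: "continuous_on {a..b} g"
  shows "op_fun (\<lambda>t. f t * g t) T = op_fun f T o\<^sub>L op_fun g T"
proof -
  obtain p where p: "uniform_limit {a..b} (\<lambda>n. poly (p n)) f sequentially"
    by (rule uniform_poly_approximation[OF f])
  obtain q where q: "uniform_limit {a..b} (\<lambda>n. poly (q n)) g sequentially"
    by (rule uniform_poly_approximation[OF g])
  have bf: "bounded (f ` {a..b})" and bg: "bounded (g ` {a..b})"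
    using f g by (auto intro!: compact_imp_bounded compact_continuous_image)
  have "uniform_limit {a..b} (\<lambda>n. poly (p n * q n)) (\<lambda>t. f t * g t) sequentially"
  proof -
    have "poly (p n * q n) = (\<lambda>t. poly (p n) t * poly (q n) t)" for n by auto
    then show ?thesis using uniform_lim_mult[OF p q bf bg] by presburger
  qed
  from LIMSEQ_unique[OF op_fun_limit[OF T this, unfolded op_poly_mult]
      bounded_bilinear.tendsto[OF bounded_bilinear_blinfun_compose op_fun_limit[OF T p] op_fun_limit[OF T q]]]
  show ?thesis .
qed

lemma op_fun_const: "T \<in> op_between a b \<Longrightarrow> op_fun (\<lambda>t. c) T = c *\<^sub>R id_blinfun"
proof -
  assume "T \<in> op_between a b"
  moreover have "poly [:c:] = (\<lambda>t. c)" by auto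
  ultimately show ?thesis using op_fun_poly[of T a b "[:c:]"] by (simp only: op_poly_const)
qed

lemma op_fun_id: "T \<in> op_between a b \<Longrightarrow> op_fun (\<lambda>t. t) T = T"
proof -
  assume "T \<in> op_between a b"
  moreover have "poly [:0, 1:] = (\<lambda>t::real. t)" by auto
  ultimately show ?thesis using op_fun_poly[of T a b "[:0, 1:]"] by (simp only: op_poly_X)
qed

lemma op_fun_scale:
  assumes T: "T \<in> op_between a b" and f: "continuous_on {a..b} f"
  shows "op_fun (\<lambda>t. c * f t) T = c *\<^sub>R op_fun f T"
  using op_fun_mult[OF T continuous_on_const f, of c] by (simp add: op_fun_const[OF T] blinfun_compose_linear)

lemma op_fun_commute:
  assumes T: "T \<in> op_between a b" and f: "continuous_on {a..b} f" and g: "continuous_on {a..b} g"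
  shows "op_fun f T o\<^sub>L op_fun g T = op_fun g T o\<^sub>L op_fun f T"
  using op_fun_mult[OF T f g] op_fun_mult[OF T g f] by (simp add: mult.commute)

lemma op_fun_between:
  assumes T: "T \<in> op_between a b" and f: "continuous_on {a..b} f" and cd: "\<And>t. t \<in> {a..b} \<Longrightarrow> c \<le> f t \<and> f t \<le> d"
  shows "op_fun f T \<in> op_between c d"
proof -
  obtain p where p: "uniform_limit {a..b} (\<lambda>n. poly (p n)) f sequentially"
    by (rule uniform_poly_approximation[OF f])
  note lim = op_fun_limit[OF T p]
  have "c * (norm x)\<^sup>2 \<le> ip (op_fun f T x) x \<and> ip (op_fun f T x) x \<le> d * (norm x)\<^sup>2" for x
  proof -
    have l: "(\<lambda>n. ip (op_poly (p n) T x) x) \<longlonglongrightarrow> ip (op_fun f T x) x"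
      by (intro tendsto_ip blinfun.tendsto lim tendsto_const)
    have ev: "(c - e) * (norm x)\<^sup>2 \<le> ip (op_fun f T x) x \<and> ip (op_fun f T x) x \<le> (d + e) * (norm x)\<^sup>2" if e: "0 < e" for e
    proof -
      obtain N where N: "\<And>n t. N \<le> n \<Longrightarrow> t \<in> {a..b} \<Longrightarrow> dist (poly (p n) t) (f t) < e"
        using p e unfolding uniform_limit_sequentially_iff by meson
      have "op_poly (p n) T \<in> op_between (c - e) (d + e)" if "N \<le> n" for n
      proof (rule op_poly_between[OF op_betweenD(1)[OF T]])
        fix t assume "t \<in> real_spectrum T"
        then have t: "t \<in> {a..b}" using real_spectrum_subset[OF T] by blast
        show "c - e \<le> poly (p n) t \<and> poly (p n) t \<le> d + e"
          using N[OF that t] cd[OF t] by (auto simp: dist_real_def)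
      qed
      then have "(c - e) * (norm x)\<^sup>2 \<le> ip (op_poly (p n) T x) x" "ip (op_poly (p n) T x) x \<le> (d + e) * (norm x)\<^sup>2" if "N \<le> n" for n
        using op_betweenD(2,3) that by blast+
      then show ?thesis using LIMSEQ_le_const[OF l] LIMSEQ_le_const2[OF l] by blast
    qed
    have "c * (norm x)\<^sup>2 \<le> ip (op_fun f T x) x + e" "ip (op_fun f T x) x \<le> d * (norm x)\<^sup>2 + e" if e: "0 < e" for e
    proof -
      define e' where "e' = e / ((norm x)\<^sup>2 + 1)"
      have e': "0 < e'" "e' * (norm x)\<^sup>2 \<le> e"
        using e by (auto simp: e'_def add_nonneg_pos divide_le_eq mult_left_mono)
      show "c * (norm x)\<^sup>2 \<le> ip (op_fun f T x) x + e" "ip (op_fun f T x) x \<le> d * (norm x)\<^sup>2 + e"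
        using ev[OF e'(1)] e'(2) by (auto simp: algebra_simps)
    qed
    then show ?thesis by (auto intro: field_le_epsilon)
  qed
  then show ?thesis using sa_op_fun[OF T f] by (simp add: op_between_iff)
qed

lemma op_fun_norm_le:
  assumes T: "T \<in> op_between a b" and f: "continuous_on {a..b} f" and M: "\<And>t. t \<in> {a..b} \<Longrightarrow> \<bar>f t\<bar> \<le> M" "0 \<le> M"
  shows "norm (op_fun f T) \<le> M"
proof (rule op_between_norm_le)
  show "op_fun f T \<in> op_between (- M) M"
    by (rule op_fun_between[OF T f]) (use M in \<open>force simp: abs_le_iff\<close>)
qed (use M in auto)

lemma op_fun_diff:
  assumes T: "T \<in> op_between a b" and f: "continuous_on {a..b} f" and g: "continuous_on {a..b} g"
  shows "op_fun (\<lambda>t. f t - g t) T = op_fun f T - op_fun g T"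
proof -
  have g': "continuous_on {a..b} (\<lambda>t. (-1) * g t)" by (intro continuous_intros g)
  show ?thesis using op_fun_add[OF T f g'] op_fun_scale[OF T g, of "-1"] by simp
qed

lemma op_fun_norm_diff_le:
  assumes T: "T \<in> op_between a b" and f: "continuous_on {a..b} f" and g: "continuous_on {a..b} g"
    and M: "\<And>t. t \<in> {a..b} \<Longrightarrow> \<bar>f t - g t\<bar> \<le> M" "0 \<le> M"
  shows "norm (op_fun f T - op_fun g T) \<le> M"
  using op_fun_norm_le[OF T continuous_on_diff[OF f g] M] by (simp add: op_fun_diff[OF T f g])

section \<open>A variational formula for the perspective\<close>

definition op_sqrt :: "('e::complex_hilbert_space \<Rightarrow>\<^sub>L 'e) \<Rightarrow> ('e \<Rightarrow>\<^sub>L 'e)" where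
  "op_sqrt X = op_fun sqrt X"

lemma op_sqrt_facts:
  fixes X :: "'e::complex_hilbert_space \<Rightarrow>\<^sub>L 'e"
  assumes X: "X \<in> op_between a b" and a: "0 < a"
  shows "op_inv_sqrt X \<in> self_adjoint_ops" "op_sqrt X \<in> self_adjoint_ops"
    "op_sqrt X (op_inv_sqrt X x) = x" "op_inv_sqrt X (op_sqrt X x) = x" "op_sqrt X (op_sqrt X x) = X x"
proof -
  let ?r = "\<lambda>t::real. t powr (- 1 / 2)"
  have cr: "continuous_on {a..b} ?r" using a by (intro continuous_intros) auto
  have cs: "continuous_on {a..b} sqrt" by (intro continuous_intros)
  show "op_inv_sqrt X \<in> self_adjoint_ops" "op_sqrt X \<in> self_adjoint_ops"
    unfolding op_inv_sqrt_def op_sqrt_def using sa_op_fun[OF X] cr cs by auto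
  have one: "?r t * sqrt t = 1" if "t \<in> {a..b}" for t
    using that a by (simp add: powr_half_sqrt[symmetric] powr_add[symmetric])
  have rs: "op_inv_sqrt X o\<^sub>L op_sqrt X = id_blinfun"
    unfolding op_inv_sqrt_def op_sqrt_def op_fun_mult[OF X cr cs, symmetric]
    using op_fun_cong[OF X continuous_on_mult[OF cr cs] one] op_fun_const[OF X, of 1] by simp
  moreover have "op_sqrt X o\<^sub>L op_inv_sqrt X = id_blinfun"
    using rs op_fun_commute[OF X cr cs] unfolding op_inv_sqrt_def op_sqrt_def by simp
  ultimately show "op_sqrt X (op_inv_sqrt X x) = x" "op_inv_sqrt X (op_sqrt X x) = x"
    by (metis blinfun_apply_blinfun_compose blinfun_apply_id_blinfun id_apply)+
  have "op_sqrt X o\<^sub>L op_sqrt X = op_fun (\<lambda>t. sqrt t * sqrt t) X"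
    unfolding op_sqrt_def by (rule op_fun_mult[OF X cs cs, symmetric])
  also have "\<dots> = op_fun (\<lambda>t. t) X"
    by (rule op_fun_cong[OF X continuous_on_mult[OF cs cs]]) (use a in auto)
  also have "\<dots> = X" by (rule op_fun_id[OF X])
  finally show "op_sqrt X (op_sqrt X x) = X x" by (metis blinfun_apply_blinfun_compose)
qed

lemma norm_op_sqrt:
  assumes X: "X \<in> op_between a b" and a: "0 < a"
  shows "(norm (op_sqrt X v))\<^sup>2 = ip (X v) v"
  using sa_ip[OF op_sqrt_facts(2)[OF X a], of "op_sqrt X v" v] op_sqrt_facts(5)[OF X a]
  by (simp add: ip_self)

lemma norm_op_sqrt_bounds:
  assumes X: "X \<in> op_between a b" and a: "0 < a"
  shows "a * (norm v)\<^sup>2 \<le> (norm (op_sqrt X v))\<^sup>2" "(norm (op_sqrt X v))\<^sup>2 \<le> b * (norm v)\<^sup>2"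
  using op_betweenD[OF X] by (simp_all add: norm_op_sqrt[OF X a])

definition normalized :: "('e::complex_hilbert_space \<Rightarrow>\<^sub>L 'e) \<Rightarrow> ('e \<Rightarrow>\<^sub>L 'e) \<Rightarrow> ('e \<Rightarrow>\<^sub>L 'e)" where
  "normalized X A = op_inv_sqrt X o\<^sub>L A o\<^sub>L op_inv_sqrt X"

lemma normalized_form:
  assumes X: "X \<in> op_between a b" "0 < a"
  shows "ip (normalized X A x) x = ip (A (op_inv_sqrt X x)) (op_inv_sqrt X x)"
  using sa_ip[OF op_sqrt_facts(1)[OF X]] by (simp add: normalized_def)

lemma normalized_sqrt_form:
  assumes X: "X \<in> op_between a b" "0 < a"
  shows "ip (normalized X A (op_sqrt X w)) (op_sqrt X w) = ip (A w) w"
  by (simp add: normalized_form[OF X] op_sqrt_facts[OF X])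

lemma sa_normalized:
  assumes X: "X \<in> op_between a b" "0 < a" and A: "A \<in> self_adjoint_ops"
  shows "normalized X A \<in> self_adjoint_ops"
  unfolding normalized_def using op_sqrt_facts(1)[OF X] A by simp

lemma normalized_between:
  assumes X: "X \<in> op_between a b" and A: "A \<in> op_between a' b'" and a: "0 < a" "0 < b" "0 \<le> a'" "0 \<le> b'"
  shows "normalized X A \<in> op_between (a' / b) (b' / a)"
  unfolding op_between_iff
proof (intro conjI allI)
  show "normalized X A \<in> self_adjoint_ops" by (rule sa_normalized[OF X a(1) op_betweenD(1)[OF A]])
  fix x
  let ?y = "op_inv_sqrt X x"
  have x: "a * (norm ?y)\<^sup>2 \<le> (norm x)\<^sup>2" "(norm x)\<^sup>2 \<le> b * (norm ?y)\<^sup>2"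
    using norm_op_sqrt_bounds[OF X a(1), of ?y] op_sqrt_facts(3)[OF X a(1)] by auto
  have "a' / b * (norm x)\<^sup>2 \<le> a' / b * (b * (norm ?y)\<^sup>2)" using x a by (intro mult_left_mono) auto
  also have "\<dots> = a' * (norm ?y)\<^sup>2" using a by simp
  also have "\<dots> \<le> ip (A ?y) ?y" by (rule op_betweenD(2)[OF A])
  finally show "a' / b * (norm x)\<^sup>2 \<le> ip (normalized X A x) x" by (simp add: normalized_form[OF X a(1)])
  have "ip (A ?y) ?y \<le> b' * (norm ?y)\<^sup>2" by (rule op_betweenD(3)[OF A])
  also have "\<dots> = b' / a * (a * (norm ?y)\<^sup>2)" using a by simp
  also have "\<dots> \<le> b' / a * (norm x)\<^sup>2" using x a by (intro mult_left_mono) auto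
  finally show "ip (normalized X A x) x \<le> b' / a * (norm x)\<^sup>2" by (simp add: normalized_form[OF X a(1)])
qed

lemma mobius_kernel_equation:
  assumes T: "T \<in> op_between l m" and l: "0 < l" and s: "0 \<le> s" "s \<le> 1"
  defines "S \<equiv> op_fun (mobius_kernel s) T"
  shows "(1 - s) *\<^sub>R T (S x) + s *\<^sub>R S x = T x - x"
proof -
  have ck: "continuous_on {l..m} (mobius_kernel s)" using kernel_hull_continuous_on[OF kernel_hull_mobius[OF s] l] .
  have cd: "continuous_on {l..m} (\<lambda>t. (1 - s) * t + s)" by (intro continuous_intros)
  have "op_fun (\<lambda>t. ((1 - s) * t + s) * mobius_kernel s t) T = op_fun (\<lambda>t. t - 1) T"
  proof (rule op_fun_cong[OF T continuous_on_mult[OF cd ck]])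
    fix t assume "t \<in> {l..m}"
    then have "0 < (1 - s) * t + s" using mobius_denominator_bounds(3)[OF s] l by auto
    then show "((1 - s) * t + s) * mobius_kernel s t = t - 1" by (simp add: mobius_kernel_def)
  qed
  also have "\<dots> = T - id_blinfun"
    using op_fun_diff[OF T continuous_on_id continuous_on_const, of 1] by (simp add: op_fun_id[OF T] op_fun_const[OF T])
  also have "op_fun (\<lambda>t. ((1 - s) * t + s) * mobius_kernel s t) T = op_fun (\<lambda>t. (1 - s) * t + s) T o\<^sub>L S"
    unfolding S_def by (rule op_fun_mult[OF T cd ck])
  also have "op_fun (\<lambda>t. (1 - s) * t + s) T = (1 - s) *\<^sub>R T + s *\<^sub>R id_blinfun"
  proof -
    have "poly [:s, 1 - s:] = (\<lambda>t. (1 - s) * t + s)" by (auto simp: algebra_simps)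
    then show ?thesis
      using op_fun_poly[OF T, of "[:s, 1 - s:]"]
      by (simp add: op_poly_pCons blinfun_compose_linear add.commute)
  qed
  finally have "((1 - s) *\<^sub>R T + s *\<^sub>R id_blinfun) o\<^sub>L S = T - id_blinfun" .
  then have "(((1 - s) *\<^sub>R T + s *\<^sub>R id_blinfun) o\<^sub>L S) x = (T - id_blinfun) x" by simp
  then show ?thesis by (simp add: blinfun.add_left blinfun.scaleR_left blinfun.diff_left)
qed

lemma mobius_optimizer_equation:
  fixes x :: "'e::complex_hilbert_space"
  assumes T: "T \<in> op_between l m" and l: "0 < l" and s: "0 \<le> s" "s \<le> 1"
  defines "w \<equiv> x - (1 - s) *\<^sub>R op_fun (mobius_kernel s) T x"
  shows "(1 - s) *\<^sub>R T w + s *\<^sub>R w = x"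
proof -
  define v where "v = op_fun (mobius_kernel s) T x"
  have v: "(1 - s) *\<^sub>R T v = T x - x - s *\<^sub>R v"
    using mobius_kernel_equation[OF T l s, of x] by (simp add: v_def algebra_simps)
  have "(1 - s) *\<^sub>R T w + s *\<^sub>R w = (1 - s) *\<^sub>R T x - (1 - s) *\<^sub>R ((1 - s) *\<^sub>R T v) + s *\<^sub>R x - (s * (1 - s)) *\<^sub>R v"
    unfolding w_def v_def[symmetric]
    by (simp add: blinfun.diff_right blinfun.scaleR_right scaleR_diff_right)
  also have "\<dots> = x" unfolding v by (simp add: algebra_simps)
  finally show ?thesis .
qed

text \<open>For a kernel \<open>S = f\<^sub>s(T)\<close> the form \<open>\<langle>S x, x\<rangle>\<close> is the minimum of \<open>q\<close>, and the minimum is attained at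
  \<open>u = S x\<close>. With \<open>Q = (1 - s) T + s\<close> the excess \<open>q u - \<langle>S x, x\<rangle>\<close> is \<open>(1 - s)\<close> times the form of \<open>Q\<close> at
  \<open>u - S x\<close>. The point of the formula is that \<open>q u\<close> is affine in \<open>T\<close>.\<close>

lemma mobius_variational:
  fixes x :: "'e::complex_hilbert_space"
  assumes T: "T \<in> op_between l m" and l: "0 < l" and s: "0 \<le> s" "s \<le> 1"
  defines "S \<equiv> op_fun (mobius_kernel s) T"
  defines "q \<equiv> \<lambda>u. ip (T (x - (1 - s) *\<^sub>R u)) (x - (1 - s) *\<^sub>R u) - ip x x + 2 * (1 - s) * ip x u + s * (1 - s) * ip u u"
  shows "ip (S x) x \<le> q u" "q (S x) = ip (S x) x"
proof -
  note TH = op_betweenD(1)[OF T]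
  define Q where "Q u = (1 - s) *\<^sub>R T u + s *\<^sub>R u" for u
  have Qs: "ip (Q u) z = ip u (Q z)" for u z unfolding Q_def by (simp add: ip_simps sa_ip[OF TH])
  have Ql: "Q (u - z) = Q u - Q z" for u z by (simp add: Q_def blinfun.diff_right algebra_simps)
  define v where "v = S x"
  have Qv: "Q v = T x - x" unfolding Q_def v_def S_def by (rule mobius_kernel_equation[OF T l s])
  have Qw: "Q (x - (1 - s) *\<^sub>R v) = x" unfolding Q_def v_def S_def by (rule mobius_optimizer_equation[OF T l s])
  have key: "q u = ip v x + (1 - s) * ip (Q (u - v)) (u - v)" for u
  proof -
    have "q u = ip (Q v) x - 2 * (1 - s) * ip (Q v) u + (1 - s) * ip (Q u) u"
    proof -
      have e: "ip (T (x - r *\<^sub>R u)) (x - r *\<^sub>R u) = ip (T x) x - 2 * r * ip (T x) u + r * r * ip (T u) u" for r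
        using sa_ip[OF TH, of u x] ip_commute[of u "T x"]
        by (simp add: blinfun.diff_right blinfun.scaleR_right ip_simps algebra_simps)
      show ?thesis
        unfolding Qv q_def e unfolding Q_def by (simp add: ip_simps algebra_simps)
    qed
    also have "\<dots> = ip (Q v) (x - (1 - s) *\<^sub>R v) + (1 - s) * ip (Q (u - v)) (u - v)"
      using Qs[of u v] ip_commute[of u "Q v"] by (simp add: Ql ip_simps algebra_simps)
    also have "ip (Q v) (x - (1 - s) *\<^sub>R v) = ip v x" unfolding Qs Qw ..
    finally show ?thesis .
  qed
  have "0 \<le> ip (Q z) z" for z
  proof -
    have "0 \<le> l * (norm z)\<^sup>2" using l by simp
    then have "0 \<le> ip (T z) z" using op_betweenD(2)[OF T, of z] by linarith
    then show ?thesis unfolding Q_def using s by (simp add: ip_simps ip_self)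
  qed
  then have "ip v x \<le> q u" unfolding key using s by simp
  then show "ip (S x) x \<le> q u" by (simp add: v_def)
  show "q (S x) = ip (S x) x" unfolding key v_def[symmetric] by (simp add: Q_def)
qed

text \<open>The quadratic form of \<open>X\<^sup>1\<^sup>/\<^sup>2 f(X\<^sup>-\<^sup>1\<^sup>/\<^sup>2 A X\<^sup>-\<^sup>1\<^sup>/\<^sup>2) X\<^sup>1\<^sup>/\<^sup>2\<close>, the operator perspective of \<open>f\<close>.\<close>

definition perspective :: "(real \<Rightarrow> real) \<Rightarrow> ('e::complex_hilbert_space \<Rightarrow>\<^sub>L 'e) \<Rightarrow> ('e \<Rightarrow>\<^sub>L 'e) \<Rightarrow> 'e \<Rightarrow> real" where
  "perspective f X A v = ip (op_fun f (normalized X A) (op_sqrt X v)) (op_sqrt X v)"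

text \<open>This constant bounds \<open>1 + 2 \<parallel>u\<parallel> / \<parallel>v\<parallel>\<close> for the minimizers \<open>u\<close> of the variational formula, when all
  operators lie between \<open>a I\<close> and \<open>b I\<close>.\<close>

definition drift_const :: "real \<Rightarrow> real \<Rightarrow> real" where
  "drift_const a b = 1 + 4 * (b / a) * sqrt (b / a)"

text \<open>A lower bound for \<open>\<langle>A w, w\<rangle> / \<parallel>v\<parallel>\<^sup>2\<close>, where \<open>w = v - (1 - s) u\<close> belongs to the minimizer \<open>u\<close> of the
  variational formula at \<open>v\<close>.\<close>

definition gap_const :: "real \<Rightarrow> real \<Rightarrow> real" where
  "gap_const a b = a * (a / b) ^ 3"

text \<open>In the variables \<open>v\<close>, \<open>u\<close> and \<open>w = v - (1 - s) u\<close> the variational formula says that the perspective is the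
  minimum over \<open>u\<close> of
  \<open>\<langle>A w, w\<rangle> - \<langle>X v, v\<rangle> + 2 (1 - s) \<langle>X v, u\<rangle> + s (1 - s) \<langle>X u, u\<rangle>\<close>, which is linear in the pair \<open>(X, A)\<close>. The value for
  \<open>(X, A)\<close> is estimated at the minimizer for \<open>(Z, A')\<close>. Replacing \<open>X\<close> by \<open>c Z\<close> costs terms with
  \<open>(c Z - X) v\<close>, and \<open>- s (1 - s) \<langle>(c Z - X) u, u\<rangle>\<close>, which has the good sign; replacing \<open>A\<close> by \<open>A'\<close> instead of
  \<open>c A'\<close> gains \<open>(c - 1) \<langle>A' w, w\<rangle>\<close>.\<close>

lemma comparison_mobius:
  fixes X Z A A' :: "'e::complex_hilbert_space \<Rightarrow>\<^sub>L 'e"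
  assumes ab: "0 < a" "a \<le> b"
    and X: "X \<in> op_between a b" and Z: "Z \<in> op_between a b" and A: "A \<in> op_between a b" and A': "A' \<in> op_between a b"
    and AA: "A \<preceq> A'" and c: "1 \<le> c" and XZ: "X \<preceq> c *\<^sub>R Z" and s: "0 \<le> s" "s \<le> 1"
  shows "perspective (mobius_kernel s) X A v \<le> c * perspective (mobius_kernel s) Z A' v
    - gap_const a b * (c - 1) * (norm v)\<^sup>2 + drift_const a b * norm ((c *\<^sub>R Z - X) v) * norm v"
proof -
  have b: "0 < b" using ab by simp
  let ?l = "a / b" and ?m = "b / a"
  have l: "0 < ?l" using ab b by simp
  have TX: "normalized X A \<in> op_between ?l ?m" and TZ: "normalized Z A' \<in> op_between ?l ?m"
    using normalized_between[OF X A] normalized_between[OF Z A'] ab b by auto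
  define y where "y = op_sqrt Z v"
  define S where "S = op_fun (mobius_kernel s) (normalized Z A')"
  define u where "u = op_inv_sqrt Z (S y)"
  define w where "w = v - (1 - s) *\<^sub>R u"
  have Su: "op_sqrt Z u = S y" unfolding u_def by (rule op_sqrt_facts(3)[OF Z ab(1)])
  have sw: "op_sqrt Y w = op_sqrt Y v - (1 - s) *\<^sub>R op_sqrt Y u" for Y
    by (simp add: w_def blinfun.diff_right blinfun.scaleR_right)
  have sq: "ip (op_sqrt Y p) (op_sqrt Y q) = ip (Y p) q" if "Y \<in> op_between a b" for Y p q
    using sa_ip[OF op_sqrt_facts(2)[OF that ab(1)], of "op_sqrt Y p" q] op_sqrt_facts(5)[OF that ab(1)] by simp
  have le: "perspective (mobius_kernel s) X A v \<le> ip (A w) w - ip (X v) v + 2 * (1 - s) * ip (X v) u + s * (1 - s) * ip (X u) u"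
    using mobius_variational(1)[OF TX l s, of "op_sqrt X v" "op_sqrt X u"]
    unfolding perspective_def sw[symmetric] normalized_sqrt_form[OF X ab(1)] sq[OF X] .
  have eq: "perspective (mobius_kernel s) Z A' v = ip (A' w) w - ip (Z v) v + 2 * (1 - s) * ip (Z v) u + s * (1 - s) * ip (Z u) u"
  proof -
    note V = mobius_variational(2)[OF TZ l s, of y, folded S_def, folded Su]
    have "perspective (mobius_kernel s) Z A' v = ip (op_sqrt Z u) y"
      unfolding Su by (simp add: perspective_def S_def y_def)
    then show ?thesis
      using V unfolding y_def sw[symmetric] normalized_sqrt_form[OF Z ab(1)] sq[OF Z] by simp
  qed
  let ?D = "c *\<^sub>R Z - X"
  have Dip: "ip (?D p) q = c * ip (Z p) q - ip (X p) q" for p q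
    by (simp add: blinfun.diff_left blinfun.scaleR_left ip_simps)
  have D: "0 \<le> ip (?D p) p" for p using XZ unfolding Dip op_le_iff by (simp add: blinfun.scaleR_left ip_simps)
  have Aw: "ip (A w) w \<le> c * ip (A' w) w - (c - 1) * ip (A' w) w" using AA by (simp add: op_le_iff algebra_simps)
  \<comment> \<open>The vector \<open>w\<close> cannot be small, because its image under \<open>Z\<^sup>1\<^sup>/\<^sup>2\<close> is mapped to \<open>y\<close> by the bounded operator \<open>(1 - s) T + s\<close>, where \<open>T\<close> is \<open>normalized Z A'\<close>.\<close>
  have gap: "gap_const a b * (norm v)\<^sup>2 \<le> ip (A' w) w"
  proof -
    let ?w = "op_sqrt Z w"
    have w': "?w = y - (1 - s) *\<^sub>R S y" unfolding sw Su y_def ..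
    have "(1 - s) *\<^sub>R normalized Z A' ?w + s *\<^sub>R ?w = y"
      unfolding w' S_def by (rule mobius_optimizer_equation[OF TZ l s])
    then have "norm y \<le> (1 - s) * norm (normalized Z A' ?w) + s * norm ?w"
      using norm_triangle_ineq[of "(1 - s) *\<^sub>R normalized Z A' ?w" "s *\<^sub>R ?w"] s by simp
    also have "\<dots> \<le> (1 - s) * (?m * norm ?w) + s * (?m * norm ?w)"
    proof (intro add_mono mult_left_mono)
      have m1: "1 \<le> ?m" using ab by simp
      have "norm (normalized Z A') \<le> ?m"
        by (rule op_between_norm_le[OF TZ]) (use ab b m1 l in \<open>auto intro: order.trans[of _ 0]\<close>)
      then show "norm (normalized Z A' ?w) \<le> ?m * norm ?w"
        by (rule order.trans[OF norm_blinfun mult_right_mono]) simp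
      show "norm ?w \<le> ?m * norm ?w" using mult_right_mono[OF m1, of "norm ?w"] by simp
    qed (use s in auto)
    also have "\<dots> = ?m * norm ?w" by (simp only: left_diff_distrib)
    finally have "(norm y)\<^sup>2 \<le> (?m * norm ?w)\<^sup>2" by (intro power_mono) auto
    moreover have "a * (norm v)\<^sup>2 \<le> (norm y)\<^sup>2" unfolding y_def by (rule norm_op_sqrt_bounds(1)[OF Z ab(1)])
    moreover have "(norm ?w)\<^sup>2 \<le> b * (norm w)\<^sup>2" by (rule norm_op_sqrt_bounds(2)[OF Z ab(1)])
    then have "(?m * norm ?w)\<^sup>2 \<le> ?m\<^sup>2 * (b * (norm w)\<^sup>2)"
      unfolding power_mult_distrib by (intro mult_left_mono) auto
    ultimately have "a * (norm v)\<^sup>2 \<le> ?m\<^sup>2 * (b * (norm w)\<^sup>2)" by linarith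
    then have "?l ^ 3 * (a * (norm v)\<^sup>2) \<le> ?l ^ 3 * (?m\<^sup>2 * (b * (norm w)\<^sup>2))" using l by (intro mult_left_mono) auto
    also have "\<dots> = a * (norm w)\<^sup>2" using ab b by (simp add: field_simps power2_eq_square power3_eq_cube)
    also have "\<dots> \<le> ip (A' w) w" by (rule op_betweenD(2)[OF A'])
    finally show ?thesis by (simp add: gap_const_def ac_simps)
  qed
  have nu: "norm u \<le> 2 * ?m * sqrt ?m * norm v"
  proof -
    have "norm S \<le> 2 * ?m"
      unfolding S_def
    proof (rule op_fun_norm_le[OF TZ kernel_hull_continuous_on[OF kernel_hull_mobius[OF s] l]])
      fix t assume t: "t \<in> {?l..?m}"
      then have "0 < t" using l by simp
      moreover have "1 / t \<le> ?m" using t l frac_le[of 1 1 ?l t] by simp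
      ultimately show "\<bar>mobius_kernel s t\<bar> \<le> 2 * ?m"
        using kernel_hull_bound[OF kernel_hull_mobius[OF s], of t] t by auto
    qed (use ab b in simp)
    then have "norm (S y) \<le> 2 * ?m * norm y" by (rule order.trans[OF norm_blinfun mult_right_mono]) simp
    then have "(norm (S y))\<^sup>2 \<le> (2 * ?m * norm y)\<^sup>2" by (intro power_mono) auto
    also have "\<dots> \<le> (2 * ?m)\<^sup>2 * (b * (norm v)\<^sup>2)"
      unfolding power_mult_distrib[of "2 * ?m"] y_def by (intro mult_left_mono norm_op_sqrt_bounds(2)[OF Z ab(1)]) auto
    finally have "a * (norm u)\<^sup>2 \<le> (2 * ?m)\<^sup>2 * (b * (norm v)\<^sup>2)"
      using norm_op_sqrt_bounds(1)[OF Z ab(1), of u] unfolding Su by linarith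
    then have "(norm u)\<^sup>2 \<le> (2 * ?m)\<^sup>2 * (?m * (norm v)\<^sup>2)" using ab by (simp add: field_simps)
    also have "\<dots> = (2 * ?m * sqrt ?m * norm v)\<^sup>2"
    proof -
      have "(sqrt ?m)\<^sup>2 = ?m" using ab by (intro real_sqrt_pow2) auto
      then show ?thesis unfolding power_mult_distrib[of "2 * ?m * sqrt ?m"] power_mult_distrib[of "2 * ?m"] by simp
    qed
    finally show ?thesis by (rule power2_le_imp_le) (use ab b in auto)
  qed
  have dv: "ip (?D v) v \<le> norm (?D v) * norm v" using ip_cauchy_schwarz[of "?D v" v] by linarith
  have du: "- (2 * (1 - s) * ip (?D v) u) \<le> 2 * (norm (?D v) * norm u)"
  proof -
    have "\<bar>(1 - s) * ip (?D v) u\<bar> \<le> 1 * (norm (?D v) * norm u)"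
      unfolding abs_mult using s ip_cauchy_schwarz[of "?D v" u] by (intro mult_mono) auto
    then show ?thesis by linarith
  qed
  have "perspective (mobius_kernel s) X A v \<le> c * perspective (mobius_kernel s) Z A' v - (c - 1) * ip (A' w) w
      + ip (?D v) v - 2 * (1 - s) * ip (?D v) u - s * (1 - s) * ip (?D u) u"
    using le Aw unfolding eq Dip by (simp add: algebra_simps)
  also have "\<dots> \<le> c * perspective (mobius_kernel s) Z A' v - (c - 1) * (gap_const a b * (norm v)\<^sup>2)
      + norm (?D v) * norm v + 2 * (norm (?D v) * norm u)"
  proof -
    have "(c - 1) * (gap_const a b * (norm v)\<^sup>2) \<le> (c - 1) * ip (A' w) w" using c gap by (intro mult_left_mono) auto
    moreover have "0 \<le> s * (1 - s) * ip (?D u) u" using s D by simp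
    ultimately show ?thesis using dv du by linarith
  qed
  also have "2 * (norm (?D v) * norm u) \<le> 2 * (norm (?D v) * (2 * ?m * sqrt ?m * norm v))"
    using nu by (intro mult_left_mono) auto
  finally show ?thesis by (simp add: drift_const_def algebra_simps)
qed

section \<open>Comparison and continuity for all operator monotone functions\<close>

lemma perspective_mix:
  assumes X: "X \<in> op_between a b" and A: "A \<in> op_between a b" and ab: "0 < a" "a \<le> b"
    and k: "kernel_hull k" and l: "kernel_hull l"
  shows "perspective (\<lambda>t. (1 - u) * k t + u * l t) X A v = (1 - u) * perspective k X A v + u * perspective l X A v"
proof -
  have pos: "0 < a / b" using ab by simp
  have T: "normalized X A \<in> op_between (a / b) (b / a)" using normalized_between[OF X A] ab by auto
  have ck: "continuous_on {a / b..b / a} k" and cl: "continuous_on {a / b..b / a} l"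
    using kernel_hull_continuous_on[OF k pos] kernel_hull_continuous_on[OF l pos] .
  have "op_fun (\<lambda>t. (1 - u) * k t + u * l t) (normalized X A)
      = (1 - u) *\<^sub>R op_fun k (normalized X A) + u *\<^sub>R op_fun l (normalized X A)"
    using ck cl by (subst op_fun_add[OF T]) (auto simp: op_fun_scale[OF T] intro!: continuous_intros)
  then show ?thesis by (simp add: perspective_def blinfun.add_left blinfun.scaleR_left ip_simps)
qed

lemma comparison_hull:
  fixes X Z A A' :: "'e::complex_hilbert_space \<Rightarrow>\<^sub>L 'e"
  assumes "kernel_hull k"
    and ab: "0 < a" "a \<le> b"
    and X: "X \<in> op_between a b" and Z: "Z \<in> op_between a b" and A: "A \<in> op_between a b" and A': "A' \<in> op_between a b"
    and AA: "A \<preceq> A'" and c: "1 \<le> c" and XZ: "X \<preceq> c *\<^sub>R Z"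
  shows "perspective k X A v \<le> c * perspective k Z A' v
    - gap_const a b * (c - 1) * (norm v)\<^sup>2 + drift_const a b * norm ((c *\<^sub>R Z - X) v) * norm v"
  using assms(1)
proof induction
  case (kernel_hull_mobius s)
  then show ?case by (intro comparison_mobius assms)
next
  case (kernel_hull_mix k l u)
  let ?e = "- gap_const a b * (c - 1) * (norm v)\<^sup>2 + drift_const a b * norm ((c *\<^sub>R Z - X) v) * norm v"
  have "(1 - u) * perspective k X A v + u * perspective l X A v
      \<le> (1 - u) * (c * perspective k Z A' v + ?e) + u * (c * perspective l Z A' v + ?e)"
    using kernel_hull_mix by (intro add_mono mult_left_mono) auto
  also have "\<dots> = c * ((1 - u) * perspective k Z A' v + u * perspective l Z A' v) + ?e"
    by (simp only: distrib_left left_diff_distrib) (simp add: algebra_simps)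
  finally show ?case
    using kernel_hull_mix perspective_mix[OF X A ab, of k l u v] perspective_mix[OF Z A' ab, of k l u v] by simp
qed

lemma perspective_approximation:
  assumes f: "f \<in> op_mono_funs" and X: "X \<in> op_between a b" and A: "A \<in> op_between a b" and ab: "0 < a" "a \<le> b"
    and k: "kernel_hull k" "\<And>t. t \<in> {a / b..b / a} \<Longrightarrow> \<bar>f t - k t\<bar> \<le> e" and e: "0 \<le> e"
  shows "\<bar>perspective f X A v - perspective k X A v\<bar> \<le> e * (b * (norm v)\<^sup>2)"
proof -
  have pos: "0 < a / b" using ab by simp
  have T: "normalized X A \<in> op_between (a / b) (b / a)" using normalized_between[OF X A] ab by auto
  let ?d = "op_fun f (normalized X A) - op_fun k (normalized X A)" and ?x = "op_sqrt X v"
  have "norm ?d \<le> e"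
    by (rule op_fun_norm_diff_le[OF T op_mono_funs_continuous_on[OF f pos] kernel_hull_continuous_on[OF k(1) pos] k(2) e])
  have "perspective f X A v - perspective k X A v = ip (?d ?x) ?x"
    by (simp add: perspective_def blinfun.diff_left ip_simps)
  also have "\<bar>ip (?d ?x) ?x\<bar> \<le> norm (?d ?x) * norm ?x" by (rule ip_cauchy_schwarz)
  also have "\<dots> \<le> (e * norm ?x) * norm ?x"
    by (intro mult_right_mono order.trans[OF norm_blinfun]) (use \<open>norm ?d \<le> e\<close> in auto)
  also have "\<dots> = e * (norm ?x)\<^sup>2" by (simp add: power2_eq_square)
  also have "\<dots> \<le> e * (b * (norm v)\<^sup>2)" by (intro mult_left_mono norm_op_sqrt_bounds(2)[OF X ab(1)] e)
  finally show ?thesis .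
qed

text \<open>The estimate for kernels is linear in the function with constants that depend on \<open>a\<close> and \<open>b\<close> only, so it
  passes to the hull and to uniform limits on \<open>[a / b, b / a]\<close>, where the spectra of the normalized operators lie.\<close>

lemma comparison_op_mono:
  fixes X Z A A' :: "'e::complex_hilbert_space \<Rightarrow>\<^sub>L 'e"
  assumes f: "f \<in> op_mono_funs"
    and ab: "0 < a" "a \<le> b"
    and X: "X \<in> op_between a b" and Z: "Z \<in> op_between a b" and A: "A \<in> op_between a b" and A': "A' \<in> op_between a b"
    and AA: "A \<preceq> A'" and c: "1 \<le> c" and XZ: "X \<preceq> c *\<^sub>R Z"
  shows "perspective f X A v \<le> c * perspective f Z A' v
    - gap_const a b * (c - 1) * (norm v)\<^sup>2 + drift_const a b * norm ((c *\<^sub>R Z - X) v) * norm v"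
    (is "?L \<le> ?R")
proof (rule field_le_epsilon)
  fix \<epsilon> :: real assume \<epsilon>: "0 < \<epsilon>"
  define e where "e = \<epsilon> / ((1 + c) * (b * (norm v)\<^sup>2) + 1)"
  have den: "0 < (1 + c) * (b * (norm v)\<^sup>2) + 1" using ab c by (intro add_nonneg_pos) auto
  have e: "0 < e" using \<epsilon> den by (simp add: e_def)
  have pos: "0 < a / b" using ab by simp
  obtain k where k: "kernel_hull k" "\<forall>t\<in>{a / b..b / a}. \<bar>f t - k t\<bar> < e"
    using op_mono_funs_uniform_hull[OF f pos e] by blast
  let ?E = "e * (b * (norm v)\<^sup>2)"
  have 1: "\<bar>perspective f X A v - perspective k X A v\<bar> \<le> ?E"
    by (rule perspective_approximation[OF f X A ab k(1)]) (use k(2) e in \<open>auto intro: less_imp_le\<close>)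
  have 2: "\<bar>perspective f Z A' v - perspective k Z A' v\<bar> \<le> ?E"
    by (rule perspective_approximation[OF f Z A' ab k(1)]) (use k(2) e in \<open>auto intro: less_imp_le\<close>)
  have "c * perspective k Z A' v \<le> c * (perspective f Z A' v + ?E)" using 2 c by (intro mult_left_mono) auto
  moreover have "?E + c * ?E \<le> \<epsilon>"
  proof -
    have "?E + c * ?E = e * ((1 + c) * (b * (norm v)\<^sup>2))" by (simp add: algebra_simps)
    also have "\<dots> \<le> e * ((1 + c) * (b * (norm v)\<^sup>2) + 1)" using e by (intro mult_left_mono) auto
    also have "\<dots> = \<epsilon>" using den by (simp add: e_def)
    finally show ?thesis .
  qed
  ultimately show "?L \<le> ?R + \<epsilon>"
    using 1 comparison_hull[OF k(1) ab X Z A A' AA c XZ, of v] by (simp only: distrib_left)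
qed

lemma op_fun_normalized_norm:
  assumes f: "f \<in> op_mono_funs" and X: "X \<in> op_between a b" and A: "A \<in> op_between a b" and ab: "0 < a" "a \<le> b"
  shows "op_fun f (normalized X A) \<in> self_adjoint_ops" "norm (op_fun f (normalized X A)) \<le> 2 * (b / a)"
proof -
  have pos: "0 < a / b" using ab by simp
  have T: "normalized X A \<in> op_between (a / b) (b / a)" using normalized_between[OF X A] ab by auto
  note cf = op_mono_funs_continuous_on[OF f pos]
  show "op_fun f (normalized X A) \<in> self_adjoint_ops" by (rule sa_op_fun[OF T cf])
  show "norm (op_fun f (normalized X A)) \<le> 2 * (b / a)"
  proof (rule op_fun_norm_le[OF T cf])
    fix t assume t: "t \<in> {a / b..b / a}"
    then have t0: "0 < t" using pos less_le_trans by auto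
    have "1 / t \<le> b / a" using t t0 ab pos frac_le[of 1 1 "a / b" t] by simp
    then show "\<bar>f t\<bar> \<le> 2 * (b / a)" using op_mono_funs_bound[OF f t0] t by auto
  qed (use ab in simp)
qed

lemma perspective_sign:
  assumes f: "f \<in> op_mono_funs" and X: "X \<in> op_between a b" and A: "A \<in> op_between a b" and ab: "0 < a" "a \<le> b"
  shows "A \<preceq> X \<Longrightarrow> perspective f X A v \<le> 0" "X \<preceq> A \<Longrightarrow> 0 \<le> perspective f X A v"
proof -
  have pos: "0 < a / b" using ab by simp
  have T: "normalized X A \<in> op_between (a / b) (b / a)" using normalized_between[OF X A] ab by auto
  have form: "(norm x)\<^sup>2 = ip (X (op_inv_sqrt X x)) (op_inv_sqrt X x)" for x
    using norm_op_sqrt[OF X ab(1), of "op_inv_sqrt X x"] op_sqrt_facts(3)[OF X ab(1), of x] by simp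
  { assume "A \<preceq> X"
    then have T1: "normalized X A \<in> op_between (a / b) 1"
      using T form unfolding op_between_iff by (auto simp: normalized_form[OF X ab(1)] op_le_iff)
    have "op_fun f (normalized X A) \<in> op_between (f (a / b)) 0"
    proof (rule op_fun_between[OF T1 op_mono_funs_continuous_on[OF f pos]])
      fix t assume "t \<in> {a / b..1}"
      then show "f (a / b) \<le> f t \<and> f t \<le> 0"
        using op_mono_funs_increment(1)[OF f, of t 1] op_mono_funs_increment(1)[OF f, of "a / b" t]
          op_mono_funs_one[OF f] pos by auto
    qed
    then show "perspective f X A v \<le> 0" unfolding perspective_def using op_betweenD(3) by fastforce }
  { assume "X \<preceq> A"
    then have T1: "normalized X A \<in> op_between 1 (b / a)"
      using T form unfolding op_between_iff by (auto simp: normalized_form[OF X ab(1)] op_le_iff)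
    have "op_fun f (normalized X A) \<in> op_between 0 (f (b / a))"
    proof (rule op_fun_between[OF T1 op_mono_funs_continuous_on[OF f]])
      fix t assume "t \<in> {1..b / a}"
      then show "0 \<le> f t \<and> f t \<le> f (b / a)"
        using op_mono_funs_increment(1)[OF f, of 1 t] op_mono_funs_increment(1)[OF f, of t "b / a"]
          op_mono_funs_one[OF f] by auto
    qed simp
    then show "0 \<le> perspective f X A v" unfolding perspective_def using op_betweenD(2) by fastforce }
qed

text \<open>The resolvent identity: with \<open>Q = (1 - s) T + s\<close> and with \<open>w\<close> such that \<open>((1 - s) U + s) w = x\<close>, the
  difference of the two functions at \<open>x\<close> is mapped by \<open>Q\<close> to \<open>(T - U) w\<close>.\<close>

lemma mobius_operator_lipschitz:
  fixes T U :: "'e::complex_hilbert_space \<Rightarrow>\<^sub>L 'e"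
  assumes T: "T \<in> op_between l m" and U: "U \<in> op_between l m" and l: "0 < l" and s: "0 \<le> s" "s \<le> 1"
  shows "norm (op_fun (mobius_kernel s) T - op_fun (mobius_kernel s) U) \<le> norm (T - U) / (min 1 l)\<^sup>2"
proof (rule norm_blinfun_bound)
  fix x :: 'e
  define q where "q = min 1 l"
  have q: "0 < q" using l by (simp add: q_def)
  define S where "S = op_fun (mobius_kernel s) T"
  define V where "V = op_fun (mobius_kernel s) U"
  have below: "q * norm z \<le> norm ((1 - s) *\<^sub>R Y z + s *\<^sub>R z)" if Y: "Y \<in> op_between l m" for Y z
  proof (cases "z = 0")
    case False
    have "q * (norm z)\<^sup>2 = (1 - s) * (q * (norm z)\<^sup>2) + s * (q * (norm z)\<^sup>2)" by (simp only: left_diff_distrib)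
    also have "\<dots> \<le> (1 - s) * ip (Y z) z + s * (1 * (norm z)\<^sup>2)"
    proof (intro add_mono mult_left_mono)
      show "q * (norm z)\<^sup>2 \<le> ip (Y z) z"
        by (rule order.trans[OF mult_right_mono op_betweenD(2)[OF Y]]) (auto simp: q_def)
      show "q * (norm z)\<^sup>2 \<le> 1 * (norm z)\<^sup>2" by (intro mult_right_mono) (auto simp: q_def)
    qed (use s in auto)
    also have "\<dots> = ip ((1 - s) *\<^sub>R Y z + s *\<^sub>R z) z" by (simp add: ip_simps ip_self)
    also have "\<dots> \<le> norm ((1 - s) *\<^sub>R Y z + s *\<^sub>R z) * norm z"
      using ip_cauchy_schwarz by (rule order.trans[OF abs_ge_self])
    finally show ?thesis using False by (simp add: power2_eq_square mult.assoc[symmetric])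
  qed simp
  define w where "w = x - (1 - s) *\<^sub>R V x"
  have "q * norm w \<le> norm x"
    using below[OF U, of w] mobius_optimizer_equation[OF U l s, of x] by (simp add: w_def V_def)
  have S: "(1 - s) *\<^sub>R T (S x) + s *\<^sub>R S x = T x - x" unfolding S_def by (rule mobius_kernel_equation[OF T l s])
  have V: "(1 - s) *\<^sub>R U (V x) + s *\<^sub>R V x = U x - x" unfolding V_def by (rule mobius_kernel_equation[OF U l s])
  have "(1 - s) *\<^sub>R T (S x - V x) + s *\<^sub>R (S x - V x)
      = ((1 - s) *\<^sub>R T (S x) + s *\<^sub>R S x) - ((1 - s) *\<^sub>R U (V x) + s *\<^sub>R V x) - (1 - s) *\<^sub>R (T - U) (V x)"
    by (simp add: blinfun.diff_right blinfun.diff_left algebra_simps)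
  also have "\<dots> = (T - U) w"
    unfolding S V w_def blinfun.diff_right blinfun.diff_left blinfun.scaleR_right by (simp add: algebra_simps)
  finally have "q * norm (S x - V x) \<le> norm ((T - U) w)" using below[OF T, of "S x - V x"] by simp
  also have "\<dots> \<le> norm (T - U) * norm w" by (rule norm_blinfun)
  finally have "q * (q * norm (S x - V x)) \<le> q * (norm (T - U) * norm w)" using q by (intro mult_left_mono) auto
  also have "\<dots> = norm (T - U) * (q * norm w)" by simp
  also have "\<dots> \<le> norm (T - U) * norm x" using \<open>q * norm w \<le> norm x\<close> by (intro mult_left_mono) auto
  finally have "norm (S x - V x) \<le> norm (T - U) / q\<^sup>2 * norm x"
    using q by (simp add: field_simps power2_eq_square)
  then show "norm ((op_fun (mobius_kernel s) T - op_fun (mobius_kernel s) U) x) \<le> norm (T - U) / (min 1 l)\<^sup>2 * norm x"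
    by (simp add: S_def V_def q_def blinfun.diff_left)
qed simp

lemma hull_operator_lipschitz:
  assumes "kernel_hull k" and T: "T \<in> op_between l m" and U: "U \<in> op_between l m" and l: "0 < l"
  shows "norm (op_fun k T - op_fun k U) \<le> norm (T - U) / (min 1 l)\<^sup>2"
  using assms(1)
proof induction
  case (kernel_hull_mobius s)
  then show ?case by (intro mobius_operator_lipschitz[OF T U l])
next
  case (kernel_hull_mix k g u)
  have ck: "continuous_on {l..m} k" and cg: "continuous_on {l..m} g"
    using kernel_hull_continuous_on kernel_hull_mix l by auto
  have e: "op_fun (\<lambda>t. (1 - u) * k t + u * g t) Y = (1 - u) *\<^sub>R op_fun k Y + u *\<^sub>R op_fun g Y" if Y: "Y \<in> op_between l m" for Y
    using ck cg by (subst op_fun_add[OF Y]) (auto simp: op_fun_scale[OF Y] intro!: continuous_intros)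
  have "norm (op_fun (\<lambda>t. (1 - u) * k t + u * g t) T - op_fun (\<lambda>t. (1 - u) * k t + u * g t) U)
      = norm ((1 - u) *\<^sub>R (op_fun k T - op_fun k U) + u *\<^sub>R (op_fun g T - op_fun g U))"
    unfolding e[OF T] e[OF U] by (simp add: algebra_simps)
  also have "\<dots> \<le> (1 - u) * norm (op_fun k T - op_fun k U) + u * norm (op_fun g T - op_fun g U)"
    using kernel_hull_mix by (intro order.trans[OF norm_triangle_ineq]) simp
  also have "\<dots> \<le> (1 - u) * (norm (T - U) / (min 1 l)\<^sup>2) + u * (norm (T - U) / (min 1 l)\<^sup>2)"
    using kernel_hull_mix by (intro add_mono mult_left_mono) auto
  also have "\<dots> = norm (T - U) / (min 1 l)\<^sup>2" by (simp only: left_diff_distrib)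
  finally show ?case .
qed

lemma op_mono_operator_lipschitz:
  assumes f: "f \<in> op_mono_funs" and T: "T \<in> op_between l m" and U: "U \<in> op_between l m" and l: "0 < l"
  shows "norm (op_fun f T - op_fun f U) \<le> norm (T - U) / (min 1 l)\<^sup>2"
proof (rule field_le_epsilon)
  fix e :: real assume e: "0 < e"
  then obtain k where k: "kernel_hull k" "\<forall>t\<in>{l..m}. \<bar>f t - k t\<bar> < e / 2"
    using op_mono_funs_uniform_hull[OF f l, of "e / 2" m] by auto
  have ap: "norm (op_fun f Y - op_fun k Y) \<le> e / 2" if "Y \<in> op_between l m" for Y
    by (rule op_fun_norm_diff_le[OF that op_mono_funs_continuous_on[OF f l] kernel_hull_continuous_on[OF k(1) l]])
      (use k e in \<open>auto intro: less_imp_le\<close>)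
  have "norm (op_fun f T - op_fun f U)
      = norm ((op_fun f T - op_fun k T) + (op_fun k T - op_fun k U) - (op_fun f U - op_fun k U))" by simp
  also have "\<dots> \<le> norm (op_fun f T - op_fun k T) + norm (op_fun k T - op_fun k U) + norm (op_fun f U - op_fun k U)"
    by (intro order.trans[OF norm_triangle_ineq4] add_right_mono norm_triangle_ineq)
  also have "\<dots> \<le> e / 2 + norm (T - U) / (min 1 l)\<^sup>2 + e / 2"
    by (intro add_mono ap T U hull_operator_lipschitz[OF k(1) T U l])
  finally show "norm (op_fun f T - op_fun f U) \<le> norm (T - U) / (min 1 l)\<^sup>2 + e" by simp
qed

section \<open>Weak integrals of operators\<close>

text \<open>The representing vector minimizes \<open>\<parallel>x\<parallel>\<^sup>2 - 2 \<phi>(x)\<close>; the parallelogram identity makes minimizing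
  sequences Cauchy.\<close>

lemma riesz_representation:
  fixes \<phi> :: "'e::complex_hilbert_space \<Rightarrow> real"
  assumes "bounded_linear \<phi>"
  shows "\<exists>z. \<forall>x. \<phi> x = ip z x"
proof -
  interpret bounded_linear \<phi> by fact
  obtain K where K: "0 < K" "\<And>x. norm (\<phi> x) \<le> norm x * K" using pos_bounded by blast
  define J where "J x = (norm x)\<^sup>2 - 2 * \<phi> x" for x
  define d where "d = Inf (range J)"
  have "- K\<^sup>2 \<le> J x" for x
  proof -
    have "\<phi> x \<le> norm x * K" using K(2)[of x] by simp
    moreover have "0 \<le> (norm x - K)\<^sup>2" by simp
    ultimately show ?thesis unfolding J_def by (simp add: power2_eq_square algebra_simps)
  qed
  then have bdd: "bdd_below (range J)" by (intro bdd_belowI[of _ "- K\<^sup>2"]) auto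
  have dJ: "d \<le> J x" for x unfolding d_def by (intro cInf_lower bdd) auto
  have "\<exists>x. J x < d + 1 / Suc n" for n
  proof -
    have "Inf (range J) < d + 1 / Suc n" by (simp add: d_def)
    then show ?thesis using cInf_lessD[of "range J"] by blast
  qed
  then obtain x where x: "\<And>n. J (x n) < d + 1 / Suc n" by metis
  have par: "(norm (u - v))\<^sup>2 \<le> 2 * (J u - d) + 2 * (J v - d)" for u v
  proof -
    have "(norm (u - v))\<^sup>2 = 2 * (norm u)\<^sup>2 + 2 * (norm v)\<^sup>2 - (norm (u + v))\<^sup>2"
      unfolding ip_self[symmetric] ip_simps by (simp add: ip_commute[of v u])
    moreover have "4 * J ((1 / 2) *\<^sub>R (u + v)) = (norm (u + v))\<^sup>2 - 4 * \<phi> u - 4 * \<phi> v"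
    proof -
      have "\<phi> ((1 / 2) *\<^sub>R (u + v)) = (\<phi> u + \<phi> v) / 2" by (simp only: scaleR add) simp
      then show ?thesis unfolding J_def by (simp add: power2_eq_square)
    qed
    moreover have "J u = (norm u)\<^sup>2 - 2 * \<phi> u" "J v = (norm v)\<^sup>2 - 2 * \<phi> v" by (simp_all add: J_def)
    moreover have "d \<le> J ((1 / 2) *\<^sub>R (u + v))" by (rule dJ)
    ultimately show ?thesis by argo
  qed
  have "Cauchy x"
  proof (rule CauchyI)
    fix e :: real assume e: "0 < e"
    then obtain N where N: "1 / Suc N < e\<^sup>2 / 4" using nat_approx_posE[of "e\<^sup>2 / 4"] by auto
    show "\<exists>M. \<forall>m\<ge>M. \<forall>n\<ge>M. norm (x m - x n) < e"
    proof (intro exI allI impI)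
      fix m n assume mn: "N \<le> m" "N \<le> n"
      have "1 / real (Suc m) \<le> 1 / Suc N" "1 / real (Suc n) \<le> 1 / Suc N" using mn by (simp_all add: frac_le)
      then have "J (x m) < d + e\<^sup>2 / 4" "J (x n) < d + e\<^sup>2 / 4"
        using less_trans[OF less_le_trans[OF x add_left_mono] add_strict_left_mono[OF N]] by blast+
      then have "(norm (x m - x n))\<^sup>2 < e\<^sup>2" using par[of "x m" "x n"] by argo
      then show "norm (x m - x n) < e" using e by (simp add: power2_less_imp_less)
    qed
  qed
  then obtain z where z: "x \<longlonglongrightarrow> z" using Cauchy_convergent convergent_def by blast
  have "(\<lambda>n. J (x n)) \<longlonglongrightarrow> J z"
    unfolding J_def by (intro tendsto_intros z tendsto)
  moreover have "(\<lambda>n. d + 1 / Suc n) \<longlonglongrightarrow> d + 0"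
    by (intro tendsto_add tendsto_const LIMSEQ_inverse_real_of_nat[unfolded inverse_eq_divide])
  ultimately have "J z \<le> d" using x by (intro LIMSEQ_le[of "\<lambda>n. J (x n)" "J z" "\<lambda>n. d + 1 / Suc n" d]) (auto intro: less_imp_le)
  have "\<phi> y = ip z y" for y
  proof -
    have "0 \<le> 0 + 2 * (ip z y - \<phi> y) * t + (norm y)\<^sup>2 * t\<^sup>2" for t
    proof -
      have "J z \<le> J (z + t *\<^sub>R y)" using \<open>J z \<le> d\<close> dJ[of "z + t *\<^sub>R y"] by linarith
      moreover have "(norm (z + t *\<^sub>R y))\<^sup>2 = (norm z)\<^sup>2 + 2 * t * ip z y + (norm y)\<^sup>2 * t\<^sup>2"
        unfolding ip_self[symmetric] ip_simps by (simp add: ip_commute[of y z] power2_eq_square algebra_simps)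
      ultimately show ?thesis unfolding J_def by (simp add: add scaleR algebra_simps)
    qed
    then have "(ip z y - \<phi> y)\<^sup>2 \<le> 0 * (norm y)\<^sup>2" by (rule quadratic_nonneg_discriminant)
    then show ?thesis by simp
  qed
  then show ?thesis by blast
qed

lemma bounded_form_operator:
  fixes B :: "'e::complex_hilbert_space \<Rightarrow> 'e \<Rightarrow> real"
  assumes "bounded_bilinear B"
  shows "\<exists>T :: 'e \<Rightarrow>\<^sub>L 'e. \<forall>x y. B x y = ip (T x) y"
proof -
  interpret bounded_bilinear B by fact
  have "\<exists>z. \<forall>y. B x y = ip z y" for x
    by (rule riesz_representation) (rule bounded_linear_right)
  then obtain g where g: "\<And>x y. B x y = ip (g x) y" by metis
  obtain K where K: "0 < K" "\<And>x y. norm (B x y) \<le> norm x * norm y * K" using pos_bounded by blast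
  have "bounded_linear g"
  proof (rule bounded_linear_intro)
    show "g (x + y) = g x + g y" for x y by (rule ip_eqI) (simp add: g[symmetric] ip_simps add_left)
    show "g (r *\<^sub>R x) = r *\<^sub>R g x" for r x by (rule ip_eqI) (simp add: g[symmetric] ip_simps scaleR_left)
    show "norm (g x) \<le> norm x * K" for x
    proof (cases "g x = 0")
      case False
      have "norm (g x) * norm (g x) \<le> (norm x * K) * norm (g x)"
        using K(2)[of x "g x"] by (simp add: g ip_self power2_eq_square algebra_simps)
      then show ?thesis using False by simp
    qed (use K in simp)
  qed
  then have "blinfun_apply (Blinfun g) = g" by (rule bounded_linear_Blinfun_apply)
  then show ?thesis using g by metis
qed

lemma ip_scaleC_left: "ip (c *\<^sub>C x) y = ip x (cnj c *\<^sub>C y)"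
  by (simp add: ip_def cinner_scaleC_left cinner_scaleC_right)

lemma has_weak_integralD:
  assumes "has_weak_integral M g T"
  shows "T \<in> self_adjoint_ops" "integrable M (\<lambda>z. ip (g z x) y)" "(\<integral>z. ip (g z x) y \<partial>M) = ip (T x) y"
proof -
  have hb: "has_bochner_integral M (\<lambda>z. cinner (g z x) y) (cinner (T x) y)"
    using assms by (simp add: has_weak_integral_def)
  show "T \<in> self_adjoint_ops" using assms by (simp add: has_weak_integral_def)
  show "integrable M (\<lambda>z. ip (g z x) y)" using hb unfolding ip_def has_bochner_integral_iff by auto
  show "(\<integral>z. ip (g z x) y \<partial>M) = ip (T x) y" using hb unfolding ip_def has_bochner_integral_iff by auto
qed

text \<open>The integrated matrix elements are a bounded bilinear form, which the Riesz
  representation turns into an operator.\<close>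

lemma (in prob_space) weak_integral_exists:
  fixes g :: "'a \<Rightarrow> ('e::complex_hilbert_space \<Rightarrow>\<^sub>L 'e)"
  assumes sa: "AE z in M. g z \<in> self_adjoint_ops" and bd: "AE z in M. norm (g z) \<le> K"
    and meas: "\<And>x y. (\<lambda>z. cinner (g z x) y) \<in> borel_measurable M"
  shows "\<exists>T. has_weak_integral M g T"
proof -
  have int: "integrable M (\<lambda>z. cinner (g z x) y)" for x y
  proof (rule integrable_const_bound[OF _ meas])
    show "AE z in M. norm (cinner (g z x) y) \<le> 2 * (K * norm x * norm y)"
      using bd
    proof eventually_elim
      case (elim z)
      have "norm (cinner (g z x) y) \<le> 2 * (norm (g z x) * norm y)" by (rule norm_cinner_le)
      also have "\<dots> \<le> 2 * (K * norm x * norm y)"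
        by (intro mult_left_mono mult_right_mono order.trans[OF norm_blinfun] elim) auto
      finally show ?case .
    qed
  qed
  then have intr: "integrable M (\<lambda>z. ip (g z x) y)" for x y unfolding ip_def by (rule integrable_Re)
  define B where "B x y = (\<integral>z. ip (g z x) y \<partial>M)" for x y
  have bnd: "\<bar>B x y\<bar> \<le> \<bar>K\<bar> * (norm x * norm y)" for x y
  proof -
    have "AE z in M. \<bar>ip (g z x) y\<bar> \<le> \<bar>K\<bar> * (norm x * norm y)"
      using bd
    proof eventually_elim
      case (elim z)
      have "\<bar>ip (g z x) y\<bar> \<le> norm (g z x) * norm y" by (rule ip_cauchy_schwarz)
      also have "\<dots> \<le> \<bar>K\<bar> * norm x * norm y"
        by (intro mult_right_mono order.trans[OF norm_blinfun]) (use elim in auto)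
      finally show ?case by (simp add: mult.assoc)
    qed
    then have "(\<integral>z. \<bar>ip (g z x) y\<bar> \<partial>M) \<le> (\<integral>z. \<bar>K\<bar> * (norm x * norm y) \<partial>M)"
      by (intro integral_mono_AE integrable_abs intr) auto
    then have "(\<integral>z. \<bar>ip (g z x) y\<bar> \<partial>M) \<le> \<bar>K\<bar> * (norm x * norm y)" by (simp add: prob_space)
    then show ?thesis unfolding B_def by (rule order.trans[OF integral_abs_bound])
  qed
  have "bounded_bilinear B"
    by standard (auto simp: B_def blinfun.add_right blinfun.scaleR_right ip_simps intr
        intro!: exI[of _ "\<bar>K\<bar>"] order.trans[OF bnd[unfolded B_def]])
  then obtain T :: "'e \<Rightarrow>\<^sub>L 'e" where T: "\<And>x y. B x y = ip (T x) y" using bounded_form_operator by blast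
  have "T \<in> self_adjoint_ops"
    unfolding self_adjoint_ops_iff
  proof (intro conjI allI)
    fix c x y
    show "ip (T x) y = ip x (T y)"
    proof -
      have "B x y = B y x"
        unfolding B_def
      proof (rule integral_cong_AE)
        show "AE z in M. ip (g z x) y = ip (g z y) x"
          using sa by eventually_elim (metis sa_ip ip_commute)
      qed (auto intro: borel_measurable_integrable intr)
      then show ?thesis using T ip_commute by metis
    qed
    show "T (c *\<^sub>C x) = c *\<^sub>C T x"
    proof (rule ip_eqI)
      fix y
      have "B (c *\<^sub>C x) y = B x (cnj c *\<^sub>C y)"
        unfolding B_def
      proof (rule integral_cong_AE)
        show "AE z in M. ip (g z (c *\<^sub>C x)) y = ip (g z x) (cnj c *\<^sub>C y)"
          using sa by eventually_elim (simp add: self_adjoint_ops_iff ip_scaleC_left)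
      qed (auto intro: borel_measurable_integrable intr)
      then show "ip (T (c *\<^sub>C x)) y = ip (c *\<^sub>C T x) y" by (simp add: T ip_scaleC_left)
    qed
  qed
  moreover have "(\<integral>z. cinner (g z x) y \<partial>M) = cinner (T x) y" for x y
  proof (rule complex_eqI)
    show "Re (\<integral>z. cinner (g z x) y \<partial>M) = Re (cinner (T x) y)"
      using T[of x y] unfolding B_def ip_def by (simp add: integral_Re int)
    have "Im (\<integral>z. cinner (g z x) y \<partial>M) = (\<integral>z. ip (g z x) (\<i> *\<^sub>C y) \<partial>M)"
      unfolding integral_Im[OF int, symmetric] by (simp add: cinner_ip)
    also have "\<dots> = Im (cinner (T x) y)" using T[of x "\<i> *\<^sub>C y"] unfolding B_def by (simp add: cinner_ip)
    finally show "Im (\<integral>z. cinner (g z x) y \<partial>M) = Im (cinner (T x) y)" .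
  qed
  ultimately show ?thesis unfolding has_weak_integral_def has_bochner_integral_iff using int by blast
qed

lemma topspace_LP: "topspace LP_topology = op_mono_funs \<times> pos_def_ops"
proof -
  have "op_mono_funs \<subseteq> topspace (product_topology (\<lambda>_. euclideanreal) {0<..})"
    by (auto simp: op_mono_funs_def PiE_def)
  then show ?thesis by (auto simp: LP_topology_def op_mono_topology_def)
qed

lemma openin_op_mono_close_on_finite:
  assumes "finite T" "T \<subseteq> {0<..}"
  shows "openin op_mono_topology {f \<in> op_mono_funs. \<forall>t\<in>T. \<bar>f t - f0 t\<bar> < e}"
  using assms
proof (induction T rule: finite_induct)
  case empty
  have "topspace op_mono_topology = op_mono_funs"
    by (auto simp: op_mono_topology_def op_mono_funs_def PiE_def)
  then show ?case using openin_topspace[of op_mono_topology] by simp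
next
  case (insert u T)
  have ts: "topspace op_mono_topology = op_mono_funs"
    by (auto simp: op_mono_topology_def op_mono_funs_def PiE_def)
  have "continuous_map op_mono_topology euclideanreal (\<lambda>f. f u)"
    unfolding op_mono_topology_def using insert.prems
    by (intro continuous_map_from_subtopology continuous_map_product_projection) auto
  then have "openin op_mono_topology {f \<in> topspace op_mono_topology. f u \<in> ball (f0 u) e}"
    by (rule openin_continuous_map_preimage) simp
  then have "openin op_mono_topology ({f \<in> topspace op_mono_topology. f u \<in> ball (f0 u) e} \<inter> {f \<in> op_mono_funs. \<forall>t\<in>T. \<bar>f t - f0 t\<bar> < e})"
    using insert by (intro openin_Int) auto
  also have "{f \<in> topspace op_mono_topology. f u \<in> ball (f0 u) e} \<inter> {f \<in> op_mono_funs. \<forall>t\<in>T. \<bar>f t - f0 t\<bar> < e}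
      = {f \<in> op_mono_funs. \<forall>t\<in>insert u T. \<bar>f t - f0 t\<bar> < e}"
    by (auto simp: ts dist_real_def abs_minus_commute)
  finally show ?case .
qed

lemma op_between_perturb:
  assumes A: "A \<in> op_between a b" and B: "B \<in> self_adjoint_ops" and d: "norm (B - A) \<le> d"
  shows "B \<in> op_between (a - d) (b + d)"
  unfolding op_between_iff
proof (intro conjI allI B)
  fix x
  have "\<bar>ip ((B - A) x) x\<bar> \<le> norm ((B - A) x) * norm x" by (rule ip_cauchy_schwarz)
  also have "\<dots> \<le> (d * norm x) * norm x"
    by (intro mult_right_mono order.trans[OF norm_blinfun]) (use d in auto)
  finally have "\<bar>ip (B x) x - ip (A x) x\<bar> \<le> d * (norm x)\<^sup>2"
    by (simp add: blinfun.diff_left ip_simps power2_eq_square)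
  then show "(a - d) * (norm x)\<^sup>2 \<le> ip (B x) x" "ip (B x) x \<le> (b + d) * (norm x)\<^sup>2"
    using op_betweenD(2,3)[OF A, of x] by (auto simp: algebra_simps)
qed

text \<open>Joint continuity for the topology of pointwise convergence: near \<open>A\<^sub>0\<close> all spectra stay in one interval
  \<open>[l, m]\<close>, where the equi-Lipschitz bound turns closeness on a finite net into uniform closeness of the
  functions, while the dependence on the operator is Lipschitz with a constant for all functions at once.\<close>

lemma normalized_calculus_continuous:
  fixes X :: "'e::complex_hilbert_space \<Rightarrow>\<^sub>L 'e"
  assumes X: "X \<in> pos_def_ops" and f0: "f0 \<in> op_mono_funs" and A0: "A0 \<in> pos_def_ops" and e: "0 < e"
  shows "\<exists>U. openin LP_topology U \<and> (f0, A0) \<in> U \<and>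
    (\<forall>(f, A)\<in>U. norm (op_fun f (normalized X A) - op_fun f0 (normalized X A0)) < e)"
proof -
  obtain p q where p: "0 < p" and X': "X \<in> op_between p q" using X by (auto simp: pos_def_ops_iff)
  obtain a b where a: "0 < a" and A0': "A0 \<in> op_between a b" using A0 by (auto simp: pos_def_ops_iff)
  define q' where "q' = max q 1"
  have X1: "X \<in> op_between p q'" and q': "0 < q'" using op_between_mono[OF X'] by (auto simp: q'_def)
  define l where "l = (a / 2) / q'"
  define m where "m = (max b 0 + a / 2) / p"
  have l: "0 < l" using a q' by (simp add: l_def)
  let ?R = "op_inv_sqrt X"
  define C where "C = (norm ?R)\<^sup>2 / (min 1 l)\<^sup>2 + 1"
  have C: "0 < C" by (simp add: C_def add_nonneg_pos)
  define \<delta> where "\<delta> = min (a / 2) (e / (2 * C))"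
  have \<delta>: "0 < \<delta>" "\<delta> \<le> a / 2" "C * \<delta> \<le> e / 2"
  proof -
    show "0 < \<delta>" "\<delta> \<le> a / 2" using a e C by (auto simp: \<delta>_def)
    have "C * \<delta> \<le> C * (e / (2 * C))" using C by (intro mult_left_mono) (auto simp: \<delta>_def)
    then show "C * \<delta> \<le> e / 2" using C by simp
  qed
  have e4: "0 < e / 4" using e by simp
  obtain T where T: "finite T" "T \<subseteq> {l..m}"
    "\<forall>f g. lipschitz_above l f \<longrightarrow> lipschitz_above l g \<longrightarrow> (\<forall>t\<in>T. \<bar>f t - g t\<bar> < (e / 4) / 3) \<longrightarrow>
      (\<forall>t\<in>{l..m}. \<bar>f t - g t\<bar> < e / 4)"
    using lipschitz_close_on_net[OF l e4, of m] by blast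
  let ?F = "{f \<in> op_mono_funs. \<forall>t\<in>T. \<bar>f t - f0 t\<bar> < (e / 4) / 3}"
  let ?U = "?F \<times> (pos_def_ops \<inter> ball A0 \<delta>)"
  have "openin LP_topology ?U"
    unfolding LP_topology_def
  proof (rule openin_prod_Times_iff[THEN iffD2], intro disjI2 conjI)
    show "openin op_mono_topology ?F" using T l by (intro openin_op_mono_close_on_finite) auto
    show "openin (top_of_set pos_def_ops) (pos_def_ops \<inter> ball A0 \<delta>)" by (intro openin_open_Int) simp
  qed
  moreover have "(f0, A0) \<in> ?U" using f0 A0 e \<delta> by auto
  moreover have "norm (op_fun f (normalized X A) - op_fun f0 (normalized X A0)) < e" if "(f, A) \<in> ?U" for f A
  proof -
    have f: "f \<in> op_mono_funs" "\<forall>t\<in>T. \<bar>f t - f0 t\<bar> < (e / 4) / 3" and A: "A \<in> pos_def_ops" "norm (A - A0) < \<delta>"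
      using that by (auto simp: dist_norm norm_minus_commute)
    have saA: "A \<in> self_adjoint_ops" using A(1) by (auto simp: pos_def_ops_iff op_between_iff)
    have "A \<in> op_between (a - \<delta>) (b + \<delta>)" using op_between_perturb[OF A0' saA] A(2) by simp
    then have bA: "A \<in> op_between (a / 2) (max b 0 + a / 2)" by (rule op_between_mono) (use \<delta> in auto)
    have bA0: "A0 \<in> op_between (a / 2) (max b 0 + a / 2)" by (rule op_between_mono[OF A0']) (use a in auto)
    have N: "normalized X A \<in> op_between l m" and N0: "normalized X A0 \<in> op_between l m"
      unfolding l_def m_def using normalized_between[OF X1 bA] normalized_between[OF X1 bA0] a p q' by auto
    have "norm (normalized X A - normalized X A0) \<le> (norm ?R)\<^sup>2 * \<delta>"
    proof -
      have "normalized X A - normalized X A0 = ?R o\<^sub>L (A - A0) o\<^sub>L ?R"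
        by (simp add: normalized_def blinfun_compose_linear)
      also have "norm \<dots> \<le> norm ?R * norm (A - A0) * norm ?R"
        by (intro order.trans[OF norm_blinfun_compose] mult_right_mono norm_blinfun_compose) auto
      also have "\<dots> \<le> norm ?R * \<delta> * norm ?R" using A by (intro mult_right_mono mult_left_mono) auto
      finally show ?thesis by (simp add: power2_eq_square ac_simps)
    qed
    then have "norm (op_fun f (normalized X A) - op_fun f (normalized X A0)) \<le> (norm ?R)\<^sup>2 * \<delta> / (min 1 l)\<^sup>2"
      by (intro order.trans[OF op_mono_operator_lipschitz[OF f(1) N N0 l]] divide_right_mono) auto
    also have "\<dots> \<le> C * \<delta>" using \<delta>(1) by (simp add: C_def algebra_simps)
    finally have 1: "norm (op_fun f (normalized X A) - op_fun f (normalized X A0)) \<le> e / 2" using \<delta>(3) by linarith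
    have "\<forall>t\<in>{l..m}. \<bar>f t - f0 t\<bar> < e / 4"
      using T(3) f(2) op_mono_funs_lipschitz[OF f(1) l] op_mono_funs_lipschitz[OF f0 l] by blast
    then have 2: "norm (op_fun f (normalized X A0) - op_fun f0 (normalized X A0)) \<le> e / 4"
      by (intro op_fun_norm_diff_le[OF N0 op_mono_funs_continuous_on[OF f(1) l] op_mono_funs_continuous_on[OF f0 l]])
        (use e in \<open>auto intro: less_imp_le\<close>)
    have "norm (op_fun f (normalized X A) - op_fun f0 (normalized X A0))
        \<le> norm (op_fun f (normalized X A) - op_fun f (normalized X A0)) + norm (op_fun f (normalized X A0) - op_fun f0 (normalized X A0))"
      using norm_triangle_ineq[of "op_fun f (normalized X A) - op_fun f (normalized X A0)" "op_fun f (normalized X A0) - op_fun f0 (normalized X A0)"] by simp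
    then show ?thesis using 1 2 e by linarith
  qed
  ultimately show ?thesis by (intro exI[of _ ?U]) auto
qed

lemma borel_of_LP:
  "space (borel_of_topology LP_topology) = op_mono_funs \<times> pos_def_ops"
  "openin LP_topology U \<Longrightarrow> U \<in> sets (borel_of_topology LP_topology)"
proof -
  have sub: "{U. openin LP_topology U} \<subseteq> Pow (topspace LP_topology)" using openin_subset by auto
  show "space (borel_of_topology LP_topology) = op_mono_funs \<times> pos_def_ops"
    unfolding borel_of_topology_def space_measure_of[OF sub] by (rule topspace_LP)
  show "openin LP_topology U \<Longrightarrow> U \<in> sets (borel_of_topology LP_topology)"
    unfolding borel_of_topology_def sets_measure_of[OF sub] by (simp add: sigma_sets.Basic)
qed

text \<open>The Borel sets of the product topology may be more than the product of the Borel sets, so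
  measurability is drawn from joint continuity.\<close>

lemma measurable_normalized_calculus:
  fixes X :: "'e::complex_hilbert_space \<Rightarrow>\<^sub>L 'e"
  assumes X: "X \<in> pos_def_ops"
  shows "(\<lambda>z. cinner (op_fun (fst z) (normalized X (snd z)) x) y) \<in> borel_measurable (borel_of_topology LP_topology)"
    (is "?F \<in> _")
proof (rule borel_measurableI)
  fix S :: "complex set" assume S: "open S"
  have "openin LP_topology (?F -` S \<inter> space (borel_of_topology LP_topology))"
  proof (subst openin_subopen, intro ballI)
    fix z assume "z \<in> ?F -` S \<inter> space (borel_of_topology LP_topology)"
    then have z: "?F z \<in> S" "fst z \<in> op_mono_funs" "snd z \<in> pos_def_ops" by (auto simp: borel_of_LP)
    obtain e where e: "0 < e" "ball (?F z) e \<subseteq> S" using S z(1) open_contains_ball by blast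
    define e' where "e' = e / (2 * (norm x * norm y) + 1)"
    have den: "0 < 2 * (norm x * norm y) + 1" by (intro add_nonneg_pos) auto
    have e': "0 < e'" using e den by (simp add: e'_def)
    from normalized_calculus_continuous[OF X z(2,3) e']
    obtain U where U: "openin LP_topology U" "z \<in> U"
      "\<forall>(f, A)\<in>U. norm (op_fun f (normalized X A) - op_fun (fst z) (normalized X (snd z))) < e'" by auto
    have "U \<subseteq> ?F -` S \<inter> space (borel_of_topology LP_topology)"
    proof
      fix w assume w: "w \<in> U"
      let ?D = "op_fun (fst w) (normalized X (snd w)) - op_fun (fst z) (normalized X (snd z))"
      have D: "norm ?D < e'" using U(3) w by (auto simp: case_prod_beta)
      have "?F w - ?F z = cinner (?D x) y"
        using cinner_add_left[of "?D x" "op_fun (fst z) (normalized X (snd z)) x" y] by (simp add: blinfun.diff_left)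
      also have "norm \<dots> \<le> 2 * (norm (?D x) * norm y)" by (rule norm_cinner_le)
      also have "\<dots> \<le> 2 * (e' * norm x * norm y)"
        by (intro mult_left_mono mult_right_mono order.trans[OF norm_blinfun]) (use D in auto)
      also have "\<dots> = e' * (2 * (norm x * norm y))" by simp
      also have "\<dots> < e' * (2 * (norm x * norm y) + 1)" using e' by simp
      also have "\<dots> = e" using den by (simp add: e'_def)
      finally have "?F w \<in> ball (?F z) e" by (simp add: dist_norm norm_minus_commute)
      then show "w \<in> ?F -` S \<inter> space (borel_of_topology LP_topology)"
        using e(2) w openin_subset[OF U(1)] by (auto simp: borel_of_LP topspace_LP)
    qed
    then show "\<exists>T. openin LP_topology T \<and> z \<in> T \<and> T \<subseteq> ?F -` S \<inter> space (borel_of_topology LP_topology)"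
      using U by blast
  qed
  then show "?F -` S \<inter> space (borel_of_topology LP_topology) \<in> sets (borel_of_topology LP_topology)"
    by (rule borel_of_LP(2))
qed

section \<open>The Karcher drift and its Euler steps\<close>

definition supported_between :: "real \<Rightarrow> real \<Rightarrow> ((real \<Rightarrow> real) \<times> ('e::complex_hilbert_space \<Rightarrow>\<^sub>L 'e)) measure \<Rightarrow> bool" where
  "supported_between a b \<mu> \<longleftrightarrow> prob_space \<mu> \<and> sets \<mu> = sets (borel_of_topology LP_topology) \<and>
    (AE z in \<mu>. snd z \<in> op_between a b)"

lemma supported_between_mono:
  "supported_between a b \<mu> \<Longrightarrow> a' \<le> a \<Longrightarrow> b \<le> b' \<Longrightarrow> supported_between a' b' \<mu>"
  unfolding supported_between_def using op_between_mono by (auto elim!: eventually_mono)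

lemma bdd_prob_measures_supported:
  assumes "\<mu> \<in> bdd_prob_measures"
  shows "\<exists>r\<ge>0. supported_between (exp (- r)) (exp r) \<mu>"
proof -
  let ?S = "supp_measure LP_topology \<mu>"
  from assms obtain r where \<mu>: "prob_space \<mu>" "sets \<mu> = sets (borel_of_topology LP_topology)" "emeasure \<mu> ?S = 1"
    and r: "?S \<subseteq> op_mono_funs \<times> op_interval r" by (auto simp: bdd_prob_measures_def)
  interpret prob_space \<mu> by fact
  have "?S \<in> sets \<mu>" using \<mu>(3) emeasure_notin_sets by force
  then have "AE z in \<mu>. z \<in> ?S" using \<mu>(3) by (intro AE_prob_1) (auto simp: measure_def)
  then have "AE z in \<mu>. snd z \<in> op_between (exp (- \<bar>r\<bar>)) (exp \<bar>r\<bar>)"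
  proof eventually_elim
    case (elim z)
    then have "snd z \<in> op_between (exp (- r)) (exp r)" using r by (auto simp: op_interval_eq)
    then show ?case by (rule op_between_mono) auto
  qed
  then show ?thesis using \<mu> by (intro exI[of _ "\<bar>r\<bar>"]) (auto simp: supported_between_def)
qed

lemma space_supported: "sets \<mu> = sets (borel_of_topology LP_topology) \<Longrightarrow> space \<mu> = op_mono_funs \<times> pos_def_ops"
  using sets_eq_imp_space_eq borel_of_LP(1) by metis

lemma AE_supported:
  assumes "supported_between a b \<mu>"
  shows "AE z in \<mu>. fst z \<in> op_mono_funs \<and> snd z \<in> op_between a b"
proof -
  have "AE z in \<mu>. snd z \<in> op_between a b" using assms by (simp add: supported_between_def)
  moreover have "AE z in \<mu>. z \<in> space \<mu>" by (rule AE_space)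
  ultimately show ?thesis
    using space_supported[of \<mu>] assms by (auto simp: supported_between_def elim!: eventually_elim2)
qed

definition normalized_calculus ::
  "('e::complex_hilbert_space \<Rightarrow>\<^sub>L 'e) \<Rightarrow> (real \<Rightarrow> real) \<times> ('e \<Rightarrow>\<^sub>L 'e) \<Rightarrow> ('e \<Rightarrow>\<^sub>L 'e)" where
  "normalized_calculus X z = op_fun (fst z) (normalized X (snd z))"

lemma karcher_equation_iff: "karcher_equation \<mu> X \<longleftrightarrow> has_weak_integral \<mu> (normalized_calculus X) 0"
  unfolding karcher_equation_def normalized_calculus_def normalized_def by (simp add: case_prod_beta')

text \<open>The operator \<open>G(X) = \<integral> X\<^sup>1\<^sup>/\<^sup>2 f(X\<^sup>-\<^sup>1\<^sup>/\<^sup>2 A X\<^sup>-\<^sup>1\<^sup>/\<^sup>2) X\<^sup>1\<^sup>/\<^sup>2 d\<mu>\<close>. It vanishes exactly at the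
  solutions, and after this congruence its dependence on \<open>X\<close> is governed by the comparison inequality.\<close>

definition karcher_drift ::
  "((real \<Rightarrow> real) \<times> ('e::complex_hilbert_space \<Rightarrow>\<^sub>L 'e)) measure \<Rightarrow> ('e \<Rightarrow>\<^sub>L 'e) \<Rightarrow> ('e \<Rightarrow>\<^sub>L 'e)" where
  "karcher_drift \<mu> X = op_sqrt X o\<^sub>L (SOME T. has_weak_integral \<mu> (normalized_calculus X) T) o\<^sub>L op_sqrt X"

lemma op_between_pos_def: "X \<in> op_between a b \<Longrightarrow> 0 < a \<Longrightarrow> X \<in> pos_def_ops"
  by (auto simp: pos_def_ops_iff)

context
  fixes a b :: real
  assumes ab: "0 < a" "a \<le> b"
begin

lemma weak_integral_normalized_calculus:
  assumes \<mu>: "supported_between a b \<mu>" and X: "X \<in> op_between a b"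
  shows "\<exists>T. has_weak_integral \<mu> (normalized_calculus X) T"
proof -
  interpret prob_space \<mu> using \<mu> by (simp add: supported_between_def)
  show ?thesis
  proof (rule weak_integral_exists)
    show "AE z in \<mu>. normalized_calculus X z \<in> self_adjoint_ops"
      using AE_supported[OF \<mu>] by eventually_elim (auto simp: normalized_calculus_def op_fun_normalized_norm[OF _ X _ ab])
    show "AE z in \<mu>. norm (normalized_calculus X z) \<le> 2 * (b / a)"
      using AE_supported[OF \<mu>]
      by eventually_elim (use op_fun_normalized_norm(2)[OF _ X _ ab] in \<open>auto simp: normalized_calculus_def\<close>)
    have "measurable \<mu> borel = measurable (borel_of_topology LP_topology) (borel :: complex measure)"
      using \<mu> by (intro measurable_cong_sets) (auto simp: supported_between_def)
    then show "(\<lambda>z. cinner (normalized_calculus X z x) y) \<in> borel_measurable \<mu>" for x y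
      using measurable_normalized_calculus[OF op_between_pos_def[OF X ab(1)], of x y] by (simp add: normalized_calculus_def)
  qed
qed

lemma karcher_drift_facts:
  assumes \<mu>: "supported_between a b \<mu>" and X: "X \<in> op_between a b"
  shows "karcher_drift \<mu> X \<in> self_adjoint_ops"
    "integrable \<mu> (\<lambda>z. perspective (fst z) X (snd z) v)"
    "ip (karcher_drift \<mu> X v) v = (\<integral>z. perspective (fst z) X (snd z) v \<partial>\<mu>)"
    "karcher_equation \<mu> X \<longleftrightarrow> karcher_drift \<mu> X = 0"
proof -
  define T where "T = (SOME T. has_weak_integral \<mu> (normalized_calculus X) T)"
  have T: "has_weak_integral \<mu> (normalized_calculus X) T"
    unfolding T_def by (rule someI_ex[OF weak_integral_normalized_calculus[OF \<mu> X]])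
  have K: "karcher_drift \<mu> X = op_sqrt X o\<^sub>L T o\<^sub>L op_sqrt X" by (simp add: karcher_drift_def T_def)
  note sq = op_sqrt_facts[OF X ab(1)]
  show "karcher_drift \<mu> X \<in> self_adjoint_ops" unfolding K using has_weak_integralD(1)[OF T] sq(2) by simp
  have p: "perspective (fst z) X (snd z) v = ip (normalized_calculus X z (op_sqrt X v)) (op_sqrt X v)" for z
    by (simp add: perspective_def normalized_calculus_def)
  show "integrable \<mu> (\<lambda>z. perspective (fst z) X (snd z) v)" unfolding p by (rule has_weak_integralD(2)[OF T])
  show "ip (karcher_drift \<mu> X v) v = (\<integral>z. perspective (fst z) X (snd z) v \<partial>\<mu>)"
    unfolding p has_weak_integralD(3)[OF T] K using sa_ip[OF sq(2)] by simp
  show "karcher_equation \<mu> X \<longleftrightarrow> karcher_drift \<mu> X = 0"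
  proof
    assume "karcher_equation \<mu> X"
    then have Z: "has_weak_integral \<mu> (normalized_calculus X) 0" by (simp add: karcher_equation_iff)
    have "T x = 0" for x
      by (rule ip_eqI) (metis has_weak_integralD(3)[OF T] has_weak_integralD(3)[OF Z] blinfun.zero_left)
    then show "karcher_drift \<mu> X = 0" unfolding K by (intro blinfun_eqI) (simp add: blinfun.zero_right)
  next
    assume "karcher_drift \<mu> X = 0"
    then have "op_inv_sqrt X ((op_sqrt X o\<^sub>L T o\<^sub>L op_sqrt X) (op_inv_sqrt X x)) = 0" for x
      unfolding K by (simp add: blinfun.zero_right)
    then have "T x = 0" for x by (simp add: sq)
    then have "T = 0" by (intro blinfun_eqI) simp
    with T show "karcher_equation \<mu> X" by (simp add: karcher_equation_iff)
  qed
qed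

end

text \<open>The order of measures with the witnesses exposed. The diagonal coupling of a measure with itself is an instance,
  so existence, uniqueness and monotonicity rest on the same estimates.\<close>

definition coupled_below ::
  "((real \<Rightarrow> real) \<times> ('e::complex_hilbert_space \<Rightarrow>\<^sub>L 'e)) measure \<Rightarrow> ((real \<Rightarrow> real) \<times> ('e \<Rightarrow>\<^sub>L 'e)) measure \<Rightarrow> 'c measure
    \<Rightarrow> ('c \<Rightarrow> (real \<Rightarrow> real) \<times> ('e \<Rightarrow>\<^sub>L 'e)) \<Rightarrow> ('c \<Rightarrow> (real \<Rightarrow> real) \<times> ('e \<Rightarrow>\<^sub>L 'e)) \<Rightarrow> bool" where
  "coupled_below \<mu> \<nu> \<pi> F H \<longleftrightarrow> prob_space \<pi> \<and>
    F \<in> measurable \<pi> (borel_of_topology LP_topology) \<and> H \<in> measurable \<pi> (borel_of_topology LP_topology) \<and>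
    \<mu> = distr \<pi> (borel_of_topology LP_topology) F \<and> \<nu> = distr \<pi> (borel_of_topology LP_topology) H \<and>
    (\<forall>w\<in>space \<pi>. fst (F w) = fst (H w) \<and> snd (F w) \<preceq> snd (H w))"

lemma op_le_refl: "A \<in> self_adjoint_ops \<Longrightarrow> A \<preceq> A"
  by (simp add: op_le_iff)

lemma coupled_below_self:
  assumes \<mu>: "supported_between a b \<mu>"
  shows "coupled_below \<mu> \<mu> \<mu> (\<lambda>z. z) (\<lambda>z. z)"
proof -
  have s: "sets \<mu> = sets (borel_of_topology LP_topology)" "prob_space \<mu>" using \<mu> by (auto simp: supported_between_def)
  have "A \<in> pos_def_ops \<Longrightarrow> A \<preceq> A" for A :: "'a \<Rightarrow>\<^sub>L 'a"
    by (auto simp: pos_def_ops_iff op_between_iff intro: op_le_refl)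
  then show ?thesis
    using s space_supported[OF s(1)] distr_id2[OF s(1)[symmetric]] unfolding coupled_below_def
    by (auto intro: measurable_ident_sets[OF s(1)])
qed

context
  fixes a b :: real and \<mu> \<nu> :: "((real \<Rightarrow> real) \<times> ('e::complex_hilbert_space \<Rightarrow>\<^sub>L 'e)) measure"
    and \<pi> :: "'c measure" and F H
  assumes ab: "0 < a" "a \<le> b" and \<mu>: "supported_between a b \<mu>" and \<nu>: "supported_between a b \<nu>"
    and coupled: "coupled_below \<mu> \<nu> \<pi> F H"
begin

lemma drift_comparison:
  assumes X: "X \<in> op_between a b" and Z: "Z \<in> op_between a b" and c: "1 \<le> c" and XZ: "X \<preceq> c *\<^sub>R Z"
  shows "ip (karcher_drift \<mu> X v) v \<le> c * ip (karcher_drift \<nu> Z v) v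
    - gap_const a b * (c - 1) * (norm v)\<^sup>2 + drift_const a b * norm ((c *\<^sub>R Z - X) v) * norm v"
proof -
  let ?L = "borel_of_topology LP_topology"
  interpret prob_space \<pi> using coupled by (simp add: coupled_below_def)
  have F: "F \<in> measurable \<pi> ?L" and H: "H \<in> measurable \<pi> ?L" and \<mu>F: "\<mu> = distr \<pi> ?L F" and \<nu>H: "\<nu> = distr \<pi> ?L H"
    and FH: "\<And>w. w \<in> space \<pi> \<Longrightarrow> fst (F w) = fst (H w) \<and> snd (F w) \<preceq> snd (H w)"
    using coupled by (auto simp: coupled_below_def)
  let ?P = "\<lambda>Y z. perspective (fst z) Y (snd z) v"
  let ?e = "- gap_const a b * (c - 1) * (norm v)\<^sup>2 + drift_const a b * norm ((c *\<^sub>R Z - X) v) * norm v"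
  have mP: "?P Y \<in> borel_measurable ?L" if "Y \<in> op_between a b" for Y
    using measurable_normalized_calculus[OF op_between_pos_def[OF that ab(1)], of "op_sqrt Y v" "op_sqrt Y v"]
    unfolding perspective_def ip_def
    by (rule measurable_compose[where g = Re]) (intro borel_measurable_continuous_onI continuous_intros)
  have iF: "integrable \<pi> (\<lambda>w. ?P X (F w))"
    using karcher_drift_facts(2)[OF ab \<mu> X, of v] unfolding \<mu>F integrable_distr_eq[OF F mP[OF X]] .
  have iH: "integrable \<pi> (\<lambda>w. ?P Z (H w))"
    using karcher_drift_facts(2)[OF ab \<nu> Z, of v] unfolding \<nu>H integrable_distr_eq[OF H mP[OF Z]] .
  have "AE w in \<pi>. ?P X (F w) \<le> c * ?P Z (H w) + ?e"
  proof -
    have "AE w in \<pi>. fst (F w) \<in> op_mono_funs \<and> snd (F w) \<in> op_between a b"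
      using AE_supported[OF \<mu>] unfolding \<mu>F by (rule AE_distrD[OF F])
    moreover have "AE w in \<pi>. fst (H w) \<in> op_mono_funs \<and> snd (H w) \<in> op_between a b"
      using AE_supported[OF \<nu>] unfolding \<nu>H by (rule AE_distrD[OF H])
    moreover have "AE w in \<pi>. w \<in> space \<pi>" by (rule AE_space)
    ultimately show ?thesis
    proof eventually_elim
      case (elim w)
      then show ?case
        using comparison_op_mono[OF _ ab X Z _ _ _ c XZ, of "fst (F w)" "snd (F w)" "snd (H w)" v] FH[of w] by simp
    qed
  qed
  then have "(\<integral>w. ?P X (F w) \<partial>\<pi>) \<le> (\<integral>w. c * ?P Z (H w) + ?e \<partial>\<pi>)"
    using iF iH by (intro integral_mono_AE) auto
  also have "\<dots> = c * (\<integral>w. ?P Z (H w) \<partial>\<pi>) + ?e" using iH by (simp add: prob_space)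
  also have "(\<integral>w. ?P Z (H w) \<partial>\<pi>) = ip (karcher_drift \<nu> Z v) v"
    using karcher_drift_facts(3)[OF ab \<nu> Z, of v] integral_distr[OF H mP[OF Z]] unfolding \<nu>H[symmetric] by simp
  also have "(\<integral>w. ?P X (F w) \<partial>\<pi>) = ip (karcher_drift \<mu> X v) v"
    using karcher_drift_facts(3)[OF ab \<mu> X, of v] integral_distr[OF F mP[OF X]] unfolding \<mu>F[symmetric] by simp
  finally show ?thesis by simp
qed

text \<open>One Euler step \<open>X + h G(X)\<close> almost preserves \<open>X \<preceq> c Z\<close>. The drift may fail to be monotone by
  \<open>h K \<parallel>D v\<parallel> \<parallel>v\<parallel>\<close> with \<open>D = c Z - X\<close>, but \<open>\<parallel>D v\<parallel>\<^sup>2 \<le> d \<langle>D v, v\<rangle>\<close> lets the term \<open>- \<langle>D v, v\<rangle>\<close> absorb it up to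
  \<open>h\<^sup>2 K\<^sup>2 d / 4\<close>. This error is of second order in \<open>h\<close>, whereas the gain \<open>h (c - 1)\<close> times the gap constant is of
  first order.\<close>

lemma euler_comparison:
  assumes X: "X \<in> op_between a b" and Z: "Z \<in> op_between a b" and c: "1 \<le> c" and XZ: "X \<preceq> c *\<^sub>R Z"
    and h: "0 \<le> h" and d: "\<And>v. c * ip (Z v) v - ip (X v) v \<le> d * (norm v)\<^sup>2"
  shows "ip (X v) v + h * ip (karcher_drift \<mu> X v) v \<le> c * (ip (Z v) v + h * ip (karcher_drift \<nu> Z v) v)
    + (h\<^sup>2 * (drift_const a b)\<^sup>2 * d / 4 - h * gap_const a b * (c - 1)) * (norm v)\<^sup>2"
proof -
  let ?K = "drift_const a b" and ?D = "c *\<^sub>R Z - X"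
  have D: "?D \<in> self_adjoint_ops" using op_betweenD(1)[OF X] op_betweenD(1)[OF Z] by simp
  have Dip: "ip (?D u) u = c * ip (Z u) u - ip (X u) u" for u
    by (simp add: blinfun.diff_left blinfun.scaleR_left ip_simps)
  have D0: "0 \<le> ip (?D u) u" for u using XZ unfolding Dip op_le_iff by (simp add: blinfun.scaleR_left ip_simps)
  have Dd: "ip (?D u) u \<le> d * (norm u)\<^sup>2" for u unfolding Dip by (rule d)
  define y where "y = norm (?D v)"
  have yd: "y\<^sup>2 \<le> d * ip (?D v) v" unfolding y_def by (rule psd_norm_square_le[OF D D0 Dd])
  have main: "h * ?K * y * norm v - ip (?D v) v \<le> h\<^sup>2 * ?K\<^sup>2 * d / 4 * (norm v)\<^sup>2"
  proof (cases "0 < d")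
    case True
    \<comment> \<open>Completing the square, after multiplication by \<open>d\<close>.\<close>
    have "0 \<le> (y - h * ?K * d * norm v / 2)\<^sup>2" by simp
    also have "\<dots> = y\<^sup>2 - d * (h * ?K * y * norm v) + d * (h\<^sup>2 * ?K\<^sup>2 * d / 4 * (norm v)\<^sup>2)"
      by (simp add: power2_eq_square algebra_simps)
    also have "\<dots> \<le> d * ip (?D v) v - d * (h * ?K * y * norm v) + d * (h\<^sup>2 * ?K\<^sup>2 * d / 4 * (norm v)\<^sup>2)"
      using yd by simp
    also have "\<dots> = d * (ip (?D v) v - h * ?K * y * norm v + h\<^sup>2 * ?K\<^sup>2 * d / 4 * (norm v)\<^sup>2)"
      by (simp add: algebra_simps)
    finally show ?thesis using True by (simp add: zero_le_mult_iff)
  next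
    case False
    then have "d * (norm v)\<^sup>2 \<le> 0" by (intro mult_nonpos_nonneg) auto
    then have z: "ip (?D v) v = 0" "d * (norm v)\<^sup>2 = 0" using D0[of v] Dd[of v] by linarith+
    then have y: "y = 0" using yd by simp
    have e: "h\<^sup>2 * ?K\<^sup>2 * d / 4 * (norm v)\<^sup>2 = h\<^sup>2 * ?K\<^sup>2 / 4 * (d * (norm v)\<^sup>2)" by simp
    show ?thesis unfolding e z y by simp
  qed
  have "h * ip (karcher_drift \<mu> X v) v \<le> h * (c * ip (karcher_drift \<nu> Z v) v - gap_const a b * (c - 1) * (norm v)\<^sup>2 + ?K * y * norm v)"
    unfolding y_def using h by (intro mult_left_mono drift_comparison X Z c XZ)
  then show ?thesis using main unfolding Dip by (simp add: algebra_simps)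
qed

end

lemma op_between_form_nonneg:
  assumes "X \<in> op_between a b" "0 < a"
  shows "0 \<le> ip (X v) v"
proof -
  have "0 \<le> a * (norm v)\<^sup>2" using assms(2) by simp
  also have "\<dots> \<le> ip (X v) v" by (rule op_betweenD(2)[OF assms(1)])
  finally show ?thesis .
qed

lemma gap_drift_const_bounds:
  assumes "0 < a" "a \<le> b"
  shows "0 < gap_const a b" "gap_const a b \<le> a" "1 \<le> drift_const a b"
proof -
  have l: "0 < a / b" "a / b \<le> 1" using assms by auto
  then show "0 < gap_const a b" using assms by (simp add: gap_const_def)
  have "(a / b) ^ 3 \<le> 1" using l by (intro power_le_one) auto
  then show "gap_const a b \<le> a" using assms mult_left_mono[of "(a / b) ^ 3" 1 a] by (simp add: gap_const_def)
  show "1 \<le> drift_const a b" using assms by (simp add: drift_const_def)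
qed

text \<open>Let \<open>c \<ge> 1\<close> be minimal with \<open>X \<preceq> c Y\<close>. Both solutions are fixed by every Euler step. If \<open>c > 1\<close>, a step
  with small \<open>h\<close> gains a multiple of the identity in this inequality, so \<open>c\<close> was not minimal.\<close>

lemma solution_comparison:
  fixes \<mu> \<nu> :: "((real \<Rightarrow> real) \<times> ('e::complex_hilbert_space \<Rightarrow>\<^sub>L 'e)) measure"
  assumes ab: "0 < a" "a \<le> b" and \<mu>: "supported_between a b \<mu>" and \<nu>: "supported_between a b \<nu>"
    and coupled: "coupled_below \<mu> \<nu> \<pi> F H"
    and X: "X \<in> op_between a b" "karcher_equation \<mu> X" and Y: "Y \<in> op_between a b" "karcher_equation \<nu> Y"
  shows "X \<preceq> Y"
proof -
  have b: "0 < b" using ab by simp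
  have dX: "karcher_drift \<mu> X = 0" using karcher_drift_facts(4)[OF ab \<mu> X(1)] X(2) by simp
  have dY: "karcher_drift \<nu> Y = 0" using karcher_drift_facts(4)[OF ab \<nu> Y(1)] Y(2) by simp
  note saX = op_betweenD(1)[OF X(1)] and saY = op_betweenD(1)[OF Y(1)]
  have Ypos: "0 \<le> ip (Y v) v" for v
    by (rule op_between_form_nonneg[OF Y(1) ab(1)])
  have le_iff: "X \<preceq> c *\<^sub>R Y \<longleftrightarrow> (\<forall>v. ip (X v) v \<le> c * ip (Y v) v)" for c
    using saX saY by (auto simp: op_le_iff blinfun.scaleR_left ip_simps)
  define C where "C = {c. 1 \<le> c \<and> X \<preceq> c *\<^sub>R Y}"
  have "b / a \<in> C"
    unfolding C_def le_iff
  proof (intro CollectI conjI allI)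
    show "1 \<le> b / a" using ab by simp
    fix v
    have "ip (X v) v \<le> b * (norm v)\<^sup>2" by (rule op_betweenD(3)[OF X(1)])
    also have "\<dots> = b / a * (a * (norm v)\<^sup>2)" using ab by simp
    also have "\<dots> \<le> b / a * ip (Y v) v" using ab by (intro mult_left_mono op_betweenD(2)[OF Y(1)]) auto
    finally show "ip (X v) v \<le> b / a * ip (Y v) v" .
  qed
  then have ne: "C \<noteq> {}" by blast
  have bdd: "bdd_below C" by (intro bdd_belowI[of _ 1]) (simp add: C_def)
  define c where "c = Inf C"
  have c1: "1 \<le> c" unfolding c_def by (rule cInf_greatest[OF ne]) (simp add: C_def)
  have Xc: "ip (X v) v \<le> c * ip (Y v) v" for v
  proof (rule ccontr)
    assume *: "\<not> ?thesis"
    then have "0 < ip (Y v) v"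
    proof -
      have "ip (X v) v \<le> b / a * ip (Y v) v" using \<open>b / a \<in> C\<close> by (simp add: C_def le_iff)
      then show ?thesis using * Ypos[of v] by (cases "ip (Y v) v = 0") auto
    qed
    then have "c < ip (X v) v / ip (Y v) v" using * by (simp add: less_divide_eq)
    then obtain c' where c': "c' \<in> C" "c' < ip (X v) v / ip (Y v) v" unfolding c_def using cInf_lessD[OF ne] by blast
    then have "ip (X v) v \<le> c' * ip (Y v) v" by (simp add: C_def le_iff)
    then show False using c'(2) \<open>0 < ip (Y v) v\<close> by (simp add: less_divide_eq)
  qed
  have "c = 1"
  proof (rule ccontr)
    assume "c \<noteq> 1"
    then have c: "1 < c" using c1 by simp
    let ?K = "drift_const a b" and ?g = "gap_const a b"
    note kp = gap_drift_const_bounds[OF ab]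
    \<comment> \<open>This \<open>h\<close> makes the second order error half of the first order gain; \<open>c b\<close> bounds \<open>c Y - X\<close>.\<close>
    define h where "h = 2 * ?g * (c - 1) / (?K\<^sup>2 * (c * b))"
    have den: "0 < ?K\<^sup>2 * (c * b)" using kp c b by (intro mult_pos_pos zero_less_power) auto
    have h: "0 < h" using kp c den by (simp add: h_def)
    define \<eta> where "\<eta> = h * ?g * (c - 1) / 2"
    have \<eta>: "0 < \<eta>" using h kp c by (simp add: \<eta>_def)
    have coef: "h\<^sup>2 * ?K\<^sup>2 * (c * b) / 4 - h * ?g * (c - 1) = - \<eta>"
    proof -
      have "?K\<^sup>2 * (c * b) \<noteq> 0" using den by (rule less_imp_neq[symmetric])
      from iffD1[OF nonzero_eq_divide_eq[OF this] h_def] have "h * (?K\<^sup>2 * (c * b)) = 2 * ?g * (c - 1)" .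
      have "h\<^sup>2 * ?K\<^sup>2 * (c * b) = h * (h * (?K\<^sup>2 * (c * b)))" by (simp only: power2_eq_square mult.assoc)
      also have "\<dots> = 2 * (h * ?g * (c - 1))"
        unfolding \<open>h * (?K\<^sup>2 * (c * b)) = 2 * ?g * (c - 1)\<close> by simp
      finally have e: "h\<^sup>2 * ?K\<^sup>2 * (c * b) = 2 * (h * ?g * (c - 1))" .
      show ?thesis unfolding \<eta>_def e by simp
    qed
    have "ip (X v) v \<le> (c - \<eta> / b) * ip (Y v) v" for v
    proof -
      have d: "c * ip (Y u) u - ip (X u) u \<le> (c * b) * (norm u)\<^sup>2" for u
      proof -
        have "c * ip (Y u) u \<le> c * (b * (norm u)\<^sup>2)" using c by (intro mult_left_mono op_betweenD(3)[OF Y(1)]) auto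
        moreover have "0 \<le> ip (X u) u"
          by (rule op_between_form_nonneg[OF X(1) ab(1)])
        ultimately show ?thesis by simp
      qed
      have "X \<preceq> c *\<^sub>R Y" using Xc le_iff by blast
      from euler_comparison[OF ab \<mu> \<nu> coupled X(1) Y(1) c1 this less_imp_le[OF h] d, of v]
      have "ip (X v) v \<le> c * ip (Y v) v - \<eta> * (norm v)\<^sup>2" unfolding dX dY coef by (simp add: blinfun.zero_left)
      moreover have "\<eta> / b * ip (Y v) v \<le> \<eta> / b * (b * (norm v)\<^sup>2)"
        using \<eta> b by (intro mult_left_mono op_betweenD(3)[OF Y(1)]) auto
      ultimately show ?thesis using b by (simp add: left_diff_distrib)
    qed
    moreover have "(c - \<eta> / b) * ip (Y v) v \<le> max 1 (c - \<eta> / b) * ip (Y v) v" for v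
      using Ypos by (intro mult_right_mono) auto
    ultimately have "ip (X v) v \<le> max 1 (c - \<eta> / b) * ip (Y v) v" for v by (rule order.trans)
    then have "max 1 (c - \<eta> / b) \<in> C" unfolding C_def le_iff by simp
    then have "c \<le> max 1 (c - \<eta> / b)" unfolding c_def by (rule cInf_lower[OF _ bdd])
    moreover have "0 < \<eta> / b" using \<eta> b by simp
    ultimately show False using c by (simp add: max_def split: if_splits)
  qed
  then show ?thesis using Xc saX saY by (simp add: op_le_iff)
qed

lemma op_between_limit:
  assumes X: "\<And>n. X n \<in> op_between a b" and lim: "X \<longlonglongrightarrow> Y"
  shows "Y \<in> op_between a b"
  unfolding op_between_iff
proof (intro conjI allI)
  show "Y \<in> self_adjoint_ops" by (rule sa_limit[OF op_betweenD(1)[OF X] lim])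
  fix v
  have l: "(\<lambda>n. ip (X n v) v) \<longlonglongrightarrow> ip (Y v) v" by (intro tendsto_ip blinfun.tendsto lim tendsto_const)
  show "a * (norm v)\<^sup>2 \<le> ip (Y v) v" by (rule LIMSEQ_le_const[OF l]) (use op_betweenD(2)[OF X] in blast)
  show "ip (Y v) v \<le> b * (norm v)\<^sup>2" by (rule LIMSEQ_le_const2[OF l]) (use op_betweenD(3)[OF X] in blast)
qed

lemma scaled_id_between: "a \<le> c \<Longrightarrow> c \<le> b \<Longrightarrow> c *\<^sub>R id_blinfun \<in> op_between a b"
  by (auto simp: op_between_iff blinfun.scaleR_left ip_simps ip_self intro: mult_right_mono)

text \<open>On the order interval from \<open>a\<^sub>0 / 2\<close> to \<open>2 b\<^sub>0\<close> the Euler map \<open>E X = X + h G(X)\<close> is, for a suitable small \<open>h\<close>, a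
  self-map and a strict contraction for the distance that is the least \<open>\<epsilon>\<close> with \<open>X \<preceq> (1 + \<epsilon>) Y\<close> and
  \<open>Y \<preceq> (1 + \<epsilon>) X\<close>, a version of the Thompson metric that is equivalent to the norm distance there. The limit of its
  iterates is a zero of \<open>G\<close>.\<close>

lemma karcher_solution_exists:
  fixes \<mu> :: "((real \<Rightarrow> real) \<times> ('e::complex_hilbert_space \<Rightarrow>\<^sub>L 'e)) measure"
  assumes ab0: "0 < a0" "a0 \<le> b0" and \<mu>0: "supported_between a0 b0 \<mu>"
  shows "\<exists>X. X \<in> pos_def_ops \<and> karcher_equation \<mu> X"
proof -
  define a where "a = a0 / 2"
  define b where "b = 2 * b0"
  have ab: "0 < a" "a \<le> b" "a \<le> a0" "b0 \<le> b" using ab0 by (auto simp: a_def b_def)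
  have b: "0 < b" using ab by simp
  have \<mu>: "supported_between a b \<mu>" by (rule supported_between_mono[OF \<mu>0 ab(3,4)])
  note self = coupled_below_self[OF \<mu>]
  let ?K = "drift_const a b" and ?g = "gap_const a b"
  note kp = gap_drift_const_bounds[OF ab(1,2)]
  define h where "h = ?g / (?K\<^sup>2 * b)"
  have den: "0 < ?K\<^sup>2 * b" using kp b by (intro mult_pos_pos zero_less_power) auto
  have h: "0 < h" using kp den by (simp add: h_def)
  have hK: "h\<^sup>2 * ?K\<^sup>2 * (t * b) / 4 = h * ?g * (t / 4)" for t
  proof -
    have "?K\<^sup>2 * b \<noteq> 0" using den by (rule less_imp_neq[symmetric])
    from iffD1[OF nonzero_eq_divide_eq[OF this] h_def] have hg: "h * (?K\<^sup>2 * b) = ?g" .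
    have "h\<^sup>2 * ?K\<^sup>2 * (t * b) / 4 = h * (h * (?K\<^sup>2 * b)) * (t / 4)" by (simp add: power2_eq_square ac_simps)
    then show ?thesis unfolding hg .
  qed
  define E where "E X = X + h *\<^sub>R karcher_drift \<mu> X" for X
  have Eip: "ip (E X v) v = ip (X v) v + h * ip (karcher_drift \<mu> X v) v" for X v
    by (simp add: E_def blinfun.add_left blinfun.scaleR_left ip_simps)
  have saE: "E X \<in> self_adjoint_ops" if "X \<in> op_between a b" for X
    unfolding E_def using op_betweenD(1)[OF that] karcher_drift_facts(1)[OF ab(1,2) \<mu> that] by simp
  note euler = euler_comparison[OF ab(1,2) \<mu> \<mu> self _ _ _ _ less_imp_le[OF h], folded Eip]
  let ?A = "a0 *\<^sub>R id_blinfun :: 'e \<Rightarrow>\<^sub>L 'e" and ?B = "b0 *\<^sub>R id_blinfun :: 'e \<Rightarrow>\<^sub>L 'e"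
  have A: "?A \<in> op_between a b" and B: "?B \<in> op_between a b" using ab ab0 by (auto intro!: scaled_id_between simp: b_def)
  have ipc: "ip ((c *\<^sub>R id_blinfun :: 'e \<Rightarrow>\<^sub>L 'e) v) v = c * (norm v)\<^sup>2" for c v
    by (simp add: blinfun.scaleR_left ip_simps ip_self)
  have driftA: "0 \<le> ip (karcher_drift \<mu> ?A v) v" for v
  proof -
    have "AE z in \<mu>. 0 \<le> perspective (fst z) ?A (snd z) v"
      using AE_supported[OF \<mu>0] AE_supported[OF \<mu>]
    proof eventually_elim
      case (elim z)
      then have "?A \<preceq> snd z" by (simp add: op_between_def)
      then show ?case using perspective_sign(2)[OF _ A _ ab(1,2)] elim by blast
    qed
    then show ?thesis unfolding karcher_drift_facts(3)[OF ab(1,2) \<mu> A] by (rule integral_nonneg_AE)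
  qed
  have driftB: "ip (karcher_drift \<mu> ?B v) v \<le> 0" for v
  proof -
    have "AE z in \<mu>. 0 \<le> - perspective (fst z) ?B (snd z) v"
      using AE_supported[OF \<mu>0] AE_supported[OF \<mu>]
    proof eventually_elim
      case (elim z)
      then have "snd z \<preceq> ?B" by (simp add: op_between_def)
      then show ?case using perspective_sign(1)[OF _ B _ ab(1,2)] elim by simp
    qed
    then have "0 \<le> (\<integral>z. - perspective (fst z) ?B (snd z) v \<partial>\<mu>)" by (rule integral_nonneg_AE)
    then show ?thesis unfolding karcher_drift_facts(3)[OF ab(1,2) \<mu> B] by simp
  qed
  \<comment> \<open>Comparison with \<open>c = 2\<close> against \<open>b\<^sub>0 I\<close> from above and \<open>a\<^sub>0 I\<close> from below, where the drift has a sign.\<close>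
  have inv: "E X \<in> op_between a b" if X: "X \<in> op_between a b" for X
    unfolding op_between_iff
  proof (intro conjI allI saE[OF X])
    fix v
    have XB: "X \<preceq> 2 *\<^sub>R ?B"
      unfolding op_le_iff using op_betweenD[OF X] by (simp add: ipc b_def)
    have "2 * ip (?B u) u - ip (X u) u \<le> (1 * b) * (norm u)\<^sup>2" for u
    proof -
      have "0 \<le> a * (norm u)\<^sup>2" using ab by simp
      then show ?thesis using op_betweenD(2)[OF X, of u] by (simp add: ipc b_def)
    qed
    from euler[OF X B _ XB this, of v] have "ip (E X v) v \<le> 2 * ip (E ?B v) v - h * ?g * (3 / 4) * (norm v)\<^sup>2"
      unfolding hK by (simp add: algebra_simps)
    also have "\<dots> \<le> 2 * ip (E ?B v) v" using h kp by simp
    also have "\<dots> \<le> 2 * (b0 * (norm v)\<^sup>2)" unfolding Eip[of ?B] ipc using driftB[of v] h by (simp add: mult_nonneg_nonpos)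
    finally show "ip (E X v) v \<le> b * (norm v)\<^sup>2" by (simp add: b_def)
    have AX: "?A \<preceq> 2 *\<^sub>R X"
      unfolding op_le_iff using op_betweenD[OF X] by (auto simp: ipc a_def blinfun.scaleR_left ip_simps ip_self mult.commute)
    have "2 * ip (X u) u - ip (?A u) u \<le> (2 * b) * (norm u)\<^sup>2" for u
    proof -
      have "0 \<le> a0 * (norm u)\<^sup>2" using ab0 by simp
      then show ?thesis using op_betweenD(3)[OF X, of u] by (simp add: ipc)
    qed
    from euler[OF A X _ AX this, of v] have "ip (E ?A v) v \<le> 2 * ip (E X v) v - h * ?g * (1 / 2) * (norm v)\<^sup>2"
      unfolding hK by (simp add: algebra_simps)
    also have "\<dots> \<le> 2 * ip (E X v) v" using h kp by simp
    finally have "ip (E ?A v) v \<le> 2 * ip (E X v) v" .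
    moreover have "a0 * (norm v)\<^sup>2 \<le> ip (E ?A v) v" unfolding Eip[of ?A] ipc using driftA[of v] h by simp
    ultimately show "a * (norm v)\<^sup>2 \<le> ip (E X v) v" by (simp add: a_def)
  qed
  define close where "close \<epsilon> X Y \<longleftrightarrow> (\<forall>v. ip (X v) v \<le> (1 + \<epsilon>) * ip (Y v) v \<and> ip (Y v) v \<le> (1 + \<epsilon>) * ip (X v) v)"
    for \<epsilon> and X Y :: "'e \<Rightarrow>\<^sub>L 'e"
  have pos: "0 \<le> ip (X v) v" if "X \<in> op_between a b" for X :: "'e \<Rightarrow>\<^sub>L 'e" and v
    by (rule op_between_form_nonneg[OF that ab(1)])
  define q where "q = 1 - h * ?g / (2 * b)"
  have q: "0 \<le> q" "q < 1"
  proof -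
    show "q < 1" using h kp b by (simp add: q_def)
    have "h * b \<le> ?g"
    proof -
      have "1 \<le> ?K\<^sup>2" using kp(3) by (simp add: one_le_power)
      then have "h * b * 1 \<le> h * b * ?K\<^sup>2" using h b by (intro mult_left_mono) auto
      also have "h * b * ?K\<^sup>2 = ?g"
      proof -
        have "?K\<^sup>2 * b \<noteq> 0" using den by (rule less_imp_neq[symmetric])
        from iffD1[OF nonzero_eq_divide_eq[OF this] h_def] have "h * (?K\<^sup>2 * b) = ?g" .
        then show ?thesis by (simp add: ac_simps)
      qed
      finally show ?thesis by simp
    qed
    also have "\<dots> \<le> b" using kp(2) ab(2) by simp
    finally have "h \<le> 1" using b by simp
    then have "h * ?g \<le> 1 * b" using kp ab h by (intro mult_mono) auto
    then show "0 \<le> q" using b by (simp add: q_def divide_le_eq)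
  qed
  have half: "ip (E X v) v \<le> (1 + q * \<epsilon>) * ip (E Y v) v"
    if X: "X \<in> op_between a b" and Y: "Y \<in> op_between a b" and \<epsilon>: "0 \<le> \<epsilon>"
      and XY: "\<And>u. ip (X u) u \<le> (1 + \<epsilon>) * ip (Y u) u" and YX: "\<And>u. ip (Y u) u \<le> (1 + \<epsilon>) * ip (X u) u"
    for X Y \<epsilon> v
  proof -
    have XY': "X \<preceq> (1 + \<epsilon>) *\<^sub>R Y"
      unfolding op_le_iff using XY op_betweenD(1)[OF X] op_betweenD(1)[OF Y] by (simp add: blinfun.scaleR_left ip_simps)
    \<comment> \<open>The difference is of order \<open>\<epsilon>\<close> because \<open>X\<close> is bounded by \<open>Y\<close> from both sides; so the error is \<open>O(h\<^sup>2 \<epsilon>)\<close> against a gain \<open>O(h \<epsilon>)\<close>.\<close>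
    have d: "(1 + \<epsilon>) * ip (Y u) u - ip (X u) u \<le> (2 * \<epsilon> * b) * (norm u)\<^sup>2" for u
    proof -
      have "(1 - \<epsilon>) * ip (Y u) u \<le> ip (Y u) u / (1 + \<epsilon>)"
      proof -
        have "(1 - \<epsilon>) * (1 + \<epsilon>) \<le> 1" by (simp add: algebra_simps)
        then have "(1 - \<epsilon>) * (1 + \<epsilon>) * ip (Y u) u \<le> 1 * ip (Y u) u" by (intro mult_right_mono pos[OF Y])
        then show ?thesis using \<epsilon> by (simp add: le_divide_eq ac_simps)
      qed
      also have "\<dots> \<le> ip (X u) u" using YX[of u] \<epsilon> by (simp add: divide_le_eq ac_simps)
      finally have "(1 + \<epsilon>) * ip (Y u) u - ip (X u) u \<le> 2 * \<epsilon> * ip (Y u) u" by (simp add: algebra_simps)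
      also have "\<dots> \<le> 2 * \<epsilon> * (b * (norm u)\<^sup>2)" using \<epsilon> by (intro mult_left_mono op_betweenD(3)[OF Y]) auto
      finally show ?thesis by (simp add: mult.assoc)
    qed
    have "1 \<le> 1 + \<epsilon>" using \<epsilon> by simp
    from euler[OF X Y this XY' d, of v] have "ip (E X v) v \<le> (1 + \<epsilon>) * ip (E Y v) v - h * ?g * \<epsilon> / 2 * (norm v)\<^sup>2"
      unfolding hK by (simp add: algebra_simps)
    moreover have "h * ?g * \<epsilon> / (2 * b) * ip (E Y v) v \<le> h * ?g * \<epsilon> / (2 * b) * (b * (norm v)\<^sup>2)"
      using h kp \<epsilon> b by (intro mult_left_mono op_betweenD(3)[OF inv[OF Y]]) auto
    moreover have "h * ?g * \<epsilon> / (2 * b) * (b * (norm v)\<^sup>2) = h * ?g * \<epsilon> / 2 * (norm v)\<^sup>2" using b by simp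
    moreover have "(1 + q * \<epsilon>) * ip (E Y v) v = (1 + \<epsilon>) * ip (E Y v) v - h * ?g * \<epsilon> / (2 * b) * ip (E Y v) v"
      by (simp add: q_def algebra_simps)
    ultimately show ?thesis by linarith
  qed
  have contr: "close (q * \<epsilon>) (E X) (E Y)"
    if "X \<in> op_between a b" "Y \<in> op_between a b" "0 \<le> \<epsilon>" "close \<epsilon> X Y" for X Y \<epsilon>
    using that half unfolding close_def by blast
  have close_norm: "norm (X - Y) \<le> \<epsilon> * b"
    if X: "X \<in> op_between a b" and Y: "Y \<in> op_between a b" and \<epsilon>: "0 \<le> \<epsilon>" and cl: "close \<epsilon> X Y" for X Y \<epsilon>
  proof (rule sa_norm_le)
    show "X - Y \<in> self_adjoint_ops" using op_betweenD(1) X Y by (intro sa_diff) auto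
    show "0 \<le> \<epsilon> * b" using \<epsilon> b by simp
    fix v
    have "\<epsilon> * ip (Y v) v \<le> \<epsilon> * (b * (norm v)\<^sup>2)" "\<epsilon> * ip (X v) v \<le> \<epsilon> * (b * (norm v)\<^sup>2)"
      using \<epsilon> op_betweenD(3) X Y by (auto intro!: mult_left_mono)
    moreover have "ip (X v) v \<le> (1 + \<epsilon>) * ip (Y v) v" "ip (Y v) v \<le> (1 + \<epsilon>) * ip (X v) v"
      using cl by (auto simp: close_def)
    ultimately show "\<bar>ip ((X - Y) v) v\<bar> \<le> \<epsilon> * b * (norm v)\<^sup>2"
      by (simp add: blinfun.diff_left ip_simps algebra_simps abs_le_iff)
  qed
  have norm_close: "close (norm (X - Y) / a) X Y"
    if X: "X \<in> op_between a b" and Y: "Y \<in> op_between a b" for X Y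
  proof -
    have "ip (X v) v \<le> (1 + norm (X - Y) / a) * ip (Y v) v"
      if X: "X \<in> op_between a b" and Y: "Y \<in> op_between a b" for X Y :: "'e \<Rightarrow>\<^sub>L 'e" and v
    proof -
      have "ip ((X - Y) v) v \<le> norm ((X - Y) v) * norm v" using ip_cauchy_schwarz by (rule order.trans[OF abs_ge_self])
      also have "\<dots> \<le> (norm (X - Y) * norm v) * norm v" by (intro mult_right_mono norm_blinfun) auto
      also have "\<dots> = norm (X - Y) / a * (a * (norm v)\<^sup>2)" using ab by (simp add: power2_eq_square)
      also have "\<dots> \<le> norm (X - Y) / a * ip (Y v) v" using ab by (intro mult_left_mono op_betweenD(2)[OF Y]) auto
      finally show ?thesis by (simp add: blinfun.diff_left ip_simps algebra_simps)
    qed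
    from this[OF X Y] this[OF Y X] show ?thesis unfolding close_def by (simp add: norm_minus_commute)
  qed
  define S where "S n = (E ^^ n) ?A" for n
  have S0: "S 0 = ?A" and SS: "S (Suc n) = E (S n)" for n by (simp_all add: S_def)
  have Sb: "S n \<in> op_between a b" for n
    by (induction n) (simp_all add: S0 SS A inv)
  define \<epsilon>0 where "\<epsilon>0 = norm (S 0 - S 1) / a"
  have \<epsilon>0: "0 \<le> \<epsilon>0" using ab by (simp add: \<epsilon>0_def)
  have Sclose: "close (q ^ n * \<epsilon>0) (S n) (S (Suc n))" for n
  proof (induction n)
    case 0
    show ?case using norm_close[OF Sb[of 0] Sb[of 1]] by (simp add: \<epsilon>0_def)
  next
    case (Suc n)
    have "close (q * (q ^ n * \<epsilon>0)) (E (S n)) (E (S (Suc n)))"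
      by (rule contr[OF Sb Sb _ Suc]) (use q \<epsilon>0 in simp)
    then show ?case by (simp add: SS mult.assoc)
  qed
  have "norm (S (Suc n) - S n) \<le> \<epsilon>0 * b * q ^ n" for n
    using close_norm[OF Sb Sb _ Sclose[of n]] q \<epsilon>0 by (simp add: norm_minus_commute ac_simps)
  moreover have "summable (\<lambda>n. \<epsilon>0 * b * q ^ n)"
    using q by (intro summable_mult summable_geometric) simp
  ultimately have "summable (\<lambda>n. S (Suc n) - S n)"
    by (intro summable_comparison_test'[of "\<lambda>n. \<epsilon>0 * b * q ^ n" 0 "\<lambda>n. S (Suc n) - S n"])
  then have "convergent (\<lambda>n. \<Sum>i<n. S (Suc i) - S i)" by (simp add: summable_iff_convergent)
  then have "convergent (\<lambda>n. S n - S 0)" by (simp add: sum_lessThan_telescope)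
  then obtain L where "(\<lambda>n. S n - S 0) \<longlonglongrightarrow> L" by (auto simp: convergent_def)
  then have "(\<lambda>n. (S n - S 0) + S 0) \<longlonglongrightarrow> L + S 0" by (intro tendsto_add tendsto_const)
  then obtain X where X: "S \<longlonglongrightarrow> X" by auto
  have Xb: "X \<in> op_between a b" by (rule op_between_limit[OF Sb X])
  have "(\<lambda>n. E (S n)) \<longlonglongrightarrow> E X"
  proof -
    have "norm (E (S n) - E X) \<le> norm (S n - X) * (q / a * b)" for n
    proof -
      have "close (q * (norm (S n - X) / a)) (E (S n)) (E X)"
        by (rule contr[OF Sb Xb _ norm_close[OF Sb Xb]]) (use ab in simp)
      from close_norm[OF inv[OF Sb] inv[OF Xb] _ this] q ab show ?thesis by (simp add: ac_simps)
    qed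
    moreover have "(\<lambda>n. norm (S n - X) * (q / a * b)) \<longlonglongrightarrow> 0 * (q / a * b)"
      by (intro tendsto_mult tendsto_const tendsto_norm_zero) (use X LIM_zero in blast)
    ultimately have "(\<lambda>n. E (S n) - E X) \<longlonglongrightarrow> 0"
      by (intro Lim_null_comparison[of "\<lambda>n. E (S n) - E X"]) auto
    then show ?thesis by (simp add: LIM_zero_iff)
  qed
  moreover have "(\<lambda>n. E (S n)) \<longlonglongrightarrow> X" using LIMSEQ_Suc[OF X] by (simp add: SS)
  ultimately have "E X = X" using LIMSEQ_unique by blast
  then have "karcher_drift \<mu> X = 0" using h by (simp add: E_def)
  then have "karcher_equation \<mu> X" using karcher_drift_facts(4)[OF ab(1,2) \<mu> Xb] by simp
  then show ?thesis using op_between_pos_def[OF Xb ab(1)] by blast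
qed

lemma common_bounds:
  assumes "X \<in> pos_def_ops" "Y \<in> pos_def_ops" "\<mu> \<in> bdd_prob_measures" "\<nu> \<in> bdd_prob_measures"
  obtains a b where "0 < a" "a \<le> b" "X \<in> op_between a b" "Y \<in> op_between a b"
    "supported_between a b \<mu>" "supported_between a b \<nu>"
proof -
  obtain a1 b1 where 1: "0 < a1" "X \<in> op_between a1 b1" using assms(1) by (auto simp: pos_def_ops_iff)
  obtain a2 b2 where 2: "0 < a2" "Y \<in> op_between a2 b2" using assms(2) by (auto simp: pos_def_ops_iff)
  obtain r where r: "0 \<le> r" "supported_between (exp (- r)) (exp r) \<mu>" using bdd_prob_measures_supported[OF assms(3)] by blast
  obtain s where s: "0 \<le> s" "supported_between (exp (- s)) (exp s) \<nu>" using bdd_prob_measures_supported[OF assms(4)] by blast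
  define a where "a = min (min a1 a2) (min (exp (- r)) (exp (- s)))"
  define b where "b = max (max b1 b2) (max (exp r) (exp s))"
  show ?thesis
  proof (rule that[of a b])
    show "0 < a" using 1 2 by (simp add: a_def)
    have "a \<le> exp (- r)" "exp r \<le> b" "exp (- r) \<le> exp r" using r by (auto simp: a_def b_def)
    then show "a \<le> b" by linarith
    show "X \<in> op_between a b" by (rule op_between_mono[OF 1(2)]) (auto simp: a_def b_def)
    show "Y \<in> op_between a b" by (rule op_between_mono[OF 2(2)]) (auto simp: a_def b_def)
    show "supported_between a b \<mu>" by (rule supported_between_mono[OF r(2)]) (auto simp: a_def b_def)
    show "supported_between a b \<nu>" by (rule supported_between_mono[OF s(2)]) (auto simp: a_def b_def)
  qed
qed

lemma op_le_antisym:
  assumes "X \<preceq> Y" "Y \<preceq> X"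
  shows "X = Y"
proof -
  have "norm (X - Y) \<le> 0"
    by (rule sa_norm_le) (use assms in \<open>auto simp: op_le_iff blinfun.diff_left ip_simps intro: antisym\<close>)
  then show ?thesis by simp
qed

lemma karcher_equation_unique_solution:
  assumes \<mu>: "\<mu> \<in> bdd_prob_measures"
  shows "\<exists>!X. X \<in> pos_def_ops \<and> karcher_equation \<mu> X"
proof -
  obtain r where r: "0 \<le> r" "supported_between (exp (- r)) (exp r) \<mu>" using bdd_prob_measures_supported[OF \<mu>] by blast
  have "\<exists>X. X \<in> pos_def_ops \<and> karcher_equation \<mu> X"
    by (rule karcher_solution_exists[OF _ _ r(2)]) (use r in auto)
  moreover have "X = Y" if X: "X \<in> pos_def_ops" "karcher_equation \<mu> X" and Y: "Y \<in> pos_def_ops" "karcher_equation \<mu> Y" for X Y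
  proof -
    obtain a b where ab: "0 < a" "a \<le> b" and bX: "X \<in> op_between a b" and bY: "Y \<in> op_between a b" and s: "supported_between a b \<mu>"
      using common_bounds[OF X(1) Y(1) \<mu> \<mu>] by metis
    show ?thesis
      using solution_comparison[OF ab s s coupled_below_self[OF s] bX X(2) bY Y(2)]
        solution_comparison[OF ab s s coupled_below_self[OF s] bY Y(2) bX X(2)]
      by (rule op_le_antisym)
  qed
  ultimately show ?thesis by blast
qed

theorem theorem1p1:
  shows "(\<forall>\<mu> \<in> (bdd_prob_measures ::
            ((real \<Rightarrow> real) \<times> ('e::complex_hilbert_space \<Rightarrow>\<^sub>L 'e)) measure set).
            \<exists>!X. X \<in> pos_def_ops \<and> karcher_equation \<mu> X) \<and>
         (\<forall>\<mu>\<^sub>1 \<in> (bdd_prob_measures ::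
            ((real \<Rightarrow> real) \<times> ('e \<Rightarrow>\<^sub>L 'e)) measure set). \<forall>\<mu>\<^sub>2 \<in> bdd_prob_measures.
            measure_le TYPE('w) \<mu>\<^sub>1 \<mu>\<^sub>2 \<longrightarrow> karcher_solution \<mu>\<^sub>1 \<preceq> karcher_solution \<mu>\<^sub>2)"
proof (intro conjI ballI impI)
  fix \<mu> :: "((real \<Rightarrow> real) \<times> ('e \<Rightarrow>\<^sub>L 'e)) measure" assume "\<mu> \<in> bdd_prob_measures"
  then show "\<exists>!X. X \<in> pos_def_ops \<and> karcher_equation \<mu> X" by (rule karcher_equation_unique_solution)
next
  fix \<mu>\<^sub>1 \<mu>\<^sub>2 :: "((real \<Rightarrow> real) \<times> ('e \<Rightarrow>\<^sub>L 'e)) measure"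
  assume \<mu>: "\<mu>\<^sub>1 \<in> bdd_prob_measures" "\<mu>\<^sub>2 \<in> bdd_prob_measures" and "measure_le TYPE('w) \<mu>\<^sub>1 \<mu>\<^sub>2"
  then obtain \<Omega> :: "'w set" and \<pi> F\<^sub>1 F\<^sub>2 where
    "coupled_below \<mu>\<^sub>1 \<mu>\<^sub>2 (\<pi> :: ((real \<Rightarrow> real) \<times> 'w) measure) F\<^sub>1 F\<^sub>2"
    unfolding measure_le_def coupled_below_def by fastforce
  note coupled = this
  have sol: "karcher_solution \<mu> \<in> pos_def_ops \<and> karcher_equation \<mu> (karcher_solution \<mu>)"
    if "\<mu> \<in> bdd_prob_measures" for \<mu> :: "((real \<Rightarrow> real) \<times> ('e \<Rightarrow>\<^sub>L 'e)) measure"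
    unfolding karcher_solution_def by (rule theI'[OF karcher_equation_unique_solution[OF that]])
  obtain a b where ab: "0 < a" "a \<le> b"
    and X: "karcher_solution \<mu>\<^sub>1 \<in> op_between a b" "karcher_solution \<mu>\<^sub>2 \<in> op_between a b"
    and s: "supported_between a b \<mu>\<^sub>1" "supported_between a b \<mu>\<^sub>2"
    using common_bounds[of "karcher_solution \<mu>\<^sub>1" "karcher_solution \<mu>\<^sub>2", OF _ _ \<mu>] sol \<mu> by metis
  show "karcher_solution \<mu>\<^sub>1 \<preceq> karcher_solution \<mu>\<^sub>2"
    using solution_comparison[OF ab s coupled X(1) _ X(2)] sol \<mu> by blast
qed

end
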